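(* Let $0\le\beta\le\alpha$ be real numbers, and for $n\in\mathbb{Z}_{\ge0}$ let $T_n^{\alpha,\beta}$ denote the convolution operator on $\mathbb{T}=\mathbb{R}/2\pi\mathbb{Z}$ with kernel $\theta\mapsto P_n^{(\alpha,\beta)}(\cos\theta)$, $\theta\in\mathbb{T}$, where $P_n^{(\alpha,\beta)}$ is the Jacobi polynomial. Assume that one of the following holds: (1) $\alpha>\frac12$; (2) $0\le\alpha<\frac12$; (3) $\alpha=\beta=\frac12$. Then for every $p$ with $2\le p\le\infty$ there is a constant $C$, depending only on $\alpha,\beta,p$, such that for all $n\in\mathbb{Z}_{\ge0}$ $$\|T_n^{\alpha,\beta}\|_{L^{p'}(\mathbb{T})\to L^p(\mathbb{T})}\le C\,A(\alpha,p/2,n),$$ where $p'$ is the conjugate exponent of $p$ and, for $\delta\ge0$, $q>0$, $n\ge0$, $$A(\delta,q,n):=\begin{cases}(n+1)^{\delta-\frac1q}, & q>\frac{1}{\delta+\frac12},\\[2pt](n+1)^{-\frac12}, & 0<q\le\frac1{\delta+\frac12}.\end{cases}$$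
   Context: The Jacobi polynomials $P_n^{(\alpha,\beta)}(x)$, $n\in\mathbb{Z}_{\ge0}$, are the orthogonal polynomials ($\deg P_n^{(\alpha,\beta)}=n$) on $[-1,1]$ with weight $(1-x)^\alpha(1+x)^\beta$, normalized by $P_n^{(\alpha,\beta)}(1)=\binom{n+\alpha}{n}=\frac{\Gamma(n+\alpha+1)}{n!\,\Gamma(\alpha+1)}$. Convention: $1/q=0$ for $q=\infty$. Convolution on $\mathbb{T}$ is $(g*K)(\theta)=\int_{\mathbb{T}}g(\theta')K(\theta-\theta')\,d\theta'$. *)

theory Defs
  imports
    "HOL-Analysis.Analysis"
    "HOL-Computational_Algebra.Polynomial"
    "HOL-Probability.Essential_Supremum"
begin

section \<open>Jacobi polynomials\<close>

text \<open>Meant for parameters \<open>\<alpha>, \<beta> > -1\<close>. At the endpoints \<open>x = \<plusminus>1\<close> the convention \<open>0 powr 0 = 0\<close>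
  changes the weight only on a null set.\<close>

definition jacobi_family :: "real \<Rightarrow> real \<Rightarrow> (nat \<Rightarrow> real poly) \<Rightarrow> bool" where
  "jacobi_family \<alpha> \<beta> P \<longleftrightarrow>
     (\<forall>n. degree (P n) = n) \<and>
     (\<forall>m n. m \<noteq> n \<longrightarrow>
        (LBINT x:{-1..1}. poly (P m) x * poly (P n) x *
           ((1 - x) powr \<alpha> * (1 + x) powr \<beta>)) = 0) \<and>
     (\<forall>n. poly (P n) 1 = (real n + \<alpha>) gchoose n)"

text \<open>For \<open>\<alpha>, \<beta> > -1\<close> exactly one family satisfies these conditions.\<close>

definition jacobi :: "real \<Rightarrow> real \<Rightarrow> nat \<Rightarrow> real poly" where
  "jacobi \<alpha> \<beta> = (THE P. jacobi_family \<alpha> \<beta> P)"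

section \<open>Lebesgue spaces on the torus\<close>

text \<open>A function on \<open>\<real>/2\<pi>\<int>\<close> is a function on the line with period \<open>2\<pi>\<close>;
  integrals over the torus are taken, with the measure \<open>d\<theta>\<close> of total mass \<open>2\<pi>\<close>, over the
  fundamental domain \<open>[0, 2\<pi>)\<close>.\<close>

definition torus :: "real measure" where
  "torus = lebesgue_on {0..<2 * pi}"

definition torus_norm :: "ennreal \<Rightarrow> (real \<Rightarrow> complex) \<Rightarrow> ennreal" where
  "torus_norm p f =
     (if p = \<infinity> then esssup torus (\<lambda>\<theta>. ennreal (norm (f \<theta>)))
      else let I = (\<integral>\<^sup>+ \<theta>. ennreal (norm (f \<theta>) powr enn2real p) \<partial>torus)
           in if I = \<infinity> then \<infinity> else ennreal (enn2real I powr (1 / enn2real p)))"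

definition torus_Lp :: "ennreal \<Rightarrow> (real \<Rightarrow> complex) set" where
  "torus_Lp p =
     {f. (\<forall>\<theta>. f (\<theta> + 2 * pi) = f \<theta>) \<and> f \<in> borel_measurable torus \<and> torus_norm p f < \<infinity>}"

definition torus_opnorm ::
    "ennreal \<Rightarrow> ennreal \<Rightarrow> ((real \<Rightarrow> complex) \<Rightarrow> (real \<Rightarrow> complex)) \<Rightarrow> ennreal" where
  "torus_opnorm q p T = (SUP f\<in>{f \<in> torus_Lp q. torus_norm q f \<le> 1}. torus_norm p (T f))"

definition torus_conv :: "(real \<Rightarrow> complex) \<Rightarrow> (real \<Rightarrow> complex) \<Rightarrow> real \<Rightarrow> complex" where
  "torus_conv g K \<theta> = (LINT \<theta>'|torus. g \<theta>' * K (\<theta> - \<theta>'))"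

definition jacobi_conv ::
    "real \<Rightarrow> real \<Rightarrow> nat \<Rightarrow> (real \<Rightarrow> complex) \<Rightarrow> (real \<Rightarrow> complex)" where
  "jacobi_conv \<alpha> \<beta> n g =
     torus_conv g (\<lambda>\<theta>. complex_of_real (poly (jacobi \<alpha> \<beta> n) (cos \<theta>)))"

text \<open>For \<open>q = \<infinity>\<close>, \<open>inverse q = 0\<close> holds in \<^typ>\<open>ennreal\<close>, in line with the convention \<open>1/q = 0\<close>.\<close>

definition A_bound :: "real \<Rightarrow> ennreal \<Rightarrow> nat \<Rightarrow> real" where
  "A_bound \<delta> q n =
     (if q > ennreal (1 / (\<delta> + 1 / 2))
      then (real n + 1) powr (\<delta> - enn2real (inverse q))
      else (real n + 1) powr (- 1 / 2))"

end

theory Submission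
  imports Defs
begin

text \<open>Write \<open>N = n + 1\<close>, \<open>a = \<alpha> + 1/2\<close> and \<open>s = \<bar>sin \<theta>\<bar>\<close>. Energy estimates for the Jacobi differential
  equation give \<open>\<bar>P (cos \<theta>)\<bar> \<le> C N powr (-1/2) * max s (1/N) powr (-a)\<close>: Sonine's function bounds
  everything by the values at the endpoints, and a corrected weighted energy carries the bound from
  \<open>s \<approx> 1/N\<close> to the whole circle. For \<open>2 < p < \<infinity>\<close> this kernel is at most \<open>A(\<alpha>, p/2, n)\<close> times
  \<open>max s (1/N) powr (-2/p)\<close>, up to a constant, so the Hardy--Littlewood--Sobolev inequality covers
  the critical exponent together with all others. For \<open>p = \<infinity>\<close> the supremum of the kernel suffices, for \<open>p = 2\<close>
  and \<open>\<alpha> \<noteq> 1/2\<close> its \<open>L\<^sup>1\<close> norm. For \<open>p = 2\<close> and \<open>\<alpha> = \<beta> = 1/2\<close>, where the \<open>L\<^sup>1\<close> norm is too large by a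
  logarithm, the kernel is a multiple of \<open>sin (N \<theta>) / sin \<theta>\<close>, whose Fourier coefficients are bounded.\<close>

text \<open>The factor \<open>N powr (-1/2)\<close> comes from the matching point: at
  \<open>s = 1/N\<close> the endpoint size \<open>N powr \<alpha>\<close> equals
  \<open>N powr (-1/2) * s powr (-a)\<close>. The obstacle for \<open>p > 2\<close> is the critical
  exponent \<open>2/p = a\<close>. There the majorant of the kernel is exactly as singular as
  \<open>s powr (-2/p)\<close>, its norm in \<open>L^(p/2)\<close> grows with a power of
  \<open>ln N\<close>, and Young's convolution inequality would lose that factor. The
  Hardy--Littlewood--Sobolev inequality asks only for weak \<open>L^(p/2)\<close>, so nothing is
  lost. It breaks down at \<open>p = 2\<close>, where the singularity has order 1. Absolute values
  still suffice there if \<open>a \<noteq> 1\<close>, because the integral of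
  \<open>max s (1/N) powr (-a)\<close> is then bounded or of the size of a pure power of
  \<open>N\<close>. At \<open>a = 1\<close> it is logarithmic, and only the oscillation of the
  kernel can remove the logarithm.\<close>

section \<open>Jacobi polynomials by their differential equation\<close>

text \<open>The hypergeometric expansion in powers of \<open>t = (1 - x) / 2\<close>.\<close>

definition jacobi_coeff :: "real \<Rightarrow> real \<Rightarrow> nat \<Rightarrow> nat \<Rightarrow> real" where
  "jacobi_coeff \<alpha> \<beta> n k = (if k \<le> n then (-1) ^ k * pochhammer (real n + \<alpha> + \<beta> + 1) k / fact k *
     (pochhammer (\<alpha> + real k + 1) (n - k) / fact (n - k)) else 0)"

definition jacobi_hyp :: "real \<Rightarrow> real \<Rightarrow> nat \<Rightarrow> real poly" where
  "jacobi_hyp \<alpha> \<beta> n = (\<Sum>k\<le>n. monom (jacobi_coeff \<alpha> \<beta> n k) k)"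

definition jacobi_poly :: "real \<Rightarrow> real \<Rightarrow> nat \<Rightarrow> real poly" where
  "jacobi_poly \<alpha> \<beta> n = pcompose (jacobi_hyp \<alpha> \<beta> n) [:1/2, -1/2:]"

definition jacobi_eigenvalue :: "real \<Rightarrow> real \<Rightarrow> nat \<Rightarrow> real" where
  "jacobi_eigenvalue \<alpha> \<beta> n = real n * (real n + \<alpha> + \<beta> + 1)"

definition jacobi_ode :: "real \<Rightarrow> real \<Rightarrow> nat \<Rightarrow> real poly \<Rightarrow> bool" where
  "jacobi_ode \<alpha> \<beta> n p \<longleftrightarrow>
     (\<forall>x. (1 - x\<^sup>2) * poly (pderiv (pderiv p)) x
       + (\<beta> - \<alpha> - (\<alpha> + \<beta> + 2) * x) * poly (pderiv p) x
       + jacobi_eigenvalue \<alpha> \<beta> n * poly p x = 0)"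

lemma coeff_jacobi_hyp: "coeff (jacobi_hyp \<alpha> \<beta> n) k = jacobi_coeff \<alpha> \<beta> n k"
  by (simp add: jacobi_hyp_def coeff_sum coeff_monom) (simp add: jacobi_coeff_def)

text \<open>The ratio of consecutive hypergeometric coefficients with denominators cleared. In this
  form it holds for every \<open>k\<close>: at \<open>k = n\<close> the factor
  \<open>real k - real n\<close> vanishes, and beyond that both coefficients are 0.\<close>

lemma jacobi_coeff_Suc:
  "(real k + 1) * (real k + \<alpha> + 1) * jacobi_coeff \<alpha> \<beta> n (Suc k) =
     (real k - real n) * (real k + real n + \<alpha> + \<beta> + 1) * jacobi_coeff \<alpha> \<beta> n k"
proof (cases "k < n")
  case True
  define m where "m = n - Suc k"
  have m: "n - k = Suc m" "n - Suc k = m" "real n = real m + real k + 1"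
    using True by (auto simp: m_def of_nat_diff)
  define A where "A = (-1) ^ k * pochhammer (real n + \<alpha> + \<beta> + 1) k / fact k"
  define B where "B = pochhammer (\<alpha> + real k + 1 + 1) m / fact m"
  have "\<alpha> + real (Suc k) + 1 = \<alpha> + real k + 1 + 1" by simp
  then have s: "(real k + 1) * jacobi_coeff \<alpha> \<beta> n (Suc k) = - A * (real n + \<alpha> + \<beta> + 1 + real k) * B"
    using True by (simp add: jacobi_coeff_def A_def B_def m pochhammer_Suc Suc_leI divide_simps)
  have t: "(real m + 1) * jacobi_coeff \<alpha> \<beta> n k = A * (\<alpha> + real k + 1) * B"
    using True by (simp add: jacobi_coeff_def A_def B_def m(1) pochhammer_rec divide_simps)
  have "(real k + 1) * (real k + \<alpha> + 1) * jacobi_coeff \<alpha> \<beta> n (Suc k)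
      = (real k + \<alpha> + 1) * (- A * (real n + \<alpha> + \<beta> + 1 + real k) * B)"
    unfolding s[symmetric] by simp
  also have "\<dots> = - (real k + real n + \<alpha> + \<beta> + 1) * ((real m + 1) * jacobi_coeff \<alpha> \<beta> n k)"
    unfolding t by (simp add: algebra_simps)
  also have "real m + 1 = real n - real k"
    by (simp add: m(3))
  finally show ?thesis by (simp add: algebra_simps)
next
  case False
  then show ?thesis by (cases "k = n") (auto simp: jacobi_coeff_def)
qed

text \<open>The coefficient of \<open>t ^ k\<close> in this hypergeometric equation is the
  recurrence \<open>jacobi_coeff_Suc\<close>, since \<open>k * (k + \<alpha> + \<beta> + 1) - n * (n
  + \<alpha> + \<beta> + 1)\<close> factors as
  \<open>(k - n) * (k + n + \<alpha> + \<beta> + 1)\<close>.\<close>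

lemma jacobi_hyp_ode:
  "[:0, 1, -1:] * pderiv (pderiv (jacobi_hyp \<alpha> \<beta> n))
    + [:\<alpha> + 1, -(\<alpha> + \<beta> + 2):] * pderiv (jacobi_hyp \<alpha> \<beta> n)
    + smult (jacobi_eigenvalue \<alpha> \<beta> n) (jacobi_hyp \<alpha> \<beta> n) = 0"
proof (rule poly_eqI)
  fix k
  have r: "(real k + 1) * (real k + \<alpha> + 1) * jacobi_coeff \<alpha> \<beta> n (Suc k) =
     (real k - real n) * (real k + real n + \<alpha> + \<beta> + 1) * jacobi_coeff \<alpha> \<beta> n k"
    by (rule jacobi_coeff_Suc)
  show "coeff ([:0, 1, -1:] * pderiv (pderiv (jacobi_hyp \<alpha> \<beta> n))
    + [:\<alpha> + 1, -(\<alpha> + \<beta> + 2):] * pderiv (jacobi_hyp \<alpha> \<beta> n)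
    + smult (jacobi_eigenvalue \<alpha> \<beta> n) (jacobi_hyp \<alpha> \<beta> n)) k = coeff 0 k"
    using r
    by (cases k; cases "k - 1")
       (auto simp: coeff_jacobi_hyp coeff_pderiv coeff_pCons jacobi_eigenvalue_def algebra_simps)
qed

lemma jacobi_poly_ode: "jacobi_ode \<alpha> \<beta> n (jacobi_poly \<alpha> \<beta> n)"
  unfolding jacobi_ode_def
proof
  fix x :: real
  define q where "q = jacobi_hyp \<alpha> \<beta> n"
  define t where "t = (1 - x) / 2"
  have p: "poly (jacobi_poly \<alpha> \<beta> n) x = poly q t"
    and d: "poly (pderiv (jacobi_poly \<alpha> \<beta> n)) x = - poly (pderiv q) t / 2"
    and dd: "poly (pderiv (pderiv (jacobi_poly \<alpha> \<beta> n))) x = poly (pderiv (pderiv q)) t / 4"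
    by (simp_all add: jacobi_poly_def q_def t_def poly_pcompose pderiv_pcompose pderiv_mult
        pderiv_pCons pderiv_minus pderiv_smult field_simps)
  have "poly ([:0, 1, -1:] * pderiv (pderiv q) + [:\<alpha> + 1, -(\<alpha> + \<beta> + 2):] * pderiv q
    + smult (jacobi_eigenvalue \<alpha> \<beta> n) q) t = 0"
    unfolding q_def jacobi_hyp_ode by simp
  then have e: "t * (1 - t) * poly (pderiv (pderiv q)) t + (\<alpha> + 1 - (\<alpha> + \<beta> + 2) * t) * poly (pderiv q) t
     + jacobi_eigenvalue \<alpha> \<beta> n * poly q t = 0"
    by (simp add: algebra_simps)
  have "1 - x\<^sup>2 = 4 * (t * (1 - t))" by (simp add: t_def power2_eq_square field_simps)
  moreover have "\<beta> - \<alpha> - (\<alpha> + \<beta> + 2) * x = - 2 * (\<alpha> + 1 - (\<alpha> + \<beta> + 2) * t)"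
    by (simp add: t_def field_simps)
  ultimately show "(1 - x\<^sup>2) * poly (pderiv (pderiv (jacobi_poly \<alpha> \<beta> n))) x
       + (\<beta> - \<alpha> - (\<alpha> + \<beta> + 2) * x) * poly (pderiv (jacobi_poly \<alpha> \<beta> n)) x
       + jacobi_eigenvalue \<alpha> \<beta> n * poly (jacobi_poly \<alpha> \<beta> n) x = 0"
    using e unfolding p d dd by (simp only:)
qed

lemma jacobi_poly_at_1: "poly (jacobi_poly \<alpha> \<beta> n) 1 = (real n + \<alpha>) gchoose n"
proof -
  have "poly (jacobi_poly \<alpha> \<beta> n) 1 = jacobi_coeff \<alpha> \<beta> n 0"
    by (simp add: jacobi_poly_def poly_pcompose poly_0_coeff_0 coeff_jacobi_hyp)
  also have "\<dots> = (real n + \<alpha>) gchoose n"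
    by (simp add: jacobi_coeff_def gbinomial_pochhammer' algebra_simps)
  finally show ?thesis .
qed

text \<open>The signs of the expansion and of the substitution \<open>t = (1 - x) / 2\<close>
  cancel. The resulting leading coefficient is symmetric in \<open>\<alpha>\<close> and
  \<open>\<beta>\<close>, which fixes the constant in \<open>jacobi_poly_reflect\<close>.\<close>

lemma jacobi_poly_degree:
  assumes "0 \<le> \<alpha>" "0 \<le> \<beta>"
  shows "degree (jacobi_poly \<alpha> \<beta> n) = n"
    and "coeff (jacobi_poly \<alpha> \<beta> n) n = pochhammer (real n + \<alpha> + \<beta> + 1) n / fact n / 2 ^ n"
proof -
  have "pochhammer (real n + \<alpha> + \<beta> + 1) n > 0"
    using assms by (intro pochhammer_pos) auto
  then have nz: "jacobi_coeff \<alpha> \<beta> n n \<noteq> 0"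
    by (simp add: jacobi_coeff_def)
  have dh: "degree (jacobi_hyp \<alpha> \<beta> n) = n"
  proof (rule antisym)
    show "degree (jacobi_hyp \<alpha> \<beta> n) \<le> n"
      by (rule degree_le) (simp add: coeff_jacobi_hyp jacobi_coeff_def)
    show "n \<le> degree (jacobi_hyp \<alpha> \<beta> n)"
      by (rule le_degree) (simp add: coeff_jacobi_hyp nz)
  qed
  show d: "degree (jacobi_poly \<alpha> \<beta> n) = n"
    by (simp add: jacobi_poly_def degree_pcompose dh)
  have "lead_coeff (jacobi_poly \<alpha> \<beta> n) = jacobi_coeff \<alpha> \<beta> n n * (-1/2) ^ n"
    unfolding jacobi_poly_def by (subst lead_coeff_comp) (auto simp: dh coeff_jacobi_hyp)
  then show "coeff (jacobi_poly \<alpha> \<beta> n) n = pochhammer (real n + \<alpha> + \<beta> + 1) n / fact n / 2 ^ n"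
    by (cases "even n") (simp_all add: d jacobi_coeff_def power_divide)
qed

section \<open>Uniqueness of polynomial solutions and reflection\<close>

lemma jacobi_eigenvalue_inj:
  assumes "0 \<le> \<alpha>" "0 \<le> \<beta>" "jacobi_eigenvalue \<alpha> \<beta> m = jacobi_eigenvalue \<alpha> \<beta> n"
  shows "m = n"
proof -
  have "(real m - real n) * (real m + real n + \<alpha> + \<beta> + 1) = 0"
    using assms(3) by (simp add: jacobi_eigenvalue_def algebra_simps)
  then show ?thesis using assms(1,2) by (auto simp: add_nonneg_eq_0_iff)
qed

text \<open>The top coefficient of the equation is the difference of the eigenvalues of
  \<open>n\<close> and \<open>degree p\<close>, times the leading coefficient of \<open>p\<close>,
  and the eigenvalues are distinct. Consequently two polynomial solutions with the same coefficient
  at \<open>n\<close> coincide.\<close>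

lemma jacobi_ode_degree:
  assumes "0 \<le> \<alpha>" "0 \<le> \<beta>" "jacobi_ode \<alpha> \<beta> n p" "p \<noteq> 0"
  shows "degree p = n"
proof -
  define k where "k = degree p"
  have "poly ([:1, 0, -1:] * pderiv (pderiv p) + [:\<beta> - \<alpha>, -(\<alpha> + \<beta> + 2):] * pderiv p
    + smult (jacobi_eigenvalue \<alpha> \<beta> n) p) = poly 0"
    using assms(3) by (simp add: jacobi_ode_def fun_eq_iff power2_eq_square algebra_simps)
  then have "coeff ([:1, 0, -1:] * pderiv (pderiv p) + [:\<beta> - \<alpha>, -(\<alpha> + \<beta> + 2):] * pderiv p
    + smult (jacobi_eigenvalue \<alpha> \<beta> n) p) k = 0"
    by (simp only: poly_eq_poly_eq_iff) simp
  moreover have "coeff p (Suc k) = 0" "coeff p (Suc (Suc k)) = 0"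
    by (auto simp: k_def coeff_eq_0)
  ultimately have "(jacobi_eigenvalue \<alpha> \<beta> n - jacobi_eigenvalue \<alpha> \<beta> k) * coeff p k = 0"
    by (cases k; cases "k - 1")
       (auto simp: coeff_pderiv coeff_pCons jacobi_eigenvalue_def algebra_simps)
  then show ?thesis
    using assms(1,2,4) jacobi_eigenvalue_inj[of \<alpha> \<beta> n k] by (auto simp: k_def)
qed

text \<open>Replacing \<open>x\<close> by \<open>- x\<close> exchanges \<open>\<alpha>\<close> and
  \<open>\<beta>\<close> in the differential equation. Both sides therefore solve the same equation
  with the same leading coefficient, and their difference is 0 by \<open>jacobi_ode_degree\<close>.
  The purpose is the value at the endpoint -1.\<close>

lemma jacobi_poly_reflect:
  assumes "0 \<le> \<alpha>" "0 \<le> \<beta>"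
  shows "poly (jacobi_poly \<alpha> \<beta> n) (- x) = (-1) ^ n * poly (jacobi_poly \<beta> \<alpha> n) x"
proof -
  define q where "q = smult ((-1) ^ n) (pcompose (jacobi_poly \<alpha> \<beta> n) [:0, -1:])"
  have px: "poly q x = (-1) ^ n * poly (jacobi_poly \<alpha> \<beta> n) (- x)" for x
    by (simp add: q_def poly_pcompose)
  have d: "poly (pderiv q) x = - ((-1) ^ n) * poly (pderiv (jacobi_poly \<alpha> \<beta> n)) (- x)" for x
    by (simp add: q_def poly_pcompose pderiv_smult pderiv_pcompose pderiv_pCons)
  have dd: "poly (pderiv (pderiv q)) x = (-1) ^ n * poly (pderiv (pderiv (jacobi_poly \<alpha> \<beta> n))) (- x)" for x
    by (simp add: q_def poly_pcompose pderiv_smult pderiv_pcompose pderiv_pCons pderiv_mult pderiv_minus)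
  have "jacobi_ode \<beta> \<alpha> n q"
    unfolding jacobi_ode_def
  proof
    fix x
    have "(1 - (-x)\<^sup>2) * poly (pderiv (pderiv (jacobi_poly \<alpha> \<beta> n))) (-x)
       + (\<beta> - \<alpha> - (\<alpha> + \<beta> + 2) * (-x)) * poly (pderiv (jacobi_poly \<alpha> \<beta> n)) (-x)
       + jacobi_eigenvalue \<alpha> \<beta> n * poly (jacobi_poly \<alpha> \<beta> n) (-x) = 0"
      using jacobi_poly_ode[of \<alpha> \<beta> n] unfolding jacobi_ode_def by blast
    then have "(-1) ^ n * ((1 - (-x)\<^sup>2) * poly (pderiv (pderiv (jacobi_poly \<alpha> \<beta> n))) (-x)
       + (\<beta> - \<alpha> - (\<alpha> + \<beta> + 2) * (-x)) * poly (pderiv (jacobi_poly \<alpha> \<beta> n)) (-x)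
       + jacobi_eigenvalue \<alpha> \<beta> n * poly (jacobi_poly \<alpha> \<beta> n) (-x)) = 0" by simp
    then show "(1 - x\<^sup>2) * poly (pderiv (pderiv q)) x + (\<alpha> - \<beta> - (\<beta> + \<alpha> + 2) * x) * poly (pderiv q) x
       + jacobi_eigenvalue \<beta> \<alpha> n * poly q x = 0"
      unfolding px d dd by (simp add: jacobi_eigenvalue_def algebra_simps)
  qed
  then have ode: "jacobi_ode \<beta> \<alpha> n (q - jacobi_poly \<beta> \<alpha> n)"
    using jacobi_poly_ode[of \<beta> \<alpha> n]
    unfolding jacobi_ode_def pderiv_diff poly_diff right_diff_distrib
    by (metis (no_types, opaque_lifting) add_diff_add diff_0_right)
  have dq: "degree q = n"
    using assms by (simp add: q_def degree_pcompose jacobi_poly_degree(1))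
  have "lead_coeff q = coeff (jacobi_poly \<alpha> \<beta> n) n"
    unfolding q_def lead_coeff_smult using assms
    by (subst lead_coeff_comp) (cases "even n"; simp add: jacobi_poly_degree(1))+
  then have c: "coeff (q - jacobi_poly \<beta> \<alpha> n) n = 0"
    using assms by (simp add: dq jacobi_poly_degree(2) add.commute add.left_commute)
  have "q - jacobi_poly \<beta> \<alpha> n = 0"
  proof (rule ccontr)
    assume nz: "q - jacobi_poly \<beta> \<alpha> n \<noteq> 0"
    then have "degree (q - jacobi_poly \<beta> \<alpha> n) = n"
      using jacobi_ode_degree[OF assms(2,1) ode] by simp
    then show False using nz c leading_coeff_0_iff by metis
  qed
  then have "poly q x = poly (jacobi_poly \<beta> \<alpha> n) x" by simp
  then have "(-1) ^ n * ((-1) ^ n * poly (jacobi_poly \<alpha> \<beta> n) (- x)) = (-1) ^ n * poly (jacobi_poly \<beta> \<alpha> n) x"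
    unfolding px by simp
  then show ?thesis by (simp flip: power_mult_distrib mult.assoc)
qed

section \<open>Orthogonality and identification with \<open>jacobi\<close>\<close>

lemma jacobi_weight_integrable:
  fixes \<alpha> \<beta> :: real and p :: "real poly"
  assumes "0 \<le> \<alpha>" "0 \<le> \<beta>"
  shows "set_integrable lborel {-1..1} (\<lambda>x. poly p x * ((1 - x) powr \<alpha> * (1 + x) powr \<beta>))"
proof -
  have "compact ((\<lambda>x. poly p x) ` {-1..1::real})"
    by (intro compact_continuous_image continuous_intros) auto
  then obtain B where B: "\<And>x. x \<in> {-1..1} \<Longrightarrow> norm (poly p x) \<le> B"
    by (metis (no_types, opaque_lifting) bounded_iff compact_imp_bounded image_eqI real_norm_def)
  show ?thesis
    unfolding set_integrable_def
  proof (rule integrableI_bounded_set_indicator[where B = "B * (2 powr \<alpha> * 2 powr \<beta>)"])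
    show "AE x in lborel. x \<in> {-1..1} \<longrightarrow>
      norm (poly p x * ((1 - x) powr \<alpha> * (1 + x) powr \<beta>)) \<le> B * (2 powr \<alpha> * 2 powr \<beta>)"
    proof (intro AE_I2 impI)
      fix x :: real assume x: "x \<in> {-1..1}"
      have "(1 - x) powr \<alpha> \<le> 2 powr \<alpha>" "(1 + x) powr \<beta> \<le> 2 powr \<beta>"
        using x assms by (auto intro!: powr_mono2)
      with B[OF x] show "norm (poly p x * ((1 - x) powr \<alpha> * (1 + x) powr \<beta>)) \<le> B * (2 powr \<alpha> * 2 powr \<beta>)"
        by (auto simp: abs_mult intro!: mult_mono)
    qed
    have "continuous_on UNIV (poly p)" by (intro continuous_intros)
    then have [measurable]: "poly p \<in> borel_measurable borel"
      by (rule borel_measurable_continuous_onI)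
    show "(\<lambda>x. poly p x * ((1 - x) powr \<alpha> * (1 + x) powr \<beta>)) \<in> borel_measurable lborel"
      by measurable
  qed auto
qed

text \<open>Sturm--Liouville argument: \<open>U\<close> is the Wronskian of the two polynomials
  times \<open>1 - x^2\<close> times the weight. By the two differential equations its derivative is
  the integrand times the difference \<open>E\<close> of the eigenvalues, and \<open>U\<close>
  vanishes at both endpoints.\<close>

lemma jacobi_poly_orthogonal:
  assumes "0 \<le> \<alpha>" "0 \<le> \<beta>" "m \<noteq> n"
  shows "(LBINT x:{-1..1}. poly (jacobi_poly \<alpha> \<beta> m) x * poly (jacobi_poly \<alpha> \<beta> n) x *
           ((1 - x) powr \<alpha> * (1 + x) powr \<beta>)) = 0"
proof -
  define p where "p = jacobi_poly \<alpha> \<beta> m"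
  define q where "q = jacobi_poly \<alpha> \<beta> n"
  define E where "E = jacobi_eigenvalue \<alpha> \<beta> n - jacobi_eigenvalue \<alpha> \<beta> m"
  define U :: "real \<Rightarrow> real" where "U = (\<lambda>x. ((1 - x) powr (\<alpha> + 1) * (1 + x) powr (\<beta> + 1)) *
     (poly (pderiv p) x * poly q x - poly p x * poly (pderiv q) x))"
  have "((\<lambda>x. E * (poly p x * poly q x * ((1 - x) powr \<alpha> * (1 + x) powr \<beta>))) has_integral (U 1 - U (-1))) {-1..1}"
  proof (rule fundamental_theorem_of_calculus_interior)
    show "continuous_on {-1..1} U"
      unfolding U_def using assms by (intro continuous_intros continuous_on_powr') auto
    fix x :: real assume x: "x \<in> {-1<..<1}"
    have ap: "(1 - x) powr (\<alpha> + 1) = (1 - x) * (1 - x) powr \<alpha>" "(1 + x) powr (\<beta> + 1) = (1 + x) * (1 + x) powr \<beta>"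
      using x by (simp_all add: powr_add)
    have odep: "(1 - x\<^sup>2) * poly (pderiv (pderiv p)) x
       + (\<beta> - \<alpha> - (\<alpha> + \<beta> + 2) * x) * poly (pderiv p) x
       + jacobi_eigenvalue \<alpha> \<beta> m * poly p x = 0"
      using jacobi_poly_ode[of \<alpha> \<beta> m] by (simp add: jacobi_ode_def p_def)
    have odeq: "(1 - x\<^sup>2) * poly (pderiv (pderiv q)) x
       + (\<beta> - \<alpha> - (\<alpha> + \<beta> + 2) * x) * poly (pderiv q) x
       + jacobi_eigenvalue \<alpha> \<beta> n * poly q x = 0"
      using jacobi_poly_ode[of \<alpha> \<beta> n] by (simp add: jacobi_ode_def q_def)
    have "(U has_real_derivative
      ((- (\<alpha> + 1) * (1 - x) powr \<alpha> * (1 + x) powr (\<beta> + 1) + (1 - x) powr (\<alpha> + 1) * ((\<beta> + 1) * (1 + x) powr \<beta>)) *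
       (poly (pderiv p) x * poly q x - poly p x * poly (pderiv q) x) +
       ((1 - x) powr (\<alpha> + 1) * (1 + x) powr (\<beta> + 1)) *
       (poly (pderiv (pderiv p)) x * poly q x - poly p x * poly (pderiv (pderiv q)) x))) (at x)"
      unfolding U_def
      by (rule derivative_eq_intros refl DERIV_powr poly_DERIV | use x in simp; fail)+
         (use x in \<open>simp add: algebra_simps powr_diff powr_add\<close>)
    moreover have "((- (\<alpha> + 1) * (1 - x) powr \<alpha> * (1 + x) powr (\<beta> + 1) + (1 - x) powr (\<alpha> + 1) * ((\<beta> + 1) * (1 + x) powr \<beta>)) *
       (poly (pderiv p) x * poly q x - poly p x * poly (pderiv q) x) +
       ((1 - x) powr (\<alpha> + 1) * (1 + x) powr (\<beta> + 1)) *
       (poly (pderiv (pderiv p)) x * poly q x - poly p x * poly (pderiv (pderiv q)) x)) =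
       ((1 - x) powr \<alpha> * (1 + x) powr \<beta>) *
       (((1 - x\<^sup>2) * poly (pderiv (pderiv p)) x + (\<beta> - \<alpha> - (\<alpha> + \<beta> + 2) * x) * poly (pderiv p) x) * poly q x
       - ((1 - x\<^sup>2) * poly (pderiv (pderiv q)) x + (\<beta> - \<alpha> - (\<alpha> + \<beta> + 2) * x) * poly (pderiv q) x) * poly p x)"
      unfolding ap by (simp add: algebra_simps power2_eq_square)
    moreover have "\<dots> = E * (poly p x * poly q x * ((1 - x) powr \<alpha> * (1 + x) powr \<beta>))"
    proof -
      have "(1 - x\<^sup>2) * poly (pderiv (pderiv p)) x + (\<beta> - \<alpha> - (\<alpha> + \<beta> + 2) * x) * poly (pderiv p) x
         = - jacobi_eigenvalue \<alpha> \<beta> m * poly p x"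
        "(1 - x\<^sup>2) * poly (pderiv (pderiv q)) x + (\<beta> - \<alpha> - (\<alpha> + \<beta> + 2) * x) * poly (pderiv q) x
         = - jacobi_eigenvalue \<alpha> \<beta> n * poly q x"
        using odep odeq by linarith+
      then show ?thesis unfolding E_def by (simp only:) (simp add: algebra_simps)
    qed
    ultimately show "(U has_vector_derivative E * (poly p x * poly q x * ((1 - x) powr \<alpha> * (1 + x) powr \<beta>))) (at x)"
      by (simp add: has_real_derivative_iff_has_vector_derivative)
  qed simp
  moreover have "U 1 = 0" "U (-1) = 0" by (simp_all add: U_def)
  moreover have "E \<noteq> 0"
    using jacobi_eigenvalue_inj[of \<alpha> \<beta> n m] assms by (auto simp: E_def)
  ultimately have "((\<lambda>x. poly p x * poly q x * ((1 - x) powr \<alpha> * (1 + x) powr \<beta>)) has_integral 0) {-1..1}"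
    using has_integral_mult_right[of "\<lambda>x. E * (poly p x * poly q x * ((1 - x) powr \<alpha> * (1 + x) powr \<beta>))" 0 "{-1..1}" "1 / E"]
    by simp
  moreover have "set_integrable lborel {-1..1} (\<lambda>x. poly p x * poly q x * ((1 - x) powr \<alpha> * (1 + x) powr \<beta>))"
    using jacobi_weight_integrable[OF assms(1,2), of "p * q"] by simp
  ultimately show ?thesis
    by (simp add: set_borel_integral_eq_integral(2) integral_unique flip: p_def q_def)
qed

lemma jacobi_family_jacobi_poly:
  assumes "0 \<le> \<alpha>" "0 \<le> \<beta>"
  shows "jacobi_family \<alpha> \<beta> (jacobi_poly \<alpha> \<beta>)"
  using assms by (auto simp: jacobi_family_def jacobi_poly_degree jacobi_poly_orthogonal jacobi_poly_at_1)

text \<open>Subtracting a multiple of \<open>P k\<close>, where \<open>k = degree p\<close>, lowers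
  the degree. That \<open>P k\<close> is not the zero polynomial is read off from its value at 1,
  because the degree condition alone leaves this open for \<open>k = 0\<close>.\<close>

lemma orthogonal_family_lower_degree:
  assumes "0 \<le> \<alpha>" "0 \<le> \<beta>" and P: "jacobi_family \<alpha> \<beta> P" and "degree p < n"
  shows "(LBINT x:{-1..1}. poly p x * poly (P n) x * ((1 - x) powr \<alpha> * (1 + x) powr \<beta>)) = 0"
  using \<open>degree p < n\<close>
proof (induction "degree p" arbitrary: p rule: less_induct)
  case less
  define k where "k = degree p"
  define c where "c = coeff p k / coeff (P k) k"
  define r where "r = p - smult c (P k)"
  have dk: "degree (P k) = k" using P by (simp add: jacobi_family_def)
  have Pk: "coeff (P k) k \<noteq> 0 \<or> P k = 0" using leading_coeff_0_iff[of "P k"] dk by auto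
  have Pk0: "P k \<noteq> 0"
  proof
    assume "P k = 0"
    then have "(real k + \<alpha>) gchoose k = 0" using P by (auto simp: jacobi_family_def dest: spec[of _ k])
    moreover have "(real k + \<alpha>) gchoose k = pochhammer (\<alpha> + 1) k / fact k"
      by (simp add: gbinomial_pochhammer' algebra_simps)
    moreover have "pochhammer (\<alpha> + 1) k > 0" using assms by (intro pochhammer_pos) auto
    ultimately show False by simp
  qed
  have ck: "coeff r k = 0" using Pk Pk0 by (simp add: r_def c_def)
  have dr: "degree r \<le> k" unfolding r_def using dk by (intro degree_diff_le) (auto simp: k_def)
  have r0: "(LBINT x:{-1..1}. poly r x * poly (P n) x * ((1 - x) powr \<alpha> * (1 + x) powr \<beta>)) = 0"
  proof (cases "r = 0")
    case False
    then have "degree r < k" using dr ck leading_coeff_0_iff[of r] by (cases "degree r = k") auto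
    then show ?thesis using less by (simp add: k_def)
  qed (simp add: set_lebesgue_integral_def)
  have kn: "k \<noteq> n" using less by (simp add: k_def)
  have o: "(LBINT x:{-1..1}. poly (P k) x * poly (P n) x * ((1 - x) powr \<alpha> * (1 + x) powr \<beta>)) = 0"
    using P kn by (simp add: jacobi_family_def)
  have "(LBINT x:{-1..1}. poly p x * poly (P n) x * ((1 - x) powr \<alpha> * (1 + x) powr \<beta>)) =
    (LBINT x:{-1..1}. (poly r x * poly (P n) x * ((1 - x) powr \<alpha> * (1 + x) powr \<beta>)) +
        c * (poly (P k) x * poly (P n) x * ((1 - x) powr \<alpha> * (1 + x) powr \<beta>)))"
    by (simp add: r_def algebra_simps)
  also have "\<dots> = 0"
    using jacobi_weight_integrable[OF assms(1,2), of "r * P n"] jacobi_weight_integrable[OF assms(1,2), of "P k * P n"]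
    by (subst set_integral_add) (auto simp: r0 o)
  finally show ?case .
qed

text \<open>The zeros of the integrand inside \<open>{-1..1}\<close> are roots of \<open>p\<close>
  or endpoints, a finite set. A nonzero \<open>p\<close> would thus make the interval a null
  set.\<close>

lemma jacobi_weighted_square_zero:
  fixes \<alpha> \<beta> :: real and p :: "real poly"
  assumes "0 \<le> \<alpha>" "0 \<le> \<beta>"
    and z: "(LBINT x:{-1..1}. poly p x * poly p x * ((1 - x) powr \<alpha> * (1 + x) powr \<beta>)) = 0"
  shows "p = 0"
proof (rule ccontr)
  assume p: "p \<noteq> 0"
  have "AE x in lborel. indicator {-1..1} x *\<^sub>R (poly p x * poly p x * ((1 - x) powr \<alpha> * (1 + x) powr \<beta>)) = 0"
    using z jacobi_weight_integrable[OF assms(1,2), of "p * p"]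
    unfolding set_lebesgue_integral_def set_integrable_def
    by (subst (asm) integral_nonneg_eq_0_iff_AE) (auto intro!: AE_I2)
  moreover have "AE x in lborel. x \<notin> insert 1 (insert (-1) {x. poly p x = 0})"
    using p by (intro AE_not_in countable_imp_null_set_lborel) (auto intro!: countable_finite poly_roots_finite)
  ultimately have "AE x in lborel. x \<notin> {-1..1::real}"
    by eventually_elim (auto simp: indicator_def powr_eq_0_iff split: if_splits)
  then have "emeasure lborel {-1..1::real} = 0"
    by (subst (asm) AE_iff_measurable[where N = "{-1..1}"]) auto
  then show False by simp
qed

text \<open>After leading coefficients are matched, \<open>r = Q n - smult c J\<close> has degree
  below \<open>n\<close>. It is then orthogonal to \<open>Q n\<close> and to \<open>J\<close>, hence
  to itself, hence zero. The common nonzero value at 1 forces \<open>c = 1\<close>.\<close>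

lemma jacobi_eq_jacobi_poly:
  assumes "0 \<le> \<alpha>" "0 \<le> \<beta>"
  shows "jacobi \<alpha> \<beta> = jacobi_poly \<alpha> \<beta>"
  unfolding jacobi_def
proof (rule the_equality)
  show "jacobi_family \<alpha> \<beta> (jacobi_poly \<alpha> \<beta>)"
    using assms by (rule jacobi_family_jacobi_poly)
  fix Q assume Q: "jacobi_family \<alpha> \<beta> Q"
  show "Q = jacobi_poly \<alpha> \<beta>"
  proof
    fix n
    define J where "J = jacobi_poly \<alpha> \<beta> n"
    define c where "c = coeff (Q n) n / coeff J n"
    define r where "r = Q n - smult c J"
    have dJ: "degree J = n" using assms by (simp add: J_def jacobi_poly_degree)
    have dQ: "degree (Q n) = n" using Q by (simp add: jacobi_family_def)
    have "pochhammer (real n + \<alpha> + \<beta> + 1) n > 0" using assms by (intro pochhammer_pos) auto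
    then have "coeff J n \<noteq> 0" using assms by (simp add: J_def jacobi_poly_degree)
    then have cr: "coeff r n = 0" by (simp add: r_def c_def)
    have dr: "degree r \<le> n" unfolding r_def using dJ dQ by (intro degree_diff_le) auto
    have "r = 0"
    proof (rule ccontr)
      assume r: "r \<noteq> 0"
      then have lt: "degree r < n" using dr cr leading_coeff_0_iff[of r] by (cases "degree r = n") auto
      have 1: "(LBINT x:{-1..1}. poly r x * poly (Q n) x * ((1 - x) powr \<alpha> * (1 + x) powr \<beta>)) = 0"
        by (rule orthogonal_family_lower_degree[OF assms Q lt])
      have 2: "(LBINT x:{-1..1}. poly r x * poly J x * ((1 - x) powr \<alpha> * (1 + x) powr \<beta>)) = 0"
        unfolding J_def by (rule orthogonal_family_lower_degree[OF assms jacobi_family_jacobi_poly[OF assms] lt])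
      have "(LBINT x:{-1..1}. poly r x * poly r x * ((1 - x) powr \<alpha> * (1 + x) powr \<beta>)) =
        (LBINT x:{-1..1}. poly r x * poly (Q n) x * ((1 - x) powr \<alpha> * (1 + x) powr \<beta>) -
        c * (poly r x * poly J x * ((1 - x) powr \<alpha> * (1 + x) powr \<beta>)))"
        unfolding r_def by (simp add: algebra_simps)
      also have "\<dots> = 0"
        using jacobi_weight_integrable[OF assms, of "r * Q n"] jacobi_weight_integrable[OF assms, of "r * J"]
        by (subst set_integral_diff) (auto simp: 1 2)
      finally show False using r jacobi_weighted_square_zero[OF assms] by blast
    qed
    then have Qc: "Q n = smult c J" by (simp add: r_def)
    have "pochhammer (\<alpha> + 1) n > 0" using assms by (intro pochhammer_pos) auto
    moreover have "(real n + \<alpha>) gchoose n = pochhammer (\<alpha> + 1) n / fact n"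
      by (simp add: gbinomial_pochhammer' algebra_simps)
    ultimately have "(real n + \<alpha>) gchoose n \<noteq> 0" by simp
    moreover have "poly (Q n) 1 = (real n + \<alpha>) gchoose n" using Q by (simp add: jacobi_family_def)
    moreover have "poly J 1 = (real n + \<alpha>) gchoose n" by (simp add: J_def jacobi_poly_at_1)
    ultimately have "c = 1" using Qc by simp
    then show "Q n = jacobi_poly \<alpha> \<beta> n" using Qc by (simp add: J_def)
  qed
qed

section \<open>Pointwise bounds for Jacobi polynomials\<close>

text \<open>The binomial coefficient is the product of the factors \<open>1 + \<alpha> / k\<close>
  for \<open>k\<close> from 1 to \<open>n\<close>, each at most
  \<open>exp (\<alpha> / k)\<close>.\<close>

lemma gbinomial_harm_bound:
  assumes "0 \<le> (\<alpha> :: real)"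
  shows "(real n + \<alpha>) gchoose n \<le> exp (\<alpha> * harm n)" "0 \<le> (real n + \<alpha>) gchoose n"
proof -
  have g: "(real n + \<alpha>) gchoose n = pochhammer (\<alpha> + 1) n / fact n" for n
    by (simp add: gbinomial_pochhammer' algebra_simps)
  have nn: "0 \<le> pochhammer (\<alpha> + 1) n" for n
    using assms by (intro less_imp_le pochhammer_pos) auto
  show "0 \<le> (real n + \<alpha>) gchoose n" unfolding g using nn by simp
  show "(real n + \<alpha>) gchoose n \<le> exp (\<alpha> * harm n)"
    unfolding g
  proof (induction n)
    case (Suc n)
    have "pochhammer (\<alpha> + 1) (Suc n) / fact (Suc n) = pochhammer (\<alpha> + 1) n / fact n * (1 + \<alpha> / real (Suc n))"
      by (simp add: pochhammer_Suc divide_simps)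
    also have "\<dots> \<le> exp (\<alpha> * harm n) * exp (\<alpha> / real (Suc n))"
      using assms Suc by (intro mult_mono exp_ge_add_one_self) (auto simp: nn)
    also have "\<dots> = exp (\<alpha> * harm (Suc n))"
      by (simp add: harm_Suc exp_add[symmetric] algebra_simps divide_inverse)
    finally show ?case .
  qed (simp add: harm_def)
qed

lemma harm_le_ln: "harm n \<le> 1 + ln (real n + 1)"
proof (cases n)
  case 0
  then show ?thesis by (simp add: harm_def)
next
  case (Suc m)
  have "harm (Suc m) - ln (real (Suc m)) \<le> harm (Suc 0) - ln (real (Suc 0))"
    using decseq_harm_diff_ln by (rule decseqD) simp
  moreover have "ln (real (Suc m)) \<le> ln (real (Suc m) + 1)" by simp
  moreover have "harm (Suc 0) = (1 :: real)" by (simp add: harm_def)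
  moreover have "ln (real (Suc 0)) = 0" by simp
  ultimately show ?thesis unfolding Suc by linarith
qed

lemma gbinomial_powr_bound:
  assumes "0 \<le> (\<alpha> :: real)"
  shows "\<bar>(real n + \<alpha>) gchoose n\<bar> \<le> exp \<alpha> * (real n + 1) powr \<alpha>"
proof -
  have "\<bar>(real n + \<alpha>) gchoose n\<bar> \<le> exp (\<alpha> * harm n)"
    using gbinomial_harm_bound[OF assms, of n] by simp
  also have "\<dots> \<le> exp (\<alpha> * (1 + ln (real n + 1)))"
    using assms harm_le_ln by (simp add: mult_left_mono)
  also have "\<dots> = exp \<alpha> * (real n + 1) powr \<alpha>"
    by (simp add: powr_def exp_add algebra_simps)
  finally show ?thesis .
qed

text \<open>Sonine's function \<open>L P\<^sup>2 + (1 - x\<^sup>2) P'\<^sup>2\<close> decreases and then increases on \<open>[-1, 1]\<close>.\<close>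

lemma sonine_bound:
  fixes \<alpha> \<beta> L :: real
  assumes ab: "0 \<le> \<alpha>" "0 \<le> \<beta>" and ode: "jacobi_ode \<alpha> \<beta> n p" and x: "x \<in> {-1..1}"
  defines "L \<equiv> jacobi_eigenvalue \<alpha> \<beta> n"
  shows "L * (poly p x)\<^sup>2 + (1 - x\<^sup>2) * (poly (pderiv p) x)\<^sup>2 \<le> L * (max \<bar>poly p 1\<bar> \<bar>poly p (-1)\<bar>)\<^sup>2"
proof -
  define f where "f = (\<lambda>x. L * (poly p x)\<^sup>2 + (1 - x\<^sup>2) * (poly (pderiv p) x)\<^sup>2)"
  \<comment> \<open>Once the differential equation is inserted, the derivative of \<open>f\<close>
    is \<open>2 * q\<close> times the square of the derivative of \<open>p\<close>. As
    \<open>q\<close> is affine with positive slope, it changes sign at most once, and its sign at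
    \<open>x\<close> decides which endpoint dominates.\<close>
  define q where "q = (\<lambda>x. \<alpha> - \<beta> + (\<alpha> + \<beta> + 1) * x)"
  have qm: "q u \<le> q v" if "u \<le> v" for u v using that ab by (simp add: q_def mult_left_mono)
  have df: "(f has_real_derivative 2 * q y * (poly (pderiv p) y)\<^sup>2) (at y)" for y
  proof -
    have "(f has_real_derivative (L * (2 * poly p y * poly (pderiv p) y) - 2 * y * (poly (pderiv p) y)\<^sup>2
      + (1 - y\<^sup>2) * (2 * poly (pderiv p) y * poly (pderiv (pderiv p)) y))) (at y)"
      unfolding f_def by (auto intro!: derivative_eq_intros poly_DERIV simp: algebra_simps power2_eq_square)
    moreover have "L * (2 * poly p y * poly (pderiv p) y) - 2 * y * (poly (pderiv p) y)\<^sup>2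
      + (1 - y\<^sup>2) * (2 * poly (pderiv p) y * poly (pderiv (pderiv p)) y) =
      2 * poly (pderiv p) y * ((1 - y\<^sup>2) * poly (pderiv (pderiv p)) y + L * poly p y - y * poly (pderiv p) y)"
      by (simp add: algebra_simps power2_eq_square)
    moreover have "(1 - y\<^sup>2) * poly (pderiv (pderiv p)) y + L * poly p y - y * poly (pderiv p) y = q y * poly (pderiv p) y"
      using ode[unfolded jacobi_ode_def, rule_format, of y] by (simp add: q_def L_def algebra_simps)
    ultimately show ?thesis by (simp add: power2_eq_square mult_ac)
  qed
  have L0: "L \<ge> 0" using ab by (simp add: L_def jacobi_eigenvalue_def)
  have "f x \<le> f 1 \<or> f x \<le> f (-1)"
  proof (cases "q x \<ge> 0")
    case True
    have "f x \<le> f 1"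
    proof (rule DERIV_nonneg_imp_nondecreasing[of x 1 f])
      fix y assume "x \<le> y"
      then have "q y \<ge> 0" using True qm[of x y] by simp
      then show "\<exists>z. (f has_real_derivative z) (at y) \<and> 0 \<le> z"
        using df[of y] by (intro exI[of _ "2 * q y * (poly (pderiv p) y)\<^sup>2"]) auto
    qed (use x in auto)
    then show ?thesis ..
  next
    case False
    have "f x \<le> f (-1)"
    proof (rule DERIV_nonpos_imp_nonincreasing[of "-1" x f])
      fix y assume "y \<le> x"
      then have "q y \<le> 0" using False qm[of y x] by simp
      then show "\<exists>z. (f has_real_derivative z) (at y) \<and> z \<le> 0"
        using df[of y]
        by (intro exI[of _ "2 * q y * (poly (pderiv p) y)\<^sup>2"]) (auto simp: mult_nonpos_nonneg)
    qed (use x in auto)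
    then show ?thesis ..
  qed
  moreover have "f 1 = L * \<bar>poly p 1\<bar>\<^sup>2" "f (-1) = L * \<bar>poly p (-1)\<bar>\<^sup>2" by (simp_all add: f_def)
  moreover have "L * \<bar>poly p 1\<bar>\<^sup>2 \<le> L * (max \<bar>poly p 1\<bar> \<bar>poly p (-1)\<bar>)\<^sup>2"
    "L * \<bar>poly p (-1)\<bar>\<^sup>2 \<le> L * (max \<bar>poly p 1\<bar> \<bar>poly p (-1)\<bar>)\<^sup>2"
    using L0 by (intro mult_left_mono power_mono; simp)+
  ultimately have "f x \<le> L * (max \<bar>poly p 1\<bar> \<bar>poly p (-1)\<bar>)\<^sup>2" by linarith
  then show ?thesis by (simp add: f_def)
qed

lemma am_gm_abs: "2 * \<bar>u * v\<bar> \<le> u\<^sup>2 + (v :: real)\<^sup>2"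
  using zero_le_power2[of "\<bar>u\<bar> - \<bar>v\<bar>"] by (simp add: power2_eq_square abs_mult algebra_simps)

text \<open>In the variable \<open>x = cos \<theta>\<close> the equation is that of an oscillator with damping
  \<open>b = q / s\<close>, where \<open>s = sin \<theta>\<close>. The energy \<open>W (L P\<^sup>2 + s\<^sup>2 P'\<^sup>2)\<close>, corrected by the term
  \<open>- W q P P'\<close>, varies only through the derivative of \<open>b\<close>, and the factor \<open>exp (b / sqrt L)\<close>
  makes it monotone wherever \<open>\<bar>b\<bar> \<le> sqrt L\<close>.\<close>

lemma jacobi_energy_decay:
  fixes \<alpha> \<beta> L :: real
  assumes ab: "0 \<le> \<beta>" "\<beta> \<le> \<alpha>" and n: "n > 0" and ode: "jacobi_ode \<alpha> \<beta> n p"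
  defines "L \<equiv> jacobi_eigenvalue \<alpha> \<beta> n"
  assumes x: "-z \<le> x" "x \<le> z" "z < 1" and z: "(2 * \<alpha> + 1)\<^sup>2 \<le> L * (1 - z\<^sup>2)"
  shows "(1 - x) powr (\<alpha> + 1/2) * (1 + x) powr (\<beta> + 1/2) * (L * (poly p x)\<^sup>2)
    \<le> 3 * (exp 1)\<^sup>2 * ((1 - z) powr (\<alpha> + 1/2) * (1 + z) powr (\<beta> + 1/2) *
        (L * (poly p z)\<^sup>2 + (1 - z\<^sup>2) * (poly (pderiv p) z)\<^sup>2))"
proof -
  define P where "P = (\<lambda>x. poly p x)"
  define D where "D = (\<lambda>x. poly (pderiv p) x)"
  define DD where "DD = (\<lambda>x. poly (pderiv (pderiv p)) x)"
  \<comment> \<open>\<open>q\<close> and \<open>r\<close> are determined by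
    \<open>W' = - q * W / (1 - x^2)\<close> and \<open>b' = r / s^3\<close>. The assumptions on
    \<open>\<alpha>\<close> and \<open>\<beta>\<close> make \<open>r\<close> nonnegative on
    \<open>[-1, 1]\<close>, so \<open>exp (b / sqrt L)\<close> is nondecreasing.\<close>
  define q where "q = (\<lambda>x. \<alpha> - \<beta> + (\<alpha> + \<beta> + 1) * x)"
  define r where "r = (\<lambda>x. \<alpha> + \<beta> + 1 + (\<alpha> - \<beta>) * x)"
  define s where "s = (\<lambda>x::real. sqrt (1 - x\<^sup>2))"
  define W where "W = (\<lambda>x. (1 - x) powr (\<alpha> + 1/2) * (1 + x) powr (\<beta> + 1/2))"
  define F where "F = (\<lambda>x. L * (P x)\<^sup>2 + (1 - x\<^sup>2) * (D x)\<^sup>2)"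
  \<comment> \<open>The derivative of \<open>W * F\<close> is
    \<open>W * q * (D^2 - L * P^2 / (1 - x^2))\<close>, a difference of kinetic and potential energy
    without a sign. The derivative of \<open>W * q * P * D\<close> contains exactly this term.
    Subtraction leaves only \<open>- W * r * P * D / (1 - x^2)\<close>, which is the fact
    \<open>WZ\<close> below.\<close>
  define Z where "Z = (\<lambda>x. F x - q x * P x * D x)"
  define b where "b = (\<lambda>x. q x / s x)"
  define H where "H = (\<lambda>x. W x * Z x * exp (b x / sqrt L))"
  have L: "L > 0" using n ab by (simp add: L_def jacobi_eigenvalue_def)
  have range: "-1 < y \<and> y < 1 \<and> 0 < 1 - y\<^sup>2 \<and> (2 * \<alpha> + 1)\<^sup>2 \<le> L * (1 - y\<^sup>2)" if "-z \<le> y" "y \<le> z" for y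
  proof -
    have "y\<^sup>2 \<le> z\<^sup>2" using that by (simp add: abs_le_square_iff[symmetric])
    then have "L * (1 - z\<^sup>2) \<le> L * (1 - y\<^sup>2)" using L by (intro mult_left_mono) auto
    moreover have "-1 < y" "y < 1" using that x by linarith+
    moreover from this have "y\<^sup>2 < 1" by (simp add: abs_square_less_1)
    ultimately show ?thesis using z by linarith
  qed
  \<comment> \<open>The assumption on \<open>z\<close> enters here: \<open>2 * \<alpha> + 1\<close>
    is the maximum of \<open>\<bar>q\<bar>\<close> on \<open>[-1, 1]\<close>, so the damping
    \<open>b\<close> stays below \<open>sqrt L\<close> in absolute value on all of
    \<open>[-z, z]\<close>.\<close>
  have qb: "\<bar>q y\<bar> \<le> s y * sqrt L" and sp: "s y > 0" and ss: "(s y)\<^sup>2 = 1 - y\<^sup>2"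
    and Wp: "W y > 0" and rp: "r y \<ge> 0" if "-z \<le> y" "y \<le> z" for y
  proof -
    note R = range[OF that]
    have "\<bar>q y\<bar> \<le> (\<alpha> - \<beta>) + (\<alpha> + \<beta> + 1) * \<bar>y\<bar>"
      unfolding q_def using ab by (intro order_trans[OF abs_triangle_ineq]) (simp add: abs_mult)
    also have "\<dots> \<le> (\<alpha> - \<beta>) + (\<alpha> + \<beta> + 1) * 1"
      using R ab by (intro add_left_mono mult_left_mono) auto
    also have "\<dots> = sqrt ((2 * \<alpha> + 1)\<^sup>2)" using ab by simp
    also have "\<dots> \<le> sqrt (L * (1 - y\<^sup>2))" using R by (intro real_sqrt_le_mono) auto
    also have "\<dots> = s y * sqrt L" by (simp add: s_def real_sqrt_mult)
    finally show "\<bar>q y\<bar> \<le> s y * sqrt L" .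
    show "s y > 0" "(s y)\<^sup>2 = 1 - y\<^sup>2" using R by (simp_all add: s_def)
    show "W y > 0" using R by (simp add: W_def)
    have "(\<alpha> - \<beta>) * (-1) \<le> (\<alpha> - \<beta>) * y" using R ab by (intro mult_left_mono) auto
    then show "r y \<ge> 0" using ab by (simp add: r_def)
  qed
  have PD: "2 * (s y * sqrt L * \<bar>P y * D y\<bar>) \<le> F y" if "-z \<le> y" "y \<le> z" for y
  proof -
    have "2 * \<bar>(sqrt L * P y) * (s y * D y)\<bar> \<le> (sqrt L * P y)\<^sup>2 + (s y * D y)\<^sup>2" by (rule am_gm_abs)
    also have "\<dots> = F y" using L ss[OF that] by (simp add: F_def power_mult_distrib)
    finally show ?thesis using L sp[OF that] by (simp add: abs_mult mult_ac)
  qed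
  have ZF: "F y \<le> 2 * Z y" "Z y \<le> 3 / 2 * F y" if "-z \<le> y" "y \<le> z" for y
  proof -
    have "\<bar>q y * P y * D y\<bar> \<le> s y * sqrt L * \<bar>P y * D y\<bar>"
      using mult_right_mono[OF qb[OF that], of "\<bar>P y * D y\<bar>"] by (simp add: abs_mult mult.assoc)
    with PD[OF that] show "F y \<le> 2 * Z y" "Z y \<le> 3 / 2 * F y" unfolding Z_def by (auto simp: abs_le_iff)
  qed
  have dH: "\<exists>d. (H has_real_derivative d) (at y) \<and> 0 \<le> d" if y: "-z \<le> y" "y \<le> z" for y
  proof -
    note R = range[OF y]
    have dP: "(P has_real_derivative D y) (at y)" "(D has_real_derivative DD y) (at y)"
      unfolding P_def D_def DD_def by (rule poly_DERIV)+
    have dW: "(W has_real_derivative - q y * W y / (1 - y\<^sup>2)) (at y)"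
    proof -
      have "(W has_real_derivative
         (- (\<alpha> + 1/2) * (1 - y) powr (\<alpha> + 1/2 - 1)) * (1 + y) powr (\<beta> + 1/2)
         + (1 - y) powr (\<alpha> + 1/2) * ((\<beta> + 1/2) * (1 + y) powr (\<beta> + 1/2 - 1))) (at y)"
        unfolding W_def
        by (rule derivative_eq_intros refl DERIV_powr | use R in simp; fail)+
           (use R in \<open>simp add: algebra_simps powr_diff\<close>)
      moreover have "(- (\<alpha> + 1/2) * (1 - y) powr (\<alpha> + 1/2 - 1)) * (1 + y) powr (\<beta> + 1/2)
         + (1 - y) powr (\<alpha> + 1/2) * ((\<beta> + 1/2) * (1 + y) powr (\<beta> + 1/2 - 1)) = - q y * W y / (1 - y\<^sup>2)"
      proof -
        have e: "1 - y\<^sup>2 = (1 - y) * (1 + y)" by (simp add: algebra_simps power2_eq_square)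
        have p: "(1 - y) powr (\<alpha> + 1/2 - 1) = (1 - y) powr (\<alpha> + 1/2) / (1 - y)"
             "(1 + y) powr (\<beta> + 1/2 - 1) = (1 + y) powr (\<beta> + 1/2) / (1 + y)"
          using R powr_diff[of "1 - y" "\<alpha> + 1/2" 1] powr_diff[of "1 + y" "\<beta> + 1/2" 1] by simp_all
        have nz: "1 - y \<noteq> 0" "1 + y \<noteq> 0" using R by auto
        have "- (\<alpha> + 1/2) * (u / (1 - y)) * v + u * ((\<beta> + 1/2) * (v / (1 + y)))
          = - q y * (u * v) / ((1 - y) * (1 + y))" for u v :: real
          using nz by (simp add: q_def divide_simps) (simp add: algebra_simps)
        then show ?thesis unfolding W_def p e by simp
      qed
      ultimately show ?thesis by simp
    qed
    have ode': "(1 - y\<^sup>2) * DD y = (q y + y) * D y - L * P y"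
      using ode[unfolded jacobi_ode_def, rule_format, of y]
      by (simp add: P_def D_def DD_def q_def L_def algebra_simps)
    define Z' where "Z' = 2 * L * P y * D y - 2 * y * (D y)\<^sup>2 + (1 - y\<^sup>2) * (2 * D y * DD y)
        - ((\<alpha> + \<beta> + 1) * P y * D y + q y * (D y)\<^sup>2 + q y * P y * DD y)"
    have dZ: "(Z has_real_derivative Z') (at y)"
      unfolding Z_def F_def q_def Z'_def
      by (auto intro!: derivative_eq_intros dP simp: algebra_simps power2_eq_square)
    have db: "(b has_real_derivative r y / (s y * (1 - y\<^sup>2))) (at y)"
    proof -
      have "(b has_real_derivative ((\<alpha> + \<beta> + 1) * s y - q y * (- y / s y)) / (s y * s y)) (at y)"
        unfolding b_def q_def s_def using R
        by (auto intro!: derivative_eq_intros simp: field_simps)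
      moreover have "((\<alpha> + \<beta> + 1) * s y - q y * (- y / s y)) / (s y * s y) = ((\<alpha> + \<beta> + 1) * (s y)\<^sup>2 + q y * y) / (s y * (s y)\<^sup>2)"
        using sp[OF y] by (simp add: field_simps power2_eq_square)
      moreover have "(\<alpha> + \<beta> + 1) * (s y)\<^sup>2 + q y * y = r y"
        unfolding ss[OF y] by (simp add: q_def r_def algebra_simps power2_eq_square)
      ultimately show ?thesis using ss[OF y] by simp
    qed
    have WZ: "(- q y * W y / (1 - y\<^sup>2)) * Z y + W y * Z' = - W y * r y * (P y * D y) / (1 - y\<^sup>2)"
    proof -
      have "- q y * Z y + (1 - y\<^sup>2) * Z' = - r y * (P y * D y)"
      proof -
        have "(1 - y\<^sup>2) * Z' = (1 - y\<^sup>2) * (2 * L * P y * D y - 2 * y * (D y)\<^sup>2 + 2 * D y * ((1 - y\<^sup>2) * DD y)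
           - ((\<alpha> + \<beta> + 1) * P y * D y + q y * (D y)\<^sup>2)) - q y * P y * ((1 - y\<^sup>2) * DD y)"
          unfolding Z'_def by (simp add: algebra_simps)
        also have "\<dots> = (1 - y\<^sup>2) * (q y * (D y)\<^sup>2 - (\<alpha> + \<beta> + 1) * P y * D y) - q y * P y * ((q y + y) * D y - L * P y)"
          unfolding ode' by (simp add: algebra_simps power2_eq_square)
        finally have 1: "(1 - y\<^sup>2) * Z' = (1 - y\<^sup>2) * (q y * (D y)\<^sup>2 - (\<alpha> + \<beta> + 1) * P y * D y)
            - q y * P y * ((q y + y) * D y - L * P y)" .
        have 2: "r y = (\<alpha> + \<beta> + 1) * (1 - y\<^sup>2) + q y * y"
          by (simp add: q_def r_def algebra_simps power2_eq_square)
        show ?thesis unfolding 1 2 Z_def F_def by (simp add: algebra_simps power2_eq_square)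
      qed
      moreover have "(- q y * W y / (1 - y\<^sup>2)) * Z y + W y * Z' = W y * (- q y * Z y + (1 - y\<^sup>2) * Z') / (1 - y\<^sup>2)"
        using R by (simp add: field_simps)
      ultimately show ?thesis by simp
    qed
    define d where "d = ((- q y * W y / (1 - y\<^sup>2)) * Z y + W y * Z') * exp (b y / sqrt L)
        + W y * Z y * (exp (b y / sqrt L) * (r y / (s y * (1 - y\<^sup>2)) / sqrt L))"
    have "(H has_real_derivative d) (at y)"
      using DERIV_mult[OF DERIV_mult[OF dW dZ] DERIV_fun_exp[OF DERIV_cdivide[OF db, of "sqrt L"]]]
      unfolding H_def d_def by (simp add: mult_ac add_ac)
    \<comment> \<open>The term \<open>Z\<close> comes from differentiating the exponential, the
      other one from \<open>WZ\<close>. The bracket is nonnegative because \<open>q * P * D\<close>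
      and \<open>s * sqrt L * P * D\<close> are each at most \<open>F / 2\<close> in absolute
      value.\<close>
    moreover have "d = W y * r y * exp (b y / sqrt L) / ((1 - y\<^sup>2) * (s y * sqrt L)) *
        (Z y - s y * sqrt L * (P y * D y))"
    proof -
      have "- w * \<rho> * u / e * E + w * v * (E * (\<rho> / (\<sigma> * e) / t)) = w * \<rho> * E / (e * (\<sigma> * t)) * (v - \<sigma> * t * u)"
        if "e \<noteq> 0" "\<sigma> \<noteq> 0" "t \<noteq> 0" for w \<rho> u e E v \<sigma> t :: real
        using that by (simp add: divide_simps) (simp add: algebra_simps)
      moreover have "1 - y\<^sup>2 \<noteq> 0" "s y \<noteq> 0" "sqrt L \<noteq> 0" using R sp[OF y] L by auto
      ultimately show ?thesis unfolding d_def WZ by blast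
    qed
    moreover have "Z y - s y * sqrt L * (P y * D y) \<ge> 0"
    proof -
      have "\<bar>q y * P y * D y\<bar> \<le> s y * sqrt L * \<bar>P y * D y\<bar>"
        using mult_right_mono[OF qb[OF y], of "\<bar>P y * D y\<bar>"] by (simp add: abs_mult mult.assoc)
      moreover have "s y * sqrt L * (P y * D y) \<le> s y * sqrt L * \<bar>P y * D y\<bar>"
        using sp[OF y] L by (intro mult_left_mono) auto
      ultimately show ?thesis using PD[OF y] unfolding Z_def by linarith
    qed
    ultimately show ?thesis
      using Wp[OF y] rp[OF y] sp[OF y] L R by (intro exI[of _ d]) auto
  qed
  have Hmono: "H x \<le> H z"
    by (rule DERIV_nonneg_imp_nondecreasing[of x z H]) (use x dH in auto)
  have bb: "\<bar>b y / sqrt L\<bar> \<le> 1" if "-z \<le> y" "y \<le> z" for y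
    using qb[OF that] sp[OF that] L by (simp add: b_def abs_mult divide_simps mult_ac)
  have xz: "-z \<le> x" "x \<le> z" "-z \<le> z" using x by auto
  have Fx: "F x \<ge> 0" using L range[OF xz(1,2)] by (simp add: F_def)
  \<comment> \<open>The constant collects a factor 2 from \<open>F \<le> 2 * Z\<close>, a factor 3/2
    from \<open>Z \<le> 3 / 2 * F\<close>, and two factors \<open>exp 1\<close>, since the exponent
    \<open>b / sqrt L\<close> lies between -1 and 1 at both points.\<close>
  have "W x * (L * (P x)\<^sup>2) \<le> W x * F x"
    using range[OF xz(1,2)] Wp[OF xz(1,2)] by (intro mult_left_mono) (auto simp: F_def)
  also have "\<dots> \<le> W x * (2 * Z x)"
    using ZF[OF xz(1,2)] Wp[OF xz(1,2)] by (intro mult_left_mono) auto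
  also have "\<dots> \<le> W x * (2 * Z x) * (exp 1 * exp (b x / sqrt L))"
  proof -
    have "exp 0 \<le> exp (1 + b x / sqrt L)" using bb[OF xz(1,2)] by (intro exp_mono) linarith
    then have "1 \<le> exp 1 * exp (b x / sqrt L)" by (simp add: exp_add)
    moreover have "0 \<le> W x * (2 * Z x)" using Fx ZF[OF xz(1,2)] Wp[OF xz(1,2)] by (intro mult_nonneg_nonneg) auto
    ultimately show ?thesis using mult_left_mono[of 1 "exp 1 * exp (b x / sqrt L)" "W x * (2 * Z x)"] by simp
  qed
  also have "\<dots> = 2 * exp 1 * H x" by (simp add: H_def)
  also have "\<dots> \<le> 2 * exp 1 * H z" using Hmono by simp
  also have "\<dots> = 2 * exp 1 * (W z * Z z * exp (b z / sqrt L))" by (simp add: H_def)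
  also have "\<dots> \<le> 2 * exp 1 * (W z * (3 / 2 * F z) * exp 1)"
  proof -
    have zz: "-z \<le> z" "z \<le> z" using x by auto
    have "b z / sqrt L \<le> 1" using bb[OF zz] by linarith
    moreover have "F z \<ge> 0" using L range[OF zz] by (simp add: F_def)
    ultimately show ?thesis
      using ZF[OF zz] Wp[OF zz] by (intro mult_left_mono mult_mono) (auto intro!: mult_nonneg_nonneg)
  qed
  also have "\<dots> = 3 * (exp 1)\<^sup>2 * (W z * F z)" by (simp add: power2_eq_square)
  finally show ?thesis by (simp add: W_def P_def F_def D_def)
qed

lemma jacobi_pointwise_bound:
  fixes \<alpha> \<beta> :: real
  assumes ab: "0 \<le> \<beta>" "\<beta> \<le> \<alpha>"
  shows "\<exists>C>0. \<forall>n. \<forall>x\<in>{-1..1}. \<bar>poly (jacobi \<alpha> \<beta> n) x\<bar>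
     \<le> C * (real n + 1) powr (-1/2) * max (sqrt (1 - x\<^sup>2)) (1 / (real n + 1)) powr (- (\<alpha> + 1/2))"
proof -
  define B where "B = 2 * \<alpha> + 1"
  define a where "a = \<alpha> + 1/2"
  \<comment> \<open>The square of \<open>K\<close> is the constant of
    \<open>jacobi_energy_decay\<close> times \<open>2 powr (\<alpha> - \<beta>)\<close>, the loss in
    replacing the weight by a power of \<open>sqrt (1 - x\<^sup>2)\<close>.\<close>
  define K where "K = sqrt (3 * (exp 1)\<^sup>2 * 2 powr (\<alpha> - \<beta>))"
  define C where "C = max 1 (max 1 K * (exp \<alpha> * (2 * B) powr a))"
  have B1: "B \<ge> 1" and a0: "a > 0" using ab by (auto simp: B_def a_def)
  have C1: "C \<ge> 1" by (simp add: C_def)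
  have "\<bar>poly (jacobi \<alpha> \<beta> n) x\<bar>
     \<le> C * (real n + 1) powr (-1/2) * max (sqrt (1 - x\<^sup>2)) (1 / (real n + 1)) powr (- a)"
    if x: "x \<in> {-1..1}" for n x
  \<comment> \<open>For \<open>n = 0\<close> the eigenvalue is 0 and the energies say nothing about
    the polynomial itself, which is the constant 1.\<close>
  proof (cases "n = 0")
    case True
    have j: "jacobi \<alpha> \<beta> = jacobi_poly \<alpha> \<beta>" using ab by (intro jacobi_eq_jacobi_poly) auto
    have "degree (jacobi_poly \<alpha> \<beta> 0) = 0" using ab by (intro jacobi_poly_degree) auto
    then have "poly (jacobi_poly \<alpha> \<beta> 0) x = poly (jacobi_poly \<alpha> \<beta> 0) 1"
      by (metis degree_eq_zeroE poly_pCons mult_zero_right poly_0)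
    then have "poly (jacobi \<alpha> \<beta> n) x = 1" unfolding True j by (simp add: jacobi_poly_at_1)
    moreover have "x\<^sup>2 \<ge> 0" by simp
    then have "max (sqrt (1 - x\<^sup>2)) 1 = 1" by (simp add: max_absorb2 del: zero_le_power2)
    ultimately show ?thesis using C1 True by simp
  next
    case False
    define N where "N = real n + 1"
    define L where "L = jacobi_eigenvalue \<alpha> \<beta> n"
    define p where "p = jacobi_poly \<alpha> \<beta> n"
    define M where "M = exp \<alpha> * N powr \<alpha>"
    define s where "s = sqrt (1 - x\<^sup>2)"
    \<comment> \<open>The value of \<open>s\<close> at which the hypothesis of
      \<open>jacobi_energy_decay\<close> holds with equality. It is comparable to
      \<open>1 / N\<close>: \<open>sig2\<close> and \<open>sig\<close> give
      \<open>1 / N \<le> \<sigma>\<close> and \<open>\<sigma> \<le> 2 * B / N\<close>.\<close>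
    define \<sigma> where "\<sigma> = B / sqrt L"
    have jp: "jacobi \<alpha> \<beta> n = p" unfolding p_def using ab by (subst jacobi_eq_jacobi_poly) auto
    have N1: "N \<ge> 1" by (simp add: N_def)
    have ode: "jacobi_ode \<alpha> \<beta> n p" unfolding p_def by (rule jacobi_poly_ode)
    have Lp: "L > 0" using False ab by (simp add: L_def jacobi_eigenvalue_def)
    have x2: "0 \<le> 1 - x\<^sup>2" using x by (simp add: abs_square_le_1 abs_le_iff)
    have p1: "\<bar>poly p 1\<bar> \<le> M"
      using gbinomial_powr_bound[of \<alpha> n] ab by (simp add: p_def jacobi_poly_at_1 M_def N_def)
    have "\<bar>poly p (-1)\<bar> = \<bar>(real n + \<beta>) gchoose n\<bar>"
      unfolding p_def using ab by (subst jacobi_poly_reflect) (auto simp: jacobi_poly_at_1 abs_mult)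
    also have "\<dots> \<le> exp \<beta> * N powr \<beta>" using gbinomial_powr_bound[of \<beta> n] ab by (simp add: N_def)
    also have "\<dots> \<le> M" unfolding M_def using ab N1 by (intro mult_mono powr_mono) auto
    finally have p2: "\<bar>poly p (-1)\<bar> \<le> M" .
    have son: "L * (poly p y)\<^sup>2 + (1 - y\<^sup>2) * (poly (pderiv p) y)\<^sup>2 \<le> L * M\<^sup>2" if "y \<in> {-1..1}" for y
    proof -
      have "L * (poly p y)\<^sup>2 + (1 - y\<^sup>2) * (poly (pderiv p) y)\<^sup>2 \<le> L * (max \<bar>poly p 1\<bar> \<bar>poly p (-1)\<bar>)\<^sup>2"
        unfolding L_def using ab ode that by (intro sonine_bound) auto
      also have "\<dots> \<le> L * M\<^sup>2"
        using p1 p2 Lp by (intro mult_left_mono power_mono) auto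
      finally show ?thesis .
    qed
    have M0: "M \<ge> 0" by (simp add: M_def)
    have nL: "real n \<le> sqrt L"
    proof -
      have "(real n)\<^sup>2 \<le> L" using ab by (simp add: L_def jacobi_eigenvalue_def power2_eq_square mult_left_mono)
      then show ?thesis by (simp add: real_le_rsqrt)
    qed
    have sig: "\<sigma> \<le> 2 * B / N"
    proof -
      have "N \<le> 2 * sqrt L" using nL False by (simp add: N_def)
      then show ?thesis using B1 N1 Lp by (simp add: \<sigma>_def divide_simps mult_left_mono)
    qed
    have sig2: "1 / N \<le> \<sigma>"
    proof -
      have "L \<le> (B * N)\<^sup>2"
      proof -
        have "L \<le> real n * (real n + 2 * \<alpha> + 1)"
          using ab by (simp add: L_def jacobi_eigenvalue_def mult_left_mono)
        also have "\<dots> \<le> N * (B * N)"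
          using ab by (intro mult_mono) (auto simp: N_def B_def algebra_simps)
        also have "\<dots> \<le> B * N * (B * N)" using B1 N1 by (intro mult_right_mono) auto
        finally show ?thesis by (simp add: power2_eq_square)
      qed
      then have "sqrt L \<le> B * N" using B1 N1 by (intro real_le_lsqrt) auto
      then show ?thesis using N1 Lp by (simp add: \<sigma>_def divide_simps mult_ac)
    qed
    have sig0: "\<sigma> > 0" using B1 Lp by (simp add: \<sigma>_def)
    have s0: "s \<ge> 0" using x2 by (simp add: s_def)
    \<comment> \<open>Here the endpoint size \<open>N powr \<alpha>\<close> is traded for
      \<open>N powr (-1/2)\<close>, the difference being the power \<open>a\<close> of the length
      scale \<open>1 / N\<close>.\<close>
    have MN: "M * (2 * B) powr a * N powr (-a) = exp \<alpha> * (2 * B) powr a * N powr (-1/2)"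
    proof -
      have "N powr \<alpha> * N powr (-a) = N powr (-1/2)" using N1 by (simp add: a_def powr_add[symmetric])
      then show ?thesis by (simp add: M_def mult_ac)
    qed
    have sN: "(2 * B / N) powr a = (2 * B) powr a * N powr (-a)"
      using B1 N1 by (simp add: powr_divide powr_minus_divide)
    have main: "\<bar>poly p x\<bar> \<le> max 1 K * M * ((2 * B / N) powr a) * max s (1 / N) powr (-a)"
    proof (cases "s < \<sigma>")
      case True
      have "L * (poly p x)\<^sup>2 \<le> L * M\<^sup>2"
        using son[OF x] mult_nonneg_nonneg[OF x2 zero_le_power2[of "poly (pderiv p) x"]] by linarith
      then have "(poly p x)\<^sup>2 \<le> M\<^sup>2" using Lp by simp
      then have pM: "\<bar>poly p x\<bar> \<le> M" using M0 by (simp add: abs_le_square_iff[symmetric])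
      have "max s (1 / N) \<le> 2 * B / N" using True sig B1 N1 by (auto simp: divide_right_mono)
      moreover have "0 < max s (1 / N)" using N1 by (simp add: less_max_iff_disj)
      ultimately have "(2 * B / N) powr (-a) \<le> max s (1 / N) powr (-a)"
        using a0 by (intro powr_mono2') auto
      then have "(2 * B / N) powr a * (2 * B / N) powr (-a) \<le> (2 * B / N) powr a * max s (1 / N) powr (-a)"
        by (intro mult_left_mono) auto
      then have "1 \<le> (2 * B / N) powr a * max s (1 / N) powr (-a)"
        using B1 N1 by (simp add: powr_minus field_simps)
      moreover have "M \<le> max 1 K * M" using M0 by (simp add: mult_le_cancel_right1)
      ultimately have "M * 1 \<le> (max 1 K * M) * ((2 * B / N) powr a * max s (1 / N) powr (-a))"
        using M0 by (intro mult_mono) auto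
      then show ?thesis using pM by (simp add: mult_ac)
    next
      case False
      define z where "z = sqrt (1 - \<sigma>\<^sup>2)"
      have spos: "s > 0" using False sig0 by linarith
      have s2: "s\<^sup>2 = 1 - x\<^sup>2" using x2 by (simp add: s_def)
      have "\<sigma>\<^sup>2 \<le> s\<^sup>2" using False sig0 by (intro power_mono) auto
      then have le: "\<sigma>\<^sup>2 \<le> 1 - x\<^sup>2" using s2 by simp
      moreover have "0 \<le> x\<^sup>2" by simp
      ultimately have s1: "\<sigma>\<^sup>2 \<le> 1" by linarith
      have z2: "z\<^sup>2 = 1 - \<sigma>\<^sup>2" and z0: "z \<ge> 0" using s1 by (auto simp: z_def)
      have z1: "z < 1"
      proof -
        have "z\<^sup>2 < 1" using z2 sig0 by simp
        then show ?thesis using z0 by (simp add: abs_square_less_1)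
      qed
      have "x\<^sup>2 \<le> z\<^sup>2" using z2 le by linarith
      then have xz: "-z \<le> x" "x \<le> z" using z0 by (simp_all add: abs_le_square_iff[symmetric] abs_le_iff)
      have x1: "-1 < x" "x < 1" using xz z1 by linarith+
      have Bz: "(2 * \<alpha> + 1)\<^sup>2 \<le> L * (1 - z\<^sup>2)" using z2 Lp by (simp add: \<sigma>_def B_def power_divide)
      \<comment> \<open>The remaining factor \<open>(1 + y) powr (\<beta> - \<alpha>)\<close> is
        harmless: its exponent is at most 0, so it is at least
        \<open>2 powr (\<beta> - \<alpha>)\<close> at \<open>x\<close>, and at most 1 at
        \<open>z\<close> because \<open>z \<ge> 0\<close>.\<close>
      have W: "(1 - y) powr (\<alpha> + 1/2) * (1 + y) powr (\<beta> + 1/2) = (1 - y\<^sup>2) powr a * (1 + y) powr (\<beta> - \<alpha>)"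
        if "-1 < y" "y < 1" for y
      proof -
        have "1 - y\<^sup>2 = (1 - y) * (1 + y)" by (simp add: algebra_simps power2_eq_square)
        then show ?thesis using that by (simp add: powr_mult a_def mult.assoc powr_add[symmetric] add.commute)
      qed
      have "(1 - x) powr (\<alpha> + 1/2) * (1 + x) powr (\<beta> + 1/2) * (L * (poly p x)\<^sup>2)
        \<le> 3 * (exp 1)\<^sup>2 * ((1 - z) powr (\<alpha> + 1/2) * (1 + z) powr (\<beta> + 1/2) *
        (L * (poly p z)\<^sup>2 + (1 - z\<^sup>2) * (poly (pderiv p) z)\<^sup>2))"
        unfolding L_def
        using ab False ode xz z1 Bz \<open>n \<noteq> 0\<close> by (intro jacobi_energy_decay) (auto simp: L_def)
      also have "\<dots> \<le> 3 * (exp 1)\<^sup>2 * ((1 - z) powr (\<alpha> + 1/2) * (1 + z) powr (\<beta> + 1/2) * (L * M\<^sup>2))"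
        using z0 z1 by (intro mult_left_mono son) auto
      also have "(1 - z) powr (\<alpha> + 1/2) * (1 + z) powr (\<beta> + 1/2) = (\<sigma>\<^sup>2) powr a * (1 + z) powr (\<beta> - \<alpha>)"
        using W[of z] z0 z1 z2 by simp
      also have "(1 - x) powr (\<alpha> + 1/2) * (1 + x) powr (\<beta> + 1/2) = (s\<^sup>2) powr a * (1 + x) powr (\<beta> - \<alpha>)"
        using W[of x] x1 s2 by simp
      finally have 1: "(s\<^sup>2) powr a * (1 + x) powr (\<beta> - \<alpha>) * (L * (poly p x)\<^sup>2)
         \<le> 3 * (exp 1)\<^sup>2 * ((\<sigma>\<^sup>2) powr a * (1 + z) powr (\<beta> - \<alpha>) * (L * M\<^sup>2))" .
      have sq: "(t\<^sup>2) powr a = (t powr a)\<^sup>2" if "t > 0" for t :: real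
        using that by (simp add: powr_powr power2_eq_square powr_mult)
      have "(s powr a)\<^sup>2 * 2 powr (\<beta> - \<alpha>) * (L * (poly p x)\<^sup>2)
        \<le> (s\<^sup>2) powr a * (1 + x) powr (\<beta> - \<alpha>) * (L * (poly p x)\<^sup>2)"
        unfolding sq[OF spos] using ab x1 Lp by (intro mult_right_mono mult_left_mono powr_mono2') auto
      also note 1
      also have "3 * (exp 1)\<^sup>2 * ((\<sigma>\<^sup>2) powr a * (1 + z) powr (\<beta> - \<alpha>) * (L * M\<^sup>2))
        \<le> 3 * (exp 1)\<^sup>2 * ((\<sigma> powr a)\<^sup>2 * 1 * (L * M\<^sup>2))"
      proof -
        have "(1 + z) powr (\<beta> - \<alpha>) \<le> 1 powr (\<beta> - \<alpha>)" using ab z0 by (intro powr_mono2') auto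
        then show ?thesis unfolding sq[OF sig0] using Lp
          by (intro mult_left_mono mult_right_mono) auto
      qed
      finally have "(s powr a)\<^sup>2 * (poly p x)\<^sup>2 * (2 powr (\<beta> - \<alpha>) * L) \<le> 3 * (exp 1)\<^sup>2 * (\<sigma> powr a)\<^sup>2 * M\<^sup>2 * L"
        by (simp add: mult_ac)
      then have "(s powr a)\<^sup>2 * (poly p x)\<^sup>2 * 2 powr (\<beta> - \<alpha>) \<le> 3 * (exp 1)\<^sup>2 * (\<sigma> powr a)\<^sup>2 * M\<^sup>2"
        using Lp by (simp add: mult.assoc[symmetric])
      then have "(s powr a)\<^sup>2 * (poly p x)\<^sup>2 * 2 powr (\<beta> - \<alpha>) * 2 powr (\<alpha> - \<beta>) \<le> 3 * (exp 1)\<^sup>2 * (\<sigma> powr a)\<^sup>2 * M\<^sup>2 * 2 powr (\<alpha> - \<beta>)"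
        by (intro mult_right_mono) auto
      then have "(s powr a)\<^sup>2 * (poly p x)\<^sup>2 \<le> 3 * (exp 1)\<^sup>2 * (\<sigma> powr a)\<^sup>2 * M\<^sup>2 * 2 powr (\<alpha> - \<beta>)"
        by (simp add: mult.assoc powr_add[symmetric])
      also have "\<dots> = (K * \<sigma> powr a * M)\<^sup>2"
        by (simp add: K_def power_mult_distrib)
      finally have "(s powr a * \<bar>poly p x\<bar>)\<^sup>2 \<le> (K * \<sigma> powr a * M)\<^sup>2" by (simp add: power_mult_distrib)
      then have "s powr a * \<bar>poly p x\<bar> \<le> K * \<sigma> powr a * M"
        by (rule power2_le_imp_le) (auto simp: K_def M0)
      also have "\<dots> \<le> max 1 K * (2 * B / N) powr a * M"
        using sig sig0 a0 M0 by (intro mult_mono powr_mono2) (auto simp: K_def)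
      finally have "s powr a * \<bar>poly p x\<bar> \<le> max 1 K * (2 * B / N) powr a * M" .
      then have "\<bar>poly p x\<bar> \<le> max 1 K * (2 * B / N) powr a * M * s powr (-a)"
        using spos by (simp add: powr_minus field_simps)
      moreover have "max s (1 / N) = s" using False sig2 by auto
      ultimately show ?thesis by (simp add: mult_ac)
    qed
    also have "\<dots> = max 1 K * (M * (2 * B) powr a * N powr (-a)) * max s (1 / N) powr (-a)"
      unfolding sN by (simp only: mult_ac)
    also have "\<dots> \<le> C * N powr (-1/2) * max s (1 / N) powr (-a)"
    proof -
      have "max 1 K * (exp \<alpha> * (2 * B) powr a) \<le> C" by (simp add: C_def)
      then have "max 1 K * (exp \<alpha> * (2 * B) powr a) * (N powr (-1/2) * max s (1 / N) powr (-a)) \<le> C * (N powr (-1/2) * max s (1 / N) powr (-a))"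
        by (intro mult_right_mono) auto
      then show ?thesis unfolding MN by (simp add: mult_ac)
    qed
    finally show ?thesis by (simp add: jp s_def N_def)
  qed
  then show ?thesis using C1 unfolding a_def by (intro exI[of _ C]) auto
qed

section \<open>The Hardy--Littlewood--Sobolev inequality\<close>

text \<open>With \<open>d\<close> the distance on the line and \<open>\<lambda> = 2 / p\<close>, so that \<open>s = 2 / (2 - \<lambda>)\<close>, this is the diagonal case of the
  Hardy--Littlewood--Sobolev inequality. By symmetry it suffices to treat the region \<open>g y \<le> f x\<close>. There
  the set of \<open>y\<close> is split at \<open>d x y = f x powr - s\<close>: on the near part \<open>g y\<close> is bounded by \<open>f x\<close>,
  on the far part Young's inequality applies, and both contributions are of order \<open>f x powr s\<close>.\<close>

lemma hls_half:
  fixes d :: "'a \<Rightarrow> 'a \<Rightarrow> real" and f g :: "'a \<Rightarrow> real"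
  assumes p: "2 < p" and C: "0 \<le> C" and s: "s = p / (p - 1)"
    and dm[measurable]: "case_prod d \<in> borel_measurable (M \<Otimes>\<^sub>M M)" and dp: "\<And>x y. 0 < d x y"
    and near: "\<And>x \<rho>. x \<in> space M \<Longrightarrow> 0 < \<rho> \<Longrightarrow>
      (\<integral>\<^sup>+y. ennreal (d x y powr (-2/p)) * indicator {y. d x y \<le> \<rho>} y \<partial>M) \<le> ennreal (C * \<rho> powr (1 - 2/p))"
    and far: "\<And>x \<rho>. x \<in> space M \<Longrightarrow> 0 < \<rho> \<Longrightarrow>
      (\<integral>\<^sup>+y. ennreal (d x y powr (-2)) * indicator {y. \<rho> < d x y} y \<partial>M) \<le> ennreal (C / \<rho>)"
    and f[measurable]: "f \<in> borel_measurable M" and g[measurable]: "g \<in> borel_measurable M"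
    and f0: "\<And>x. 0 \<le> f x" and g0: "\<And>x. 0 \<le> g x"
    and fs: "(\<integral>\<^sup>+x. ennreal (f x powr s) \<partial>M) \<le> 1"
    and gs: "(\<integral>\<^sup>+x. ennreal (g x powr s) \<partial>M) \<le> 1"
  shows "(\<integral>\<^sup>+x. (\<integral>\<^sup>+y. ennreal (f x * g y * d x y powr (-2/p)) * indicator {y. g y \<le> f x} y \<partial>M) \<partial>M)
    \<le> ennreal (2 * C + 1)"
proof -
  have inner: "(\<integral>\<^sup>+y. ennreal (f x * g y * d x y powr (-2/p)) * indicator {y. g y \<le> f x} y \<partial>M)
      \<le> ennreal (2 * C + 1) * ennreal (f x powr s)" if x[measurable]: "x \<in> space M" for x
  proof (cases "f x = 0")
    case True
    then show ?thesis by simp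
  next
    case False
    then have fp: "f x > 0" using f0[of x] by linarith
    have dx[measurable]: "d x \<in> borel_measurable M" using measurable_compose[OF measurable_Pair1'[OF x] dm] by simp
    define F where "F = f x"
    \<comment> \<open>All terms are to be of order \<open>F powr s\<close>. The near part
      contributes \<open>F^2 * \<rho> powr (1 - 2/p)\<close>, which dictates \<open>\<rho>\<close>.
      The far part contributes \<open>F * \<delta> powr s\<close> and
      \<open>F * \<delta> powr (-p) / \<rho>\<close>, and both have the right order exactly for this
      \<open>\<delta>\<close>.\<close>
    define \<rho> where "\<rho> = F powr (- s)"
    define \<delta> where "\<delta> = F powr (1 / p)"
    have Fp: "F > 0" using fp by (simp add: F_def)
    have rp: "\<rho> > 0" and dep: "\<delta> > 0" using Fp by (auto simp: \<rho>_def \<delta>_def)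
    have p1: "p > 1" using p by simp
    have s0: "s > 1" using p by (simp add: s field_simps)
    \<comment> \<open>Young's inequality without its constants: the two cases compare the powers
      \<open>(\<delta> * u) powr s\<close> and \<open>(v / \<delta>) powr p\<close>, and the product
      is at most the larger one. The parameter \<open>\<delta>\<close> distributes the weight
      between the two terms.\<close>
    have young: "u * v \<le> (\<delta> * u) powr s + (v / \<delta>) powr p" if "u \<ge> 0" "v > 0" for u v
    proof (cases "\<delta> * u \<le> (v / \<delta>) powr (p - 1)")
      case True
      have "u * v = (\<delta> * u) * (v / \<delta>)" using dep by simp
      also have "\<dots> \<le> (v / \<delta>) powr (p - 1) * (v / \<delta>)" using True that dep by (intro mult_right_mono) auto
      also have "\<dots> = (v / \<delta>) powr p" using that dep by (simp add: powr_diff)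
      finally show ?thesis using powr_ge_zero[of "\<delta> * u" s] by linarith
    next
      case False
      then have up: "\<delta> * u > 0" using powr_ge_zero[of "v / \<delta>" "p - 1"] by linarith
      have "((v / \<delta>) powr (p - 1)) powr (1 / (p - 1)) \<le> (\<delta> * u) powr (1 / (p - 1))"
        using False p1 by (intro powr_mono2) auto
      then have "v / \<delta> \<le> (\<delta> * u) powr (1 / (p - 1))" using that dep p1 by (simp add: powr_powr)
      then have "(\<delta> * u) * (v / \<delta>) \<le> (\<delta> * u) * (\<delta> * u) powr (1 / (p - 1))"
        using up by (intro mult_left_mono) auto
      also have "\<dots> = (\<delta> * u) powr 1 * (\<delta> * u) powr (1 / (p - 1))" using up by simp
      also have "\<dots> = (\<delta> * u) powr (1 + 1 / (p - 1))" by (simp only: powr_add)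
      also have "1 + 1 / (p - 1) = s" using p1 by (simp add: s field_simps)
      finally show ?thesis using dep by (simp add: add_increasing2)
    qed
    have pw: "ennreal (f x * g y * d x y powr (-2/p)) * indicator {y. g y \<le> f x} y
      \<le> ennreal (F\<^sup>2) * (ennreal (d x y powr (-2/p)) * indicator {y. d x y \<le> \<rho>} y)
        + (ennreal (F * \<delta> powr s) * ennreal (g y powr s)
        + ennreal (F * \<delta> powr (-p)) * (ennreal (d x y powr (-2)) * indicator {y. \<rho> < d x y} y))" for y
    proof (cases "g y \<le> F")
      case le: True
      show ?thesis
      proof (cases "d x y \<le> \<rho>")
        case True
        have "f x * g y * d x y powr (-2/p) \<le> F\<^sup>2 * d x y powr (-2/p)"
          using le Fp by (intro mult_right_mono) (auto simp: F_def power2_eq_square)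
        then have "ennreal (f x * g y * d x y powr (-2/p)) \<le> ennreal (F\<^sup>2) * ennreal (d x y powr (-2/p))"
          by (simp add: ennreal_mult[symmetric] ennreal_leI)
        then have "ennreal (f x * g y * d x y powr (-2/p)) \<le> ennreal (F\<^sup>2) * ennreal (d x y powr (-2/p))
            + ennreal (F * \<delta> powr s) * ennreal (g y powr s)"
          by (rule order_trans) simp
        with True le show ?thesis by (simp add: F_def)
      next
        case False
        have "g y * d x y powr (-2/p) \<le> (\<delta> * g y) powr s + (d x y powr (-2/p) / \<delta>) powr p"
          using dp[of x y] by (intro young g0) simp
        also have "(\<delta> * g y) powr s = \<delta> powr s * g y powr s" by (rule powr_mult)
        also have "(d x y powr (-2/p) / \<delta>) powr p = \<delta> powr (-p) * d x y powr (-2)"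
          using p by (simp add: powr_divide powr_powr powr_minus_divide powr_mult mult.commute)
        finally have "F * (g y * d x y powr (-2/p)) \<le> F * (\<delta> powr s * g y powr s + \<delta> powr (-p) * d x y powr (-2))"
          using Fp by (intro mult_left_mono) auto
        then have "f x * g y * d x y powr (-2/p) \<le> (F * \<delta> powr s) * g y powr s + (F * \<delta> powr (-p)) * d x y powr (-2)"
          by (simp add: F_def algebra_simps)
        then have "ennreal (f x * g y * d x y powr (-2/p)) \<le> ennreal ((F * \<delta> powr s) * g y powr s + (F * \<delta> powr (-p)) * d x y powr (-2))"
          by (rule ennreal_leI)
        also have "\<dots> = ennreal (F * \<delta> powr s) * ennreal (g y powr s) + ennreal (F * \<delta> powr (-p)) * ennreal (d x y powr (-2))"
          using Fp by (simp add: ennreal_mult ennreal_plus)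
        finally show ?thesis using False le by (simp add: F_def)
      qed
    next
      case False
      then show ?thesis by (simp add: F_def)
    qed
    have "(\<integral>\<^sup>+y. ennreal (f x * g y * d x y powr (-2/p)) * indicator {y. g y \<le> f x} y \<partial>M)
      \<le> (\<integral>\<^sup>+y. ennreal (F\<^sup>2) * (ennreal (d x y powr (-2/p)) * indicator {y. d x y \<le> \<rho>} y)
        + (ennreal (F * \<delta> powr s) * ennreal (g y powr s)
        + ennreal (F * \<delta> powr (-p)) * (ennreal (d x y powr (-2)) * indicator {y. \<rho> < d x y} y)) \<partial>M)"
      by (intro nn_integral_mono pw)
    also have "\<dots> = ennreal (F\<^sup>2) * (\<integral>\<^sup>+y. ennreal (d x y powr (-2/p)) * indicator {y. d x y \<le> \<rho>} y \<partial>M)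
       + (ennreal (F * \<delta> powr s) * (\<integral>\<^sup>+y. ennreal (g y powr s) \<partial>M)
       + ennreal (F * \<delta> powr (-p)) * (\<integral>\<^sup>+y. ennreal (d x y powr (-2)) * indicator {y. \<rho> < d x y} y \<partial>M))"
      by (simp add: nn_integral_add nn_integral_cmult)
    also have "\<dots> \<le> ennreal (F\<^sup>2) * ennreal (C * \<rho> powr (1 - 2/p))
       + (ennreal (F * \<delta> powr s) * 1 + ennreal (F * \<delta> powr (-p)) * ennreal (C / \<rho>))"
      by (intro add_mono mult_left_mono near far gs x rp) auto
    also have "\<dots> = ennreal (F\<^sup>2 * (C * \<rho> powr (1 - 2/p)) + (F * \<delta> powr s + F * \<delta> powr (-p) * (C / \<rho>)))"
      using Fp C rp by (simp add: ennreal_mult[symmetric] ennreal_plus[symmetric] del: ennreal_plus)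
    also have "F\<^sup>2 * (C * \<rho> powr (1 - 2/p)) = C * F powr s"
    proof -
      have e: "- (s * (1 - 2 / p)) + 2 = s" using p by (simp add: s field_simps)
      have "F\<^sup>2 = F powr 2" using Fp by simp
      then have "F\<^sup>2 * \<rho> powr (1 - 2/p) = F powr (- (s * (1 - 2 / p)) + 2)"
        by (simp only: \<rho>_def powr_powr powr_add) simp
      then show ?thesis unfolding e by simp
    qed
    also have "F * \<delta> powr s = F powr s"
    proof -
      have e: "1 + s / p = s" using p by (simp add: s field_simps)
      have "F * \<delta> powr s = F powr (1 + s / p)" using Fp by (simp add: \<delta>_def powr_powr powr_add)
      then show ?thesis unfolding e .
    qed
    also have "F * \<delta> powr (-p) * (C / \<rho>) = C * F powr s"
      using Fp p by (simp add: \<delta>_def \<rho>_def powr_powr powr_minus field_simps)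
    also have "ennreal (C * F powr s + (F powr s + C * F powr s)) = ennreal (2 * C + 1) * ennreal (f x powr s)"
      using C by (simp add: ennreal_mult[symmetric] F_def algebra_simps)
    finally show ?thesis .
  qed
  have "(\<integral>\<^sup>+x. (\<integral>\<^sup>+y. ennreal (f x * g y * d x y powr (-2/p)) * indicator {y. g y \<le> f x} y \<partial>M) \<partial>M)
    \<le> (\<integral>\<^sup>+x. ennreal (2 * C + 1) * ennreal (f x powr s) \<partial>M)"
    by (intro nn_integral_mono inner)
  also have "\<dots> = ennreal (2 * C + 1) * (\<integral>\<^sup>+x. ennreal (f x powr s) \<partial>M)"
    by (rule nn_integral_cmult) measurable
  also have "\<dots> \<le> ennreal (2 * C + 1) * 1" by (intro mult_left_mono fs) auto
  finally show ?thesis by simp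
qed

text \<open>The regions \<open>g y \<le> f x\<close> and \<open>f x \<le> g y\<close> overlap on
  equality, so the splitting is an inequality. Exchanging the integrals turns the second region into
  the first one with \<open>f\<close> and \<open>g\<close> interchanged, which doubles the
  constant.\<close>

lemma hls:
  fixes d :: "'a \<Rightarrow> 'a \<Rightarrow> real" and f g :: "'a \<Rightarrow> real"
  assumes "sigma_finite_measure M"
    and p: "2 < p" and C: "0 \<le> C" and s: "s = p / (p - 1)"
    and dm[measurable]: "case_prod d \<in> borel_measurable (M \<Otimes>\<^sub>M M)" and dp: "\<And>x y. 0 < d x y"
    and sym: "\<And>x y. d x y = d y x"
    and near: "\<And>x \<rho>. x \<in> space M \<Longrightarrow> 0 < \<rho> \<Longrightarrow>
      (\<integral>\<^sup>+y. ennreal (d x y powr (-2/p)) * indicator {y. d x y \<le> \<rho>} y \<partial>M) \<le> ennreal (C * \<rho> powr (1 - 2/p))"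
    and far: "\<And>x \<rho>. x \<in> space M \<Longrightarrow> 0 < \<rho> \<Longrightarrow>
      (\<integral>\<^sup>+y. ennreal (d x y powr (-2)) * indicator {y. \<rho> < d x y} y \<partial>M) \<le> ennreal (C / \<rho>)"
    and f[measurable]: "f \<in> borel_measurable M" and g[measurable]: "g \<in> borel_measurable M"
    and f0: "\<And>x. 0 \<le> f x" and g0: "\<And>x. 0 \<le> g x"
    and fs: "(\<integral>\<^sup>+x. ennreal (f x powr s) \<partial>M) \<le> 1"
    and gs: "(\<integral>\<^sup>+x. ennreal (g x powr s) \<partial>M) \<le> 1"
  shows "(\<integral>\<^sup>+x. (\<integral>\<^sup>+y. ennreal (f x * g y * d x y powr (-2/p)) \<partial>M) \<partial>M) \<le> ennreal (4 * C + 2)"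
proof -
  interpret sigma_finite_measure M by fact
  interpret pair_sigma_finite M M ..
  have swap: "(\<integral>\<^sup>+x. (\<integral>\<^sup>+y. ennreal (f x * g y * d x y powr (-2/p)) * indicator {y. f x \<le> g y} y \<partial>M) \<partial>M)
    = (\<integral>\<^sup>+y. (\<integral>\<^sup>+x. ennreal (f x * g y * d x y powr (-2/p)) * indicator {x. f x \<le> g y} x \<partial>M) \<partial>M)"
    using Fubini'[of "\<lambda>x y. ennreal (f x * g y * d x y powr (-2/p)) * indicator {(x, y). f x \<le> g y} (x, y)"]
    by (simp add: indicator_def)
  have "(\<integral>\<^sup>+x. (\<integral>\<^sup>+y. ennreal (f x * g y * d x y powr (-2/p)) \<partial>M) \<partial>M)
    \<le> (\<integral>\<^sup>+x. (\<integral>\<^sup>+y. ennreal (f x * g y * d x y powr (-2/p)) * indicator {y. g y \<le> f x} y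
       + ennreal (f x * g y * d x y powr (-2/p)) * indicator {y. f x \<le> g y} y \<partial>M) \<partial>M)"
    by (intro nn_integral_mono) (auto simp: indicator_def)
  also have "\<dots> = (\<integral>\<^sup>+x. (\<integral>\<^sup>+y. ennreal (f x * g y * d x y powr (-2/p)) * indicator {y. g y \<le> f x} y \<partial>M)
       + (\<integral>\<^sup>+y. ennreal (f x * g y * d x y powr (-2/p)) * indicator {y. f x \<le> g y} y \<partial>M) \<partial>M)"
  proof (intro nn_integral_cong nn_integral_add)
    fix x assume x: "x \<in> space M"
    then have [measurable]: "d x \<in> borel_measurable M" using measurable_compose[OF measurable_Pair1'[OF x] dm] by simp
    show "(\<lambda>y. ennreal (f x * g y * d x y powr (-2/p)) * indicator {y. g y \<le> f x} y) \<in> borel_measurable M"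
      "(\<lambda>y. ennreal (f x * g y * d x y powr (-2/p)) * indicator {y. f x \<le> g y} y) \<in> borel_measurable M"
      by measurable
  qed
  also have "\<dots> = (\<integral>\<^sup>+x. (\<integral>\<^sup>+y. ennreal (f x * g y * d x y powr (-2/p)) * indicator {y. g y \<le> f x} y \<partial>M) \<partial>M)
       + (\<integral>\<^sup>+x. (\<integral>\<^sup>+y. ennreal (f x * g y * d x y powr (-2/p)) * indicator {y. f x \<le> g y} y \<partial>M) \<partial>M)"
  proof (rule nn_integral_add)
    have "(\<lambda>x. \<integral>\<^sup>+y. ennreal (f x * g y * d x y powr (-2/p)) * indicator {(x, y). g y \<le> f x} (x, y) \<partial>M) \<in> borel_measurable M"
      by measurable
    then show "(\<lambda>x. \<integral>\<^sup>+y. ennreal (f x * g y * d x y powr (-2/p)) * indicator {y. g y \<le> f x} y \<partial>M) \<in> borel_measurable M"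
      by (simp add: indicator_def)
    have "(\<lambda>x. \<integral>\<^sup>+y. ennreal (f x * g y * d x y powr (-2/p)) * indicator {(x, y). f x \<le> g y} (x, y) \<partial>M) \<in> borel_measurable M"
      by measurable
    then show "(\<lambda>x. \<integral>\<^sup>+y. ennreal (f x * g y * d x y powr (-2/p)) * indicator {y. f x \<le> g y} y \<partial>M) \<in> borel_measurable M"
      by (simp add: indicator_def)
  qed
  also have "\<dots> \<le> ennreal (2 * C + 1) + ennreal (2 * C + 1)"
  proof (rule add_mono)
    show "(\<integral>\<^sup>+x. (\<integral>\<^sup>+y. ennreal (f x * g y * d x y powr (-2/p)) * indicator {y. g y \<le> f x} y \<partial>M) \<partial>M) \<le> ennreal (2 * C + 1)"
      by (rule hls_half[OF p C s dm dp near far f g f0 g0 fs gs])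
    have "(\<integral>\<^sup>+y. (\<integral>\<^sup>+x. ennreal (g y * f x * d y x powr (-2/p)) * indicator {x. f x \<le> g y} x \<partial>M) \<partial>M) \<le> ennreal (2 * C + 1)"
      by (rule hls_half[OF p C s dm dp near far g f g0 f0 gs fs])
    then show "(\<integral>\<^sup>+x. (\<integral>\<^sup>+y. ennreal (f x * g y * d x y powr (-2/p)) * indicator {y. f x \<le> g y} y \<partial>M) \<partial>M) \<le> ennreal (2 * C + 1)"
      unfolding swap by (simp add: mult.commute[of "f _"] sym[of "_ :: 'a" "_"])
  qed
  also have "\<dots> = ennreal (4 * C + 2)" using C by (simp add: ennreal_plus[symmetric] del: ennreal_plus)
  finally show ?thesis .
qed

section \<open>Integrals over the torus\<close>

text \<open>Jordan's inequality: on \<open>[0, pi / 2]\<close> the concave sine lies above its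
  chord.\<close>

lemma sin_ge_linear:
  assumes "0 \<le> u" "u \<le> pi / 2"
  shows "2 * u / pi \<le> sin u"
proof -
  have "convex_on {0..pi} (\<lambda>x. - sin x)"
    by (rule f''_ge0_imp_convex[where f' = "\<lambda>x. - cos x" and f'' = sin])
       (auto intro!: derivative_eq_intros sin_ge_zero)
  then have "- sin ((1 - 2 * u / pi) * 0 + 2 * u / pi * (pi / 2)) \<le> (1 - 2 * u / pi) * (- sin 0) + 2 * u / pi * (- sin (pi / 2))"
    using assms by (intro convex_onD[of _ _ "2 * u / pi" 0 "pi / 2", simplified real_scaleR_def]) (auto simp: field_simps)
  then show ?thesis by simp
qed

section \<open>The torus as a finite measure space, and integrals of functions of the sine\<close>

lemma sets_torus_borel: "f \<in> borel_measurable borel \<Longrightarrow> f \<in> borel_measurable torus"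
  unfolding torus_def by (intro measurable_restrict_space1 measurable_completion) simp

lemma id_measurable_torus: "(\<lambda>x. x) \<in> borel_measurable torus"
  by (rule sets_torus_borel) simp

lemma space_torus[simp]: "space torus = {0..<2 * pi}"
  by (simp add: torus_def space_restrict_space)

lemma finite_measure_torus: "finite_measure torus"
  unfolding torus_def by (intro finite_measure_lebesgue_on bounded_set_imp_lmeasurable) auto

lemma emeasure_torus: "emeasure torus (space torus) = ennreal (2 * pi)"
  by (simp add: torus_def emeasure_restrict_space space_restrict_space)

interpretation torus: finite_measure torus by (rule finite_measure_torus)

interpretation torus_pair: pair_sigma_finite torus torus ..

lemma nn_integral_torus: "(\<integral>\<^sup>+x. f x \<partial>torus) = (\<integral>\<^sup>+x. f x * indicator {0..<2 * pi} x \<partial>lborel)"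
  unfolding torus_def by (subst nn_integral_restrict_space) (auto simp: nn_integral_completion)

text \<open>The function \<open>\<bar>sin\<bar>\<close> has period \<open>pi\<close>, and
  \<open>x - y\<close> lies strictly between \<open>-2 * pi\<close> and \<open>2 * pi\<close>, so
  the nearest multiple of \<open>pi\<close> is one of five. Each contributes an even function
  supported in \<open>[-pi/2, pi/2]\<close>, which gives the factor 10.\<close>

lemma torus_sin_integral:
  fixes k h :: "real \<Rightarrow> ennreal"
  assumes h[measurable]: "h \<in> borel_measurable borel"
    and kh: "\<And>u. 0 \<le> u \<Longrightarrow> u \<le> pi / 2 \<Longrightarrow> k (sin u) \<le> h u"
    and x: "x \<in> space torus"
  shows "(\<integral>\<^sup>+y. k \<bar>sin (x - y)\<bar> \<partial>torus) \<le> 10 * (\<integral>\<^sup>+u. h u * indicator {0..pi / 2} u \<partial>lborel)"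
proof -
  define H where "H = (\<lambda>u. h \<bar>u\<bar> * indicator {0..pi / 2} \<bar>u\<bar>)"
  have [measurable]: "H \<in> borel_measurable borel" unfolding H_def by measurable
  have pw: "k \<bar>sin (x - y)\<bar> * indicator {0..<2 * pi} y \<le> (\<Sum>j\<in>{-2..2::int}. H (x - y - of_int j * pi))" for y
  proof (cases "y \<in> {0..<2 * pi}")
    case True
    define v where "v = (x - y) / pi"
    define j where "j = round v"
    have xy: "x - y = v * pi" by (simp add: v_def)
    have rv: "\<bar>of_int j - v\<bar> \<le> 1 / 2" unfolding j_def by (rule of_int_round_abs_le)
    have "\<bar>x - y\<bar> < 2 * pi" using True x by auto
    then have "\<bar>v\<bar> < 2" by (simp add: v_def abs_mult field_simps)
    then have "\<bar>real_of_int j\<bar> < 3" using rv by linarith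
    then have j: "j \<in> {-2..2}" by auto
    define u where "u = x - y - of_int j * pi"
    have "u = (v - of_int j) * pi" by (simp add: u_def xy algebra_simps)
    then have "\<bar>u\<bar> = \<bar>of_int j - v\<bar> * pi" by (simp add: abs_mult abs_minus_commute)
    also have "\<dots> \<le> 1 / 2 * pi" using rv by (intro mult_right_mono) auto
    finally have u: "\<bar>u\<bar> \<le> pi / 2" by simp
    have "sin (x - y) = sin (u + pi * of_int j)" by (simp add: u_def mult.commute)
    also have "\<dots> = sin u * cos (pi * of_int j)" by (simp add: sin_add)
    finally have "\<bar>sin (x - y)\<bar> = \<bar>sin u\<bar>" by (simp add: abs_mult)
    also have "\<dots> = sin \<bar>u\<bar>"
    proof (cases "u \<ge> 0")
      case True
      then have "sin u \<ge> 0" using u by (intro sin_ge_zero) auto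
      then show ?thesis using True by simp
    next
      case False
      then have "sin (-u) \<ge> 0" using u by (intro sin_ge_zero) auto
      then show ?thesis using False by simp
    qed
    finally have "k \<bar>sin (x - y)\<bar> \<le> h \<bar>u\<bar>" using kh[of "\<bar>u\<bar>"] u by simp
    also have "\<dots> = H u" using u by (simp add: H_def)
    also have "\<dots> \<le> (\<Sum>j\<in>{-2..2::int}. H (x - y - of_int j * pi))"
      unfolding u_def using j by (intro member_le_sum) auto
    finally show ?thesis using True by simp
  qed simp
  have shift: "(\<integral>\<^sup>+y. H (x - y - of_int j * pi) \<partial>lborel) = (\<integral>\<^sup>+u. H u \<partial>lborel)" for j :: int
    using nn_integral_real_affine[of H "-1" "x - of_int j * pi"] by (simp add: algebra_simps)
  have "(\<integral>\<^sup>+u. H u \<partial>lborel) \<le> (\<integral>\<^sup>+u. h u * indicator {0..pi / 2} u + h (-u) * indicator {0..pi / 2} (-u) \<partial>lborel)"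
    by (intro nn_integral_mono) (auto simp: H_def indicator_def abs_if)
  also have "\<dots> = (\<integral>\<^sup>+u. h u * indicator {0..pi / 2} u \<partial>lborel) + (\<integral>\<^sup>+u. h (-u) * indicator {0..pi / 2} (-u) \<partial>lborel)"
    by (rule nn_integral_add) measurable
  also have "(\<integral>\<^sup>+u. h (-u) * indicator {0..pi / 2} (-u) \<partial>lborel) = (\<integral>\<^sup>+u. h u * indicator {0..pi / 2} u \<partial>lborel)"
    using nn_integral_real_affine[of "\<lambda>u. h u * indicator {0..pi / 2} u" "-1" 0] by simp
  finally have HH: "(\<integral>\<^sup>+u. H u \<partial>lborel) \<le> 2 * (\<integral>\<^sup>+u. h u * indicator {0..pi / 2} u \<partial>lborel)" by (simp add: mult_2)
  have "(\<integral>\<^sup>+y. k \<bar>sin (x - y)\<bar> \<partial>torus) \<le> (\<integral>\<^sup>+y. (\<Sum>j\<in>{-2..2::int}. H (x - y - of_int j * pi)) \<partial>lborel)"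
    unfolding nn_integral_torus by (intro nn_integral_mono pw)
  also have "\<dots> = (\<Sum>j\<in>{-2..2::int}. \<integral>\<^sup>+y. H (x - y - of_int j * pi) \<partial>lborel)"
    by (rule nn_integral_sum) measurable
  also have "\<dots> = 5 * (\<integral>\<^sup>+u. H u \<partial>lborel)" unfolding shift by simp
  also have "\<dots> \<le> 5 * (2 * (\<integral>\<^sup>+u. h u * indicator {0..pi / 2} u \<partial>lborel))"
    by (intro mult_left_mono HH) simp
  also have "\<dots> = 10 * (\<integral>\<^sup>+u. h u * indicator {0..pi / 2} u \<partial>lborel)"
    by (simp flip: mult.assoc)
  finally show ?thesis .
qed

text \<open>A maximum is at least the mean, so by Jordan's inequality
  \<open>max (sin u) e \<ge> (2 * u / pi + e) / 2\<close>. The resulting majorant has an elementary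
  antiderivative, a power for \<open>\<gamma> \<noteq> 1\<close>. The restriction to
  \<open>\<bar>sin\<bar> \<le> T\<close> becomes \<open>u \<le> pi / 2 * T\<close>.\<close>

lemma torus_max_sin_integral:
  assumes e: "0 < e" and \<gamma>: "0 < \<gamma>" "\<gamma> \<noteq> 1" and T: "0 \<le> T" and x: "x \<in> space torus"
  shows "(\<integral>\<^sup>+y. ennreal (max \<bar>sin (x - y)\<bar> e powr (-\<gamma>)) * indicator {y. \<bar>sin (x - y)\<bar> \<le> T} y \<partial>torus)
    \<le> ennreal (5 * pi * 2 powr \<gamma> * (((T + e) powr (1 - \<gamma>) - e powr (1 - \<gamma>)) / (1 - \<gamma>)))"
proof -
  define k where "k = (\<lambda>s. ennreal (max s e powr (-\<gamma>)) * indicator {..T} s)"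
  define A where "A = pi / 2 * T"
  define \<phi> where "\<phi> = (\<lambda>u. 2 powr \<gamma> * (2 * u / pi + e) powr (-\<gamma>))"
  define h where "h = (\<lambda>u. ennreal (\<phi> u) * indicator {..A} u)"
  define G where "G = (\<lambda>u. 2 powr \<gamma> * (pi / 2) * ((2 * u / pi + e) powr (1 - \<gamma>) / (1 - \<gamma>)))"
  have A: "A \<ge> 0" using T by (simp add: A_def)
  have [measurable]: "\<phi> \<in> borel_measurable borel" unfolding \<phi>_def by measurable
  have [measurable]: "h \<in> borel_measurable borel" unfolding h_def by measurable
  have kh: "k (sin u) \<le> h u" if u: "0 \<le> u" "u \<le> pi / 2" for u
  proof (cases "sin u \<le> T")
    case True
    have s: "2 * u / pi \<le> sin u" using u by (rule sin_ge_linear)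
    then have "2 * u / pi \<le> T" using True by linarith
    then have "u \<le> A" by (simp add: A_def field_simps)
    moreover have "max (sin u) e powr (-\<gamma>) \<le> \<phi> u"
    proof -
      have "max (sin u) e powr (-\<gamma>) \<le> ((2 * u / pi + e) / 2) powr (-\<gamma>)"
        using e u s \<gamma> by (intro powr_mono2') (auto simp: add_nonneg_pos)
      also have "\<dots> = \<phi> u" using e u by (simp only: \<phi>_def powr_divide powr_minus) (simp add: field_simps)
      finally show ?thesis .
    qed
    ultimately show ?thesis using True by (simp add: k_def h_def ennreal_leI)
  qed (simp add: k_def)
  have dG: "DERIV G u :> \<phi> u" if "0 \<le> u" for u
  proof -
    have p: "2 * u / pi + e > 0" using that e by (simp add: add_nonneg_pos)
    have "((\<lambda>u. (2 * u / pi + e) powr (1 - \<gamma>)) has_real_derivative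
       (1 - \<gamma>) * (2 * u / pi + e) powr (1 - \<gamma> - 1) * (2 / pi)) (at u)"
    proof -
      have "((\<lambda>u. 2 * u / pi + e) has_real_derivative 2 / pi) (at u)"
        by (auto intro!: derivative_eq_intros)
      from DERIV_fun_powr[OF this p, of "1 - \<gamma>"] show ?thesis by simp
    qed
    then have "(G has_real_derivative 2 powr \<gamma> * (pi / 2) * ((1 - \<gamma>) * (2 * u / pi + e) powr (1 - \<gamma> - 1) * (2 / pi) / (1 - \<gamma>))) (at u)"
      unfolding G_def by (intro DERIV_cmult DERIV_cdivide)
    moreover have "2 powr \<gamma> * (pi / 2) * ((1 - \<gamma>) * (2 * u / pi + e) powr (1 - \<gamma> - 1) * (2 / pi) / (1 - \<gamma>)) = \<phi> u"
      using \<gamma> by (simp add: \<phi>_def field_simps)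
    ultimately show ?thesis by simp
  qed
  have "(\<integral>\<^sup>+y. ennreal (max \<bar>sin (x - y)\<bar> e powr (-\<gamma>)) * indicator {y. \<bar>sin (x - y)\<bar> \<le> T} y \<partial>torus)
    = (\<integral>\<^sup>+y. k \<bar>sin (x - y)\<bar> \<partial>torus)"
    by (simp add: k_def indicator_def)
  also have "\<dots> \<le> 10 * (\<integral>\<^sup>+u. h u * indicator {0..pi / 2} u \<partial>lborel)"
    by (rule torus_sin_integral) (use kh x in auto)
  also have "(\<integral>\<^sup>+u. h u * indicator {0..pi / 2} u \<partial>lborel) \<le> (\<integral>\<^sup>+u. ennreal (\<phi> u) * indicator {0..A} u \<partial>lborel)"
    by (intro nn_integral_mono) (auto simp: h_def indicator_def)
  also have "(\<integral>\<^sup>+u. ennreal (\<phi> u) * indicator {0..A} u \<partial>lborel) = ennreal (G A - G 0)"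
    by (rule nn_integral_FTC_Icc) (use dG A in \<open>auto simp: \<phi>_def\<close>)
  also have "10 * ennreal (G A - G 0) = ennreal (10 * (G A - G 0))"
  proof -
    have "G 0 \<le> G A"
      by (rule DERIV_nonneg_imp_nondecreasing[of 0 A G]) (use A dG in \<open>auto simp: \<phi>_def intro!: exI\<close>)
    then have "ennreal (10 * (G A - G 0)) = ennreal 10 * ennreal (G A - G 0)"
      by (intro ennreal_mult) auto
    then show ?thesis by simp
  qed
  also have "10 * (G A - G 0) = 5 * pi * 2 powr \<gamma> * (((T + e) powr (1 - \<gamma>) - e powr (1 - \<gamma>)) / (1 - \<gamma>))"
  proof -
    have "10 * (c * (pi / 2) * (u / w) - c * (pi / 2) * (v / w)) = 5 * pi * c * ((u - v) / w)" for c u v w :: real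
      by (simp add: diff_divide_distrib algebra_simps)
    moreover have "2 * A / pi + e = T + e" "2 * 0 / pi + e = e" by (simp_all add: A_def)
    ultimately show ?thesis unfolding G_def by (simp only:)
  qed
  finally show ?thesis by (simp add: mult_left_mono)
qed

section \<open>Norms of convolution operators\<close>

lemma torus_diff_measurable:
  assumes "K \<in> borel_measurable borel"
  shows "(\<lambda>(x, y). K (x - y)) \<in> borel_measurable (torus \<Otimes>\<^sub>M torus)"
proof -
  have "(\<lambda>z. fst z - snd z) \<in> borel_measurable (torus \<Otimes>\<^sub>M torus)"
    by (intro borel_measurable_diff measurable_compose[OF measurable_fst id_measurable_torus]
        measurable_compose[OF measurable_snd id_measurable_torus])
  from measurable_compose[OF this assms] show ?thesis by (simp add: case_prod_unfold)
qed

lemma torus_Lp_unit_ball: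
  assumes "s > 0" "torus_norm (ennreal s) g \<le> 1"
  shows "(\<integral>\<^sup>+x. ennreal (norm (g x) powr s) \<partial>torus) \<le> 1"
proof -
  define I where "I = (\<integral>\<^sup>+x. ennreal (norm (g x) powr s) \<partial>torus)"
  have n: "torus_norm (ennreal s) g = (if I = \<infinity> then \<infinity> else ennreal (enn2real I powr (1 / s)))"
    using assms(1) by (simp add: torus_norm_def I_def Let_def)
  have I: "I \<noteq> \<infinity>" using assms(2) n by (auto split: if_splits simp: top_unique)
  then have "enn2real I powr (1 / s) \<le> 1" using assms(2) n by simp
  then have "(enn2real I powr (1 / s)) powr s \<le> 1 powr s" using assms(1) by (intro powr_mono2) auto
  then have "enn2real I \<le> 1" using assms(1) by (simp add: powr_powr)
  then have "ennreal (enn2real I) \<le> 1" by simp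
  then show ?thesis using I by (simp add: I_def top.not_eq_extremum)
qed

lemma torus_norm_le_powr:
  assumes p: "p > 0" and j: "j \<ge> 0" and le: "(\<integral>\<^sup>+x. ennreal (norm (h x) powr p) \<partial>torus) \<le> ennreal j"
  shows "torus_norm (ennreal p) h \<le> ennreal (j powr (1 / p))"
proof -
  define I where "I = (\<integral>\<^sup>+x. ennreal (norm (h x) powr p) \<partial>torus)"
  have I: "I \<noteq> \<infinity>" using le by (auto simp: I_def top_unique)
  have "enn2real I \<le> j" using le j unfolding I_def by (rule enn2real_leI[rotated])
  then show ?thesis
    using p I by (simp add: torus_norm_def I_def[symmetric] Let_def ennreal_leI powr_mono2)
qed

text \<open>The bound is unconditional because the Bochner integral of a non-integrable function is
  0.\<close>

lemma torus_conv_norm_le: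
  "ennreal (norm (torus_conv g K x)) \<le> (\<integral>\<^sup>+y. ennreal (norm (g y) * norm (K (x - y))) \<partial>torus)"
proof (cases "integrable torus (\<lambda>y. g y * K (x - y))")
  case True
  show ?thesis
    using integral_norm_bound_ennreal[OF True] by (simp add: torus_conv_def norm_mult)
next
  case False
  then show ?thesis by (simp add: torus_conv_def not_integrable_integral_eq)
qed

text \<open>Duality: the bilinear form is tested against \<open>F powr (p - 1)\<close>, normalized, where \<open>F\<close>
  dominates the convolution. Boundedness of the kernel makes \<open>\<integral> F powr p\<close> finite a priori.\<close>

lemma torus_opnorm_le_bilinear:
  fixes K :: "real \<Rightarrow> complex" and p s B D :: real
  assumes p: "1 < p" and s: "s = p / (p - 1)" and K: "K \<in> borel_measurable borel"
    and B: "\<And>\<theta>. norm (K \<theta>) \<le> B" and D: "0 \<le> D"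
    and bil: "\<And>f g :: real \<Rightarrow> real. f \<in> borel_measurable torus \<Longrightarrow> g \<in> borel_measurable torus \<Longrightarrow>
      (\<And>x. 0 \<le> f x) \<Longrightarrow> (\<And>x. 0 \<le> g x) \<Longrightarrow>
      (\<integral>\<^sup>+x. ennreal (f x powr s) \<partial>torus) \<le> 1 \<Longrightarrow> (\<integral>\<^sup>+x. ennreal (g x powr s) \<partial>torus) \<le> 1 \<Longrightarrow>
      (\<integral>\<^sup>+x. (\<integral>\<^sup>+y. ennreal (f x * g y * norm (K (x - y))) \<partial>torus) \<partial>torus) \<le> ennreal D"
  shows "torus_opnorm (ennreal s) (ennreal p) (\<lambda>g. torus_conv g K) \<le> ennreal D"
  unfolding torus_opnorm_def
proof (rule SUP_least)
  fix G assume "G \<in> {f \<in> torus_Lp (ennreal s). torus_norm (ennreal s) f \<le> 1}"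
  then have Gm[measurable]: "G \<in> borel_measurable torus" and Gn: "torus_norm (ennreal s) G \<le> 1"
    by (auto simp: torus_Lp_def)
  have s1: "s > 1" using p by (simp add: s field_simps)
  have sp: "(p - 1) * s = p" using p by (simp add: s)
  have B0: "B \<ge> 0" using B[of 0] norm_ge_zero[of "K 0"] by linarith
  define g where "g = (\<lambda>y. norm (G y))"
  have gm[measurable]: "g \<in> borel_measurable torus" unfolding g_def by measurable
  have gs: "(\<integral>\<^sup>+y. ennreal (g y powr s) \<partial>torus) \<le> 1"
    unfolding g_def using s1 Gn by (intro torus_Lp_unit_ball) auto
  have Km[measurable]: "(\<lambda>(x, y). K (x - y)) \<in> borel_measurable (torus \<Otimes>\<^sub>M torus)"
    using K by (rule torus_diff_measurable)
  define Fe where "Fe = (\<lambda>x. \<integral>\<^sup>+y. ennreal (g y * norm (K (x - y))) \<partial>torus)"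
  define F where "F = (\<lambda>x. enn2real (Fe x))"
  have Fem[measurable]: "Fe \<in> borel_measurable torus"
    unfolding Fe_def by measurable
  have Fm[measurable]: "F \<in> borel_measurable torus" unfolding F_def by measurable
  \<comment> \<open>From \<open>g \<le> 1 + g powr s\<close> the integral of \<open>g\<close> is at
    most \<open>2 * pi + 1\<close>, which bounds the dominating convolution at every point. This
    \<open>B'\<close> guarantees finiteness only and does not enter the final constant.\<close>
  define B' where "B' = B * (2 * pi + 1)"
  have FeB: "Fe x \<le> ennreal B'" for x
  proof -
    have "Fe x \<le> (\<integral>\<^sup>+y. ennreal B * (1 + ennreal (g y powr s)) \<partial>torus)"
      unfolding Fe_def
    proof (rule nn_integral_mono)
      fix y
      have "g y \<le> 1 + g y powr s"
      proof (cases "g y \<le> 1")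
        case True
        then show ?thesis by (simp add: add_increasing2)
      next
        case False
        then have "g y powr 1 \<le> g y powr s" using s1 by (intro powr_mono) auto
        then show ?thesis using False by simp
      qed
      then have "g y * norm (K (x - y)) \<le> (1 + g y powr s) * B"
        using B by (intro mult_mono) (auto simp: g_def add_nonneg_nonneg)
      then have "ennreal (g y * norm (K (x - y))) \<le> ennreal ((1 + g y powr s) * B)" by (rule ennreal_leI)
      also have "\<dots> = ennreal B * (1 + ennreal (g y powr s))"
        using B0 by (simp add: ennreal_mult mult.commute)
      finally show "ennreal (g y * norm (K (x - y))) \<le> ennreal B * (1 + ennreal (g y powr s))" .
    qed
    also have "\<dots> = ennreal B * ((\<integral>\<^sup>+y. 1 \<partial>torus) + (\<integral>\<^sup>+y. ennreal (g y powr s) \<partial>torus))"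
      by (simp add: nn_integral_cmult nn_integral_add)
    also have "\<dots> \<le> ennreal B * (ennreal (2 * pi) + 1)"
      using gs emeasure_torus by (intro mult_left_mono add_mono) auto
    also have "\<dots> = ennreal B'"
      using B0 by (simp add: B'_def ennreal_mult)
    finally show ?thesis .
  qed
  have FeF: "ennreal (F x) = Fe x" for x
    using FeB[of x] by (simp add: F_def top.not_eq_extremum le_less_trans[OF _ ennreal_less_top])
  have F0: "0 \<le> F x" for x by (simp add: F_def)
  have FB: "F x \<le> B'" for x
    using FeB[of x] B0 unfolding F_def by (intro enn2real_leI) (auto simp: B'_def)
  define J where "J = (\<integral>\<^sup>+x. ennreal (F x powr p) \<partial>torus)"
  define j where "j = enn2real J"
  have "J \<le> (\<integral>\<^sup>+x. ennreal (B' powr p) \<partial>torus)"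
    unfolding J_def using p FB F0 by (intro nn_integral_mono ennreal_leI powr_mono2) auto
  also have "\<dots> = ennreal (B' powr p) * ennreal (2 * pi)" using emeasure_torus by simp
  also have "\<dots> < \<infinity>" by (simp add: ennreal_mult_less_top)
  finally have Jj: "J = ennreal j" by (simp add: j_def)
  have j0: "j \<ge> 0" by (simp add: j_def)
  have "(\<integral>\<^sup>+x. ennreal (norm (torus_conv G K x) powr p) \<partial>torus) \<le> ennreal j"
    unfolding Jj[symmetric] J_def
  proof (intro nn_integral_mono ennreal_leI powr_mono2)
    fix x
    have "ennreal (norm (torus_conv G K x)) \<le> ennreal (F x)"
      unfolding FeF Fe_def g_def by (rule torus_conv_norm_le)
    then show "norm (torus_conv G K x) \<le> F x" using F0 by simp
  qed (use p in auto)
  then have "torus_norm (ennreal p) (torus_conv G K) \<le> ennreal (j powr (1 / p))"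
    using p j0 by (intro torus_norm_le_powr) auto
  also have "\<dots> \<le> ennreal D"
  proof (cases "j = 0")
    case True
    then show ?thesis by simp
  next
    case False
    then have jp: "j > 0" using j0 by simp
    \<comment> \<open>Since \<open>(p - 1) * s = p\<close>, this \<open>f\<close> has norm 1 in
      \<open>L^s\<close>. The bilinear form at \<open>f\<close> and \<open>g\<close> then equals
      \<open>j powr (-1 / s) * j = j powr (1 / p)\<close>, the norm of \<open>F\<close> in
      \<open>L^p\<close>.\<close>
    define f where "f = (\<lambda>x. j powr (-1 / s) * F x powr (p - 1))"
    have [measurable]: "f \<in> borel_measurable torus" unfolding f_def by measurable
    have fs: "f x powr s = j powr (-1) * F x powr p" for x
      using s1 by (simp add: f_def powr_mult powr_powr sp)
    have "(\<integral>\<^sup>+x. ennreal (f x powr s) \<partial>torus) = ennreal (j powr (-1)) * J"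
      unfolding fs J_def by (subst ennreal_mult) (auto intro!: nn_integral_cmult)
    also have "\<dots> = 1" unfolding Jj using jp by (simp add: ennreal_mult[symmetric] powr_minus)
    finally have f1: "(\<integral>\<^sup>+x. ennreal (f x powr s) \<partial>torus) \<le> 1" by simp
    have "(\<integral>\<^sup>+x. (\<integral>\<^sup>+y. ennreal (f x * g y * norm (K (x - y))) \<partial>torus) \<partial>torus) \<le> ennreal D"
      using f1 gs by (intro bil) (auto simp: f_def g_def)
    moreover have "(\<integral>\<^sup>+y. ennreal (f x * g y * norm (K (x - y))) \<partial>torus) = ennreal (j powr (-1 / s)) * ennreal (F x powr p)"
      if "x \<in> space torus" for x
    proof -
      have [measurable]: "(\<lambda>y. K (x - y)) \<in> borel_measurable torus"
        using measurable_compose[OF measurable_Pair1'[OF that] Km] by simp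
      have "(\<integral>\<^sup>+y. ennreal (f x * g y * norm (K (x - y))) \<partial>torus) = (\<integral>\<^sup>+y. ennreal (f x) * ennreal (g y * norm (K (x - y))) \<partial>torus)"
        by (intro nn_integral_cong) (simp add: ennreal_mult[symmetric] f_def g_def mult.assoc)
      also have "\<dots> = ennreal (f x) * Fe x" unfolding Fe_def by (rule nn_integral_cmult) measurable
      also have "\<dots> = ennreal (f x * F x)" unfolding FeF[symmetric] using F0 by (simp add: ennreal_mult f_def)
      also have "f x * F x = j powr (-1 / s) * F x powr p"
        using F0[of x] p by (cases "F x = 0") (simp_all add: f_def powr_diff)
      finally show ?thesis by (simp add: ennreal_mult)
    qed
    then have "(\<integral>\<^sup>+x. (\<integral>\<^sup>+y. ennreal (f x * g y * norm (K (x - y))) \<partial>torus) \<partial>torus)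
      = (\<integral>\<^sup>+x. ennreal (j powr (-1 / s)) * ennreal (F x powr p) \<partial>torus)"
      by (rule nn_integral_cong)
    ultimately have "(\<integral>\<^sup>+x. ennreal (j powr (-1 / s)) * ennreal (F x powr p) \<partial>torus) \<le> ennreal D"
      by simp
    also have "(\<integral>\<^sup>+x. ennreal (j powr (-1 / s)) * ennreal (F x powr p) \<partial>torus) = ennreal (j powr (-1 / s)) * J"
      unfolding J_def by (rule nn_integral_cmult) measurable
    also have "\<dots> = ennreal (j powr (-1 / s) * j powr 1)" unfolding Jj using jp by (simp add: ennreal_mult)
    also have "j powr (-1 / s) * j powr 1 = j powr (-1 / s + 1)" by (simp only: powr_add)
    also have "-1 / s + 1 = 1 / p" using p by (simp add: s field_simps)
    finally show ?thesis .
  qed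
  finally show "torus_norm (ennreal p) (torus_conv G K) \<le> ennreal D" .
qed

lemma torus_opnorm_1_infinity:
  assumes K: "K \<in> borel_measurable borel" and B: "\<And>\<theta>. norm (K \<theta>) \<le> B"
  shows "torus_opnorm 1 \<infinity> (\<lambda>g. torus_conv g K) \<le> ennreal B"
  unfolding torus_opnorm_def
proof (rule SUP_least)
  fix G assume "G \<in> {f \<in> torus_Lp 1. torus_norm 1 f \<le> 1}"
  then have Gm[measurable]: "G \<in> borel_measurable torus" and Gn: "torus_norm (ennreal 1) G \<le> 1"
    by (auto simp: torus_Lp_def)
  have g1: "(\<integral>\<^sup>+y. ennreal (norm (G y)) \<partial>torus) \<le> 1"
    using torus_Lp_unit_ball[OF _ Gn] by simp
  have B0: "B \<ge> 0" using B[of 0] norm_ge_zero[of "K 0"] by linarith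
  have [measurable]: "(\<lambda>(x, y). K (x - y)) \<in> borel_measurable (torus \<Otimes>\<^sub>M torus)"
    using K by (rule torus_diff_measurable)
  have "ennreal (norm (torus_conv G K x)) \<le> ennreal B" for x
  proof -
    have "ennreal (norm (torus_conv G K x)) \<le> (\<integral>\<^sup>+y. ennreal (norm (G y) * norm (K (x - y))) \<partial>torus)"
      by (rule torus_conv_norm_le)
    also have "\<dots> \<le> (\<integral>\<^sup>+y. ennreal B * ennreal (norm (G y)) \<partial>torus)"
      using B B0 by (intro nn_integral_mono) (simp add: ennreal_mult[symmetric] mult.commute[of B] mult_left_mono ennreal_leI)
    also have "\<dots> = ennreal B * (\<integral>\<^sup>+y. ennreal (norm (G y)) \<partial>torus)"
      by (rule nn_integral_cmult) measurable
    also have "\<dots> \<le> ennreal B * 1" using g1 by (intro mult_left_mono) auto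
    finally show ?thesis by simp
  qed
  \<comment> \<open>\<open>esssup\<close> of a non-measurable function is \<open>top\<close>, so the
    pointwise bound alone would not give the norm.\<close>
  moreover have "(\<lambda>x. ennreal (norm (torus_conv G K x))) \<in> borel_measurable torus"
    unfolding torus_conv_def by measurable
  ultimately show "torus_norm \<infinity> (torus_conv G K) \<le> ennreal B"
    by (auto simp: torus_norm_def intro!: esssup_I)
qed

text \<open>Schur's test: \<open>f x * g y\<close> is at most
  \<open>f x powr 2 / 2 + g y powr 2 / 2\<close>, and in each term the kernel is integrated over the
  free variable. Evenness makes the bound for rows serve for columns.\<close>

lemma torus_opnorm_2_le_L1:
  assumes K: "K \<in> borel_measurable borel" and B: "\<And>\<theta>. norm (K \<theta>) \<le> B" and D: "0 \<le> D"
    and even: "\<And>\<theta>. norm (K (-\<theta>)) = norm (K \<theta>)"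
    and int: "\<And>x. x \<in> space torus \<Longrightarrow> (\<integral>\<^sup>+y. ennreal (norm (K (x - y))) \<partial>torus) \<le> ennreal D"
  shows "torus_opnorm 2 2 (\<lambda>g. torus_conv g K) \<le> ennreal D"
proof -
  have [measurable]: "(\<lambda>(x, y). K (x - y)) \<in> borel_measurable (torus \<Otimes>\<^sub>M torus)"
    using K by (rule torus_diff_measurable)
  have half: "(\<integral>\<^sup>+x. (\<integral>\<^sup>+y. ennreal (f x powr 2 / 2) * ennreal (norm (K (x - y))) \<partial>torus) \<partial>torus) \<le> ennreal (D / 2)"
    if f[measurable]: "f \<in> borel_measurable torus" and f1: "(\<integral>\<^sup>+x. ennreal (f x powr 2) \<partial>torus) \<le> 1" for f :: "real \<Rightarrow> real"
  proof -
    have "(\<integral>\<^sup>+x. (\<integral>\<^sup>+y. ennreal (f x powr 2 / 2) * ennreal (norm (K (x - y))) \<partial>torus) \<partial>torus)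
      = (\<integral>\<^sup>+x. ennreal (f x powr 2 / 2) * (\<integral>\<^sup>+y. ennreal (norm (K (x - y))) \<partial>torus) \<partial>torus)"
    proof (intro nn_integral_cong nn_integral_cmult)
      fix x assume x: "x \<in> space torus"
      have "(\<lambda>y. K (x - y)) \<in> borel_measurable torus"
        using measurable_compose[OF measurable_Pair1'[OF x] torus_diff_measurable[OF K]] by simp
      then show "(\<lambda>y. ennreal (norm (K (x - y)))) \<in> borel_measurable torus" by measurable
    qed
    also have "\<dots> \<le> (\<integral>\<^sup>+x. ennreal (D / 2) * ennreal (f x powr 2) \<partial>torus)"
    proof (rule nn_integral_mono)
      fix x assume "x \<in> space torus"
      then have "ennreal (f x powr 2 / 2) * (\<integral>\<^sup>+y. ennreal (norm (K (x - y))) \<partial>torus) \<le> ennreal (f x powr 2 / 2) * ennreal D"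
        by (intro mult_left_mono int) auto
      also have "\<dots> = ennreal (D / 2) * ennreal (f x powr 2)" using D by (simp add: ennreal_mult[symmetric] mult.commute)
      finally show "ennreal (f x powr 2 / 2) * (\<integral>\<^sup>+y. ennreal (norm (K (x - y))) \<partial>torus) \<le> ennreal (D / 2) * ennreal (f x powr 2)" .
    qed
    also have "\<dots> = ennreal (D / 2) * (\<integral>\<^sup>+x. ennreal (f x powr 2) \<partial>torus)" by (rule nn_integral_cmult) measurable
    also have "\<dots> \<le> ennreal (D / 2) * 1" by (intro mult_left_mono f1) auto
    finally show ?thesis by simp
  qed
  have "torus_opnorm (ennreal 2) (ennreal 2) (\<lambda>g. torus_conv g K) \<le> ennreal D"
  proof (rule torus_opnorm_le_bilinear[OF _ _ K B D])
    fix f g :: "real \<Rightarrow> real"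
    assume f[measurable]: "f \<in> borel_measurable torus" and g[measurable]: "g \<in> borel_measurable torus"
      and f0: "\<And>x. 0 \<le> f x" and g0: "\<And>x. 0 \<le> g x"
      and f1: "(\<integral>\<^sup>+x. ennreal (f x powr 2) \<partial>torus) \<le> 1" and g1: "(\<integral>\<^sup>+x. ennreal (g x powr 2) \<partial>torus) \<le> 1"
    have "(\<integral>\<^sup>+x. (\<integral>\<^sup>+y. ennreal (f x * g y * norm (K (x - y))) \<partial>torus) \<partial>torus)
      \<le> (\<integral>\<^sup>+x. (\<integral>\<^sup>+y. ennreal (f x powr 2 / 2) * ennreal (norm (K (x - y)))
          + ennreal (g y powr 2 / 2) * ennreal (norm (K (x - y))) \<partial>torus) \<partial>torus)"
    proof (intro nn_integral_mono)
      fix x y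
      have "f x * g y \<le> f x powr 2 / 2 + g y powr 2 / 2"
        using f0[of x] g0[of y] zero_le_power2[of "f x - g y"] by (simp add: power2_eq_square algebra_simps)
      then have "f x * g y * norm (K (x - y)) \<le> (f x powr 2 / 2 + g y powr 2 / 2) * norm (K (x - y))"
        by (intro mult_right_mono) auto
      then have "ennreal (f x * g y * norm (K (x - y))) \<le> ennreal ((f x powr 2 / 2 + g y powr 2 / 2) * norm (K (x - y)))"
        by (rule ennreal_leI)
      then show "ennreal (f x * g y * norm (K (x - y))) \<le> ennreal (f x powr 2 / 2) * ennreal (norm (K (x - y)))
          + ennreal (g y powr 2 / 2) * ennreal (norm (K (x - y)))"
        by (simp add: ennreal_mult[symmetric] ennreal_plus[symmetric] algebra_simps del: ennreal_plus)
    qed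
    also have "\<dots> = (\<integral>\<^sup>+x. ((\<integral>\<^sup>+y. ennreal (f x powr 2 / 2) * ennreal (norm (K (x - y))) \<partial>torus)
          + (\<integral>\<^sup>+y. ennreal (g y powr 2 / 2) * ennreal (norm (K (x - y))) \<partial>torus)) \<partial>torus)"
    proof (intro nn_integral_cong nn_integral_add)
      fix x assume x: "x \<in> space torus"
      have [measurable]: "(\<lambda>y. K (x - y)) \<in> borel_measurable torus"
        using measurable_compose[OF measurable_Pair1'[OF x] torus_diff_measurable[OF K]] by simp
      show "(\<lambda>y. ennreal (f x powr 2 / 2) * ennreal (norm (K (x - y)))) \<in> borel_measurable torus"
        "(\<lambda>y. ennreal (g y powr 2 / 2) * ennreal (norm (K (x - y)))) \<in> borel_measurable torus"
        by measurable
    qed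
    also have "\<dots> = (\<integral>\<^sup>+x. (\<integral>\<^sup>+y. ennreal (f x powr 2 / 2) * ennreal (norm (K (x - y))) \<partial>torus) \<partial>torus)
          + (\<integral>\<^sup>+x. (\<integral>\<^sup>+y. ennreal (g y powr 2 / 2) * ennreal (norm (K (x - y))) \<partial>torus) \<partial>torus)"
      by (rule nn_integral_add) measurable
    also have "(\<integral>\<^sup>+x. (\<integral>\<^sup>+y. ennreal (g y powr 2 / 2) * ennreal (norm (K (x - y))) \<partial>torus) \<partial>torus)
       = (\<integral>\<^sup>+y. (\<integral>\<^sup>+x. ennreal (g y powr 2 / 2) * ennreal (norm (K (x - y))) \<partial>torus) \<partial>torus)"
      using torus_pair.Fubini'[of "\<lambda>x y. ennreal (g y powr 2 / 2) * ennreal (norm (K (x - y)))"] by simp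
    also have "\<dots> = (\<integral>\<^sup>+y. (\<integral>\<^sup>+x. ennreal (g y powr 2 / 2) * ennreal (norm (K (y - x))) \<partial>torus) \<partial>torus)"
      by (intro nn_integral_cong arg_cong2[where f = "(*)"] arg_cong[where f = ennreal] refl) (use even[of "_ - _"] in simp)
    also have "(\<integral>\<^sup>+x. (\<integral>\<^sup>+y. ennreal (f x powr 2 / 2) * ennreal (norm (K (x - y))) \<partial>torus) \<partial>torus) + \<dots> \<le> ennreal (D / 2) + ennreal (D / 2)"
      by (intro add_mono half f1 g1 f g)
    also have "\<dots> = ennreal D" using D by (simp add: ennreal_plus[symmetric] del: ennreal_plus)
    finally show "(\<integral>\<^sup>+x. (\<integral>\<^sup>+y. ennreal (f x * g y * norm (K (x - y))) \<partial>torus) \<partial>torus) \<le> ennreal D" .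
  qed auto
  then show ?thesis by simp
qed

section \<open>Trigonometric kernels\<close>

lemma torus_integral_cis:
  fixes k :: int
  shows "(LINT y|torus. cis (of_int k * y)) = (if k = 0 then 2 * pi else 0)"
proof (cases "k = 0")
  case True
  have "measure torus (space torus) = 2 * pi"
    using emeasure_torus by (simp add: measure_def)
  then show ?thesis using True by (simp add: scaleR_conv_of_real)
next
  case False
  have [measurable]: "(\<lambda>y. cis (of_int k * y)) \<in> borel_measurable borel"
    by (intro borel_measurable_continuous_onI continuous_intros)
  have "(LINT y|torus. cis (of_int k * y)) = (LINT y|lborel. indicator {0..<2 * pi} y *\<^sub>R cis (of_int k * y))"
    unfolding torus_def by (subst integral_restrict_space) (auto simp: integral_completion)
  also have "\<dots> = (LINT y|lborel. indicator {0..2 * pi} y *\<^sub>R cis (of_int k * y))"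
  proof (rule integral_cong_AE)
    have "AE y in lborel. y \<noteq> 2 * pi" by (rule AE_lborel_singleton)
    then show "AE y in lborel. indicator {0..<2 * pi} y *\<^sub>R cis (of_int k * y) = indicator {0..2 * pi} y *\<^sub>R cis (of_int k * y)"
      by eventually_elim (auto simp: indicator_def)
  qed measurable
  also have "\<dots> = cis (of_int k * (2 * pi)) / (\<i> * of_int k) - cis (of_int k * 0) / (\<i> * of_int k)"
  proof (rule integral_FTC_Icc)
    fix x :: real
    have "((\<lambda>y. cis (of_int k * y) / (\<i> * of_int k)) has_vector_derivative cis (of_int k * x)) (at x)"
    proof -
      have "((\<lambda>z. exp (\<i> * of_int k * z) / (\<i> * of_int k)) has_field_derivative exp (\<i> * of_int k * of_real x)) (at (of_real x))"
        using False by (auto intro!: derivative_eq_intros)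
      from has_vector_derivative_real_field[OF this] show ?thesis
        by (simp add: cis_conv_exp mult_ac)
    qed
    then show "((\<lambda>y. cis (of_int k * y) / (\<i> * of_int k)) has_vector_derivative cis (of_int k * x)) (at x within {0..2 * pi})"
      by (rule has_vector_derivative_at_within)
  qed (auto intro!: continuous_intros)
  also have "cis (of_int k * (2 * pi)) = 1"
    using cis_multiple_2pi[of "of_int k"] by (simp add: mult_ac)
  finally show ?thesis using False by simp
qed

lemma torus_integrable_bounded:
  fixes f :: "real \<Rightarrow> complex"
  assumes "f \<in> borel_measurable torus" "\<And>x. norm (f x) \<le> B"
  shows "integrable torus f"
  by (rule torus.integrable_const_bound[where B = B]) (use assms in auto)

text \<open>The operator is \<open>2 * pi * c\<close> times the orthogonal projection onto the span
  of the characters with the distinct frequencies \<open>n - 2 * j\<close>. The proof is Bessel's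
  inequality. The coefficients \<open>a j\<close> are not divided by \<open>2 * pi\<close>, so that
  factor appears in the norm of \<open>h\<close>.\<close>

lemma torus_opnorm_2_trig:
  assumes c: "0 \<le> c"
  shows "torus_opnorm 2 2 (\<lambda>g. torus_conv g (\<lambda>\<theta>. of_real c * (\<Sum>j\<le>n. cis (of_int (int n - 2 * int j) * \<theta>))))
    \<le> ennreal (2 * pi * c)"
  unfolding torus_opnorm_def
proof (rule SUP_least)
  fix g assume "g \<in> {f \<in> torus_Lp 2. torus_norm 2 f \<le> 1}"
  then have gm[measurable]: "g \<in> borel_measurable torus" and gn: "torus_norm (ennreal 2) g \<le> 1"
    by (auto simp: torus_Lp_def)
  have G1: "(\<integral>\<^sup>+x. ennreal (norm (g x) powr 2) \<partial>torus) \<le> 1"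
    by (rule torus_Lp_unit_ball[OF _ gn]) simp
  define m where "m = (\<lambda>j. int n - 2 * int j)"
  define a where "a = (\<lambda>j. LINT y|torus. g y * cis (of_int (- m j) * y))"
  define h where "h = torus_conv g (\<lambda>\<theta>. of_real c * (\<Sum>j\<le>n. cis (of_int (m j) * \<theta>)))"
  define S where "S = (\<Sum>j\<le>n. (norm (a j))\<^sup>2)"
  have cism[measurable]: "(\<lambda>y. cis (of_int k * y)) \<in> borel_measurable torus" for k
    by (intro sets_torus_borel borel_measurable_continuous_onI continuous_intros)
  have g2i: "integrable torus (\<lambda>x. (norm (g x))\<^sup>2)"
  proof (rule integrableI_bounded)
    show "(\<integral>\<^sup>+x. ennreal (norm ((norm (g x))\<^sup>2)) \<partial>torus) < \<infinity>"
      using G1 by (simp add: order_le_less_trans[OF _ ennreal_one_less_top])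
  qed measurable
  have gi: "integrable torus g"
  proof (rule Bochner_Integration.integrable_bound)
    show "integrable torus (\<lambda>x. 1 + (norm (g x))\<^sup>2)" using g2i by simp
    show "AE x in torus. norm (g x) \<le> norm (1 + (norm (g x))\<^sup>2)"
    proof (intro AE_I2)
      fix x
      have "0 \<le> (norm (g x) - 1)\<^sup>2" by simp
      then have "2 * norm (g x) \<le> 1 + (norm (g x))\<^sup>2" by (simp add: power2_eq_square algebra_simps)
      then have "norm (g x) \<le> 1 + (norm (g x))\<^sup>2" using norm_ge_zero[of "g x"] by linarith
      then show "norm (g x) \<le> norm (1 + (norm (g x))\<^sup>2)" by simp
    qed
  qed measurable
  have gci: "integrable torus (\<lambda>y. g y * cis (of_int k * y))" for k
    by (rule Bochner_Integration.integrable_bound[OF gi]) (auto simp: norm_mult)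
  have hx: "h x = (\<Sum>j\<le>n. of_real c * a j * cis (of_int (m j) * x))" for x
  proof -
    have "h x = (LINT y|torus. (\<Sum>j\<le>n. of_real c * cis (of_int (m j) * x) * (g y * cis (of_int (- m j) * y))))"
      unfolding h_def torus_conv_def
      by (simp add: sum_distrib_left cis_mult right_diff_distrib mult_ac flip: cis_mult cis_divide)
         (simp add: mult.left_commute cis_mult algebra_simps)
    also have "\<dots> = (\<Sum>j\<le>n. LINT y|torus. of_real c * cis (of_int (m j) * x) * (g y * cis (of_int (- m j) * y)))"
      by (intro Bochner_Integration.integral_sum integrable_mult_right gci)
    also have "\<dots> = (\<Sum>j\<le>n. of_real c * cis (of_int (m j) * x) * a j)"
      unfolding a_def by (intro sum.cong refl integral_mult_right_zero)
    finally show ?thesis by (simp add: mult_ac)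
  qed
  have hm[measurable]: "h \<in> borel_measurable torus" unfolding hx[abs_def] by measurable
  have hB: "norm (h x) \<le> (\<Sum>j\<le>n. norm (of_real c * a j))" for x
    unfolding hx by (rule sum_norm_le) (simp add: norm_mult)
  have [measurable]: "cnj \<in> borel_measurable borel"
    by (intro borel_measurable_continuous_onI continuous_intros)
  have hi: "integrable torus (\<lambda>x. h x * cnj (h x))"
    by (rule torus_integrable_bounded[where B = "(\<Sum>j\<le>n. norm (of_real c * a j)) * (\<Sum>j\<le>n. norm (of_real c * a j))"])
       (use hB in \<open>auto simp: norm_mult intro!: mult_mono sum_nonneg\<close>)
  have ghi: "integrable torus (\<lambda>x. g x * cnj (h x))"
  proof (rule Bochner_Integration.integrable_bound)
    show "integrable torus (\<lambda>x. (\<Sum>j\<le>n. norm (of_real c * a j)) * norm (g x))" using gi by simp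
    show "AE x in torus. norm (g x * cnj (h x)) \<le> norm ((\<Sum>j\<le>n. norm (of_real c * a j)) * norm (g x))"
    proof (intro AE_I2)
      fix x
      have "norm (g x) * norm (h x) \<le> norm (g x) * (\<Sum>j\<le>n. norm (of_real c * a j))"
        using hB by (intro mult_left_mono) auto
      then show "norm (g x * cnj (h x)) \<le> norm ((\<Sum>j\<le>n. norm (of_real c * a j)) * norm (g x))"
        by (simp add: norm_mult abs_mult sum_nonneg mult.commute)
    qed
  qed measurable
  have gh: "(LINT x|torus. g x * cnj (h x)) = of_real (c * S)"
  proof -
    have "(LINT x|torus. g x * cnj (h x)) = (LINT x|torus. (\<Sum>j\<le>n. of_real c * cnj (a j) * (g x * cis (of_int (- m j) * x))))"
      unfolding hx by (simp add: cis_cnj sum_distrib_left mult_ac)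
    also have "\<dots> = (\<Sum>j\<le>n. LINT x|torus. of_real c * cnj (a j) * (g x * cis (of_int (- m j) * x)))"
      by (intro Bochner_Integration.integral_sum integrable_mult_right gci)
    also have "\<dots> = (\<Sum>j\<le>n. of_real c * cnj (a j) * a j)"
      unfolding a_def by (intro sum.cong refl integral_mult_right_zero)
    also have "\<dots> = of_real (c * S)"
      by (simp add: S_def sum_distrib_left complex_norm_square[symmetric] mult_ac)
    finally show ?thesis .
  qed
  have hh: "(LINT x|torus. h x * cnj (h x)) = of_real (2 * pi * c\<^sup>2 * S)"
  proof -
    have "(LINT x|torus. h x * cnj (h x)) = (LINT x|torus. (\<Sum>j\<le>n. \<Sum>l\<le>n. (of_real c * a j) * (of_real c * cnj (a l)) * cis (of_int (m j - m l) * x)))"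
    proof (intro Bochner_Integration.integral_cong refl)
      fix x
      have t: "of_real c * a j * cis (of_int (m j) * x) * cnj (of_real c * a l * cis (of_int (m l) * x))
        = (of_real c * a j) * (of_real c * cnj (a l)) * cis (of_int (m j - m l) * x)" for j l
      proof -
        have "cis (of_int (m j - m l) * x) = cis (of_int (m j) * x) * cis (- (of_int (m l) * x))"
          by (simp add: cis_mult left_diff_distrib)
        then show ?thesis by (simp add: cis_cnj)
      qed
      show "h x * cnj (h x) = (\<Sum>j\<le>n. \<Sum>l\<le>n. (of_real c * a j) * (of_real c * cnj (a l)) * cis (of_int (m j - m l) * x))"
        unfolding hx cnj_sum sum_product t ..
    qed
    also have "\<dots> = (\<Sum>j\<le>n. \<Sum>l\<le>n. LINT x|torus. (of_real c * a j) * (of_real c * cnj (a l)) * cis (of_int (m j - m l) * x))"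
    proof -
      have i: "integrable torus (\<lambda>x. u * cis (of_int k * x))" for u k
        by (rule torus_integrable_bounded[where B = "norm u"]) (auto simp: norm_mult)
      show ?thesis by (simp only: Bochner_Integration.integral_sum i Bochner_Integration.integrable_sum)
    qed
    also have "\<dots> = (\<Sum>j\<le>n. \<Sum>l\<le>n. (of_real c * a j) * (of_real c * cnj (a l)) * (if m j - m l = 0 then 2 * pi else 0))"
      by (simp only: integral_mult_right_zero torus_integral_cis)
    also have "\<dots> = (\<Sum>j\<le>n. \<Sum>l\<le>n. if l = j then (of_real c * a j) * (of_real c * cnj (a j)) * (2 * pi) else 0)"
      by (intro sum.cong refl) (auto simp: m_def)
    also have "\<dots> = (\<Sum>j\<le>n. (of_real c * a j) * (of_real c * cnj (a j)) * (2 * pi))"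
      by (intro sum.cong refl) (simp add: sum.delta)
    also have "\<dots> = of_real (2 * pi * c\<^sup>2 * S)"
      by (simp add: S_def sum_distrib_left power2_eq_square[of c] complex_norm_square[symmetric] mult_ac)
    finally show ?thesis .
  qed
  define \<Gamma> where "\<Gamma> = (LINT x|torus. (norm (g x))\<^sup>2)"
  have \<Gamma>1: "\<Gamma> \<le> 1"
  proof -
    have "ennreal \<Gamma> = (\<integral>\<^sup>+x. ennreal ((norm (g x))\<^sup>2) \<partial>torus)"
      unfolding \<Gamma>_def using g2i by (intro nn_integral_eq_integral[symmetric]) auto
    also have "\<dots> \<le> 1" using G1 by simp
    finally show ?thesis by simp
  qed
  have hn: "integrable torus (\<lambda>x. (norm (h x))\<^sup>2)" "(LINT x|torus. (norm (h x))\<^sup>2) = 2 * pi * c\<^sup>2 * S"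
  proof -
    have e: "(norm (h x))\<^sup>2 = Re (h x * cnj (h x))" for x by (simp add: complex_norm_square[symmetric])
    show "integrable torus (\<lambda>x. (norm (h x))\<^sup>2)" unfolding e using hi by (rule integrable_Re)
    show "(LINT x|torus. (norm (h x))\<^sup>2) = 2 * pi * c\<^sup>2 * S"
      unfolding e using integral_Re[OF hi] hh by simp
  qed
  \<comment> \<open>With \<open>gh\<close> and \<open>hh\<close> the expanded square is \<open>(2 *
    pi * c)^2 * \<Gamma> - 4 * pi * c^2 * S + 2 * pi * c^2 * S\<close>. Its nonnegativity is the
    desired bound on the norm of \<open>h\<close>.\<close>
  have "0 \<le> (LINT x|torus. (norm (of_real (2 * pi * c) * g x - h x))\<^sup>2)" by (intro integral_nonneg_AE) simp
  also have "\<dots> = (LINT x|torus. (2 * pi * c)\<^sup>2 * (norm (g x))\<^sup>2 - 2 * (2 * pi * c) * Re (g x * cnj (h x)) + (norm (h x))\<^sup>2)"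
  proof (intro Bochner_Integration.integral_cong refl)
    fix x
    have "(norm (of_real t * u - v))\<^sup>2 = t\<^sup>2 * (norm u)\<^sup>2 - 2 * t * Re (u * cnj v) + (norm v)\<^sup>2" for t and u v :: complex
      unfolding cmod_power2 by (simp add: power2_eq_square algebra_simps)
    then show "(norm (of_real (2 * pi * c) * g x - h x))\<^sup>2
      = (2 * pi * c)\<^sup>2 * (norm (g x))\<^sup>2 - 2 * (2 * pi * c) * Re (g x * cnj (h x)) + (norm (h x))\<^sup>2" .
  qed
  also have "\<dots> = (2 * pi * c)\<^sup>2 * \<Gamma> - 2 * (2 * pi * c) * (c * S) + 2 * pi * c\<^sup>2 * S"
    using g2i hn integrable_Re[OF ghi] integral_Re[OF ghi] gh by (simp add: \<Gamma>_def)
  finally have "2 * pi * c\<^sup>2 * S \<le> (2 * pi * c)\<^sup>2 * \<Gamma>" by (simp add: power2_eq_square algebra_simps)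
  also have "\<dots> \<le> (2 * pi * c)\<^sup>2 * 1" using \<Gamma>1 by (intro mult_left_mono) auto
  finally have le: "2 * pi * c\<^sup>2 * S \<le> (2 * pi * c)\<^sup>2" by simp
  have "(\<integral>\<^sup>+x. ennreal (norm (h x) powr 2) \<partial>torus) = ennreal (2 * pi * c\<^sup>2 * S)"
    using nn_integral_eq_integral[OF hn(1)] hn(2) by simp
  also have "\<dots> \<le> ennreal ((2 * pi * c)\<^sup>2)" using le by (rule ennreal_leI)
  finally have "torus_norm (ennreal 2) h \<le> ennreal (((2 * pi * c)\<^sup>2) powr (1 / 2))"
    by (intro torus_norm_le_powr) auto
  also have "((2 * pi * c)\<^sup>2) powr (1 / 2) = 2 * pi * c" using c by (simp add: powr_half_sqrt)
  finally show "torus_norm 2 (torus_conv g (\<lambda>\<theta>. of_real c * (\<Sum>j\<le>n. cis (of_int (int n - 2 * int j) * \<theta>)))) \<le> ennreal (2 * pi * c)"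
    by (simp add: h_def m_def)
qed

text \<open>For \<open>\<alpha> = \<beta> = 1/2\<close> the function \<open>sin \<theta> P (cos \<theta>)\<close> satisfies \<open>v'' + (n + 1)\<^sup>2 v = 0\<close>.\<close>

lemma jacobi_half_sin:
  assumes ode: "jacobi_ode (1/2) (1/2) n p"
  defines "c \<equiv> poly p 1 / (real n + 1)"
  shows "sin \<theta> * poly p (cos \<theta>) = c * sin ((real n + 1) * \<theta>)"
proof -
  define N where "N = real n + 1"
  define D where "D = poly (pderiv p)"
  define DD where "DD = poly (pderiv (pderiv p))"
  define v where "v = (\<lambda>\<theta>. sin \<theta> * poly p (cos \<theta>))"
  define v' where "v' = (\<lambda>\<theta>. cos \<theta> * poly p (cos \<theta>) - (sin \<theta>)\<^sup>2 * D (cos \<theta>))"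
  have N: "N > 0" by (simp add: N_def)
  have dp: "((\<lambda>\<theta>. poly p (cos \<theta>)) has_real_derivative D (cos t) * - sin t) (at t)" for t
    unfolding D_def by (rule DERIV_chain2[OF poly_DERIV DERIV_cos])
  have dD: "((\<lambda>\<theta>. D (cos \<theta>)) has_real_derivative DD (cos t) * - sin t) (at t)" for t
    unfolding D_def DD_def by (rule DERIV_chain2[OF poly_DERIV DERIV_cos])
  have dv: "(v has_real_derivative v' t) (at t)" for t
    unfolding v_def v'_def by (auto intro!: derivative_eq_intros dp simp: D_def algebra_simps power2_eq_square)
  have dv': "(v' has_real_derivative - (N\<^sup>2 * v t)) (at t)" for t
  proof -
    have "(v' has_real_derivative (sin t * ((1 - (cos t)\<^sup>2) * DD (cos t) - 3 * cos t * D (cos t) - poly p (cos t)))) (at t)"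
      unfolding v'_def by (auto intro!: derivative_eq_intros dp dD simp: D_def DD_def sin_squared_eq[symmetric])
        (simp add: algebra_simps power2_eq_square)
    moreover have "(1 - (cos t)\<^sup>2) * DD (cos t) - 3 * cos t * D (cos t) = - (real n * (real n + 2) * poly p (cos t))"
      using ode[unfolded jacobi_ode_def, rule_format, of "cos t"]
      by (simp add: D_def DD_def jacobi_eigenvalue_def algebra_simps)
    ultimately have "(v' has_real_derivative (sin t * (- (real n * (real n + 2) * poly p (cos t)) - poly p (cos t)))) (at t)"
      by simp
    moreover have "sin t * (- (real n * (real n + 2) * poly p (cos t)) - poly p (cos t)) = - (N\<^sup>2 * v t)"
      by (simp add: v_def N_def algebra_simps power2_eq_square)
    ultimately show ?thesis by simp
  qed
  \<comment> \<open>Uniqueness for the initial value problem: the difference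
    \<open>v - c * sin (N * \<theta>)\<close> solves the oscillator equation, so its energy
    \<open>E\<close> is constant. It vanishes at 0 because \<open>c\<close> was chosen so that
    \<open>c * N = poly p 1\<close>, the initial slope of \<open>v\<close>.\<close>
  define E where "E = (\<lambda>\<theta>. (v' \<theta> - c * N * cos (N * \<theta>))\<^sup>2 + N\<^sup>2 * (v \<theta> - c * sin (N * \<theta>))\<^sup>2)"
  have dE: "(E has_real_derivative 0) (at t)" for t
    unfolding E_def by (auto intro!: derivative_eq_intros dv dv' simp: algebra_simps power2_eq_square)
  have "E \<theta> = E 0" by (rule DERIV_isconst_all) (use dE in auto)
  also have "E 0 = 0" by (simp add: E_def v_def v'_def c_def N_def)
  finally have "N\<^sup>2 * (v \<theta> - c * sin (N * \<theta>))\<^sup>2 = 0"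
    unfolding E_def by (auto simp: add_nonneg_eq_0_iff)
  then show ?thesis using N by (simp add: v_def N_def)
qed

text \<open>Multiplication by \<open>cis \<theta> - cis (-\<theta>)\<close> makes the sum telescope.
  The sine is kept as a factor on the left, so the identity also covers its zeros.\<close>

lemma sum_cis_sin:
  "of_real (sin \<theta>) * (\<Sum>j\<le>n. cis (of_int (int n - 2 * int j) * \<theta>)) = of_real (sin ((real n + 1) * \<theta>))"
proof -
  define f where "f = (\<lambda>j. cis ((real n + 1 - 2 * real j) * \<theta>))"
  have s: "2 * \<i> * of_real (sin t) = cis t - cis (-t)" for t by (simp add: complex_eq_iff)
  have "2 * \<i> * of_real (sin \<theta>) * (\<Sum>j\<le>n. cis (of_int (int n - 2 * int j) * \<theta>)) = (\<Sum>j\<le>n. f j - f (Suc j))"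
    unfolding s sum_distrib_left
    by (intro sum.cong refl) (simp add: f_def left_diff_distrib cis_mult algebra_simps)
  also have "\<dots> = f 0 - f (Suc n)" by (rule sum_telescope)
  also have "\<dots> = 2 * \<i> * of_real (sin ((real n + 1) * \<theta>))"
    unfolding s f_def by (simp add: algebra_simps)
  finally show ?thesis by simp
qed

text \<open>\<open>jacobi_half_sin\<close> and \<open>sum_cis_sin\<close> determine the kernel only
  where the sine is nonzero. If the continuous difference \<open>w\<close> were nonzero at
  \<open>\<theta>\<close>, the sine would vanish on a whole neighbourhood, hence its derivative
  \<open>cos \<theta>\<close> would vanish too, which is impossible.\<close>

lemma jacobi_half_trig:
  assumes ode: "jacobi_ode (1/2) (1/2) n p"
  shows "complex_of_real (poly p (cos \<theta>)) =
    of_real (poly p 1 / (real n + 1)) * (\<Sum>j\<le>n. cis (of_int (int n - 2 * int j) * \<theta>))"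
proof -
  define c where "c = poly p 1 / (real n + 1)"
  define w where "w = (\<lambda>\<theta>. complex_of_real (poly p (cos \<theta>)) - of_real c * (\<Sum>j\<le>n. cis (of_int (int n - 2 * int j) * \<theta>)))"
  have sw: "of_real (sin t) * w t = 0" for t
  proof -
    have "of_real (sin t) * w t = of_real (sin t * poly p (cos t)) - of_real c * (of_real (sin t) * (\<Sum>j\<le>n. cis (of_int (int n - 2 * int j) * t)))"
      by (simp add: w_def algebra_simps)
    also have "\<dots> = 0" unfolding sum_cis_sin jacobi_half_sin[OF ode] c_def by simp
    finally show ?thesis .
  qed
  have "w \<theta> = 0"
  proof (rule ccontr)
    assume nz: "w \<theta> \<noteq> 0"
    have "isCont w \<theta>" unfolding w_def cis_conv_exp by (intro continuous_intros)
    then have "eventually (\<lambda>t. w t \<noteq> 0) (at \<theta>)" using nz by (intro tendsto_imp_eventually_ne) (auto simp: isCont_def)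
    then obtain e where e: "e > 0" "\<And>t. t \<noteq> \<theta> \<Longrightarrow> dist t \<theta> < e \<Longrightarrow> w t \<noteq> 0"
      unfolding eventually_at by auto
    have z: "sin t = 0" if "\<bar>\<theta> - t\<bar> < e" for t
      using e(2)[of t] sw[of t] nz that by (cases "t = \<theta>") (auto simp: dist_real_def abs_minus_commute)
    then have "cos \<theta> = 0" using e(1) by (intro DERIV_local_const[OF DERIV_sin e(1)]) auto
    then show False using z[of \<theta>] e(1) sin_cos_squared_add[of \<theta>] by simp
  qed
  then show ?thesis by (simp add: w_def c_def)
qed

section \<open>Jacobi kernels\<close>

text \<open>The truncated distance \<open>max \<bar>sin (x - y)\<bar> e\<close> satisfies the two
  hypotheses of \<open>hls\<close> on annuli with a constant that does not depend on
  \<open>e\<close>. This uniformity is what later makes the bound uniform in \<open>n\<close>, where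
  \<open>e = 1 / (n + 1)\<close>.\<close>

lemma torus_hls:
  fixes f g :: "real \<Rightarrow> real"
  assumes p: "2 < p" and s: "s = p / (p - 1)" and e: "0 < e"
    and f: "f \<in> borel_measurable torus" and g: "g \<in> borel_measurable torus"
    and f0: "\<And>x. 0 \<le> f x" and g0: "\<And>x. 0 \<le> g x"
    and fs: "(\<integral>\<^sup>+x. ennreal (f x powr s) \<partial>torus) \<le> 1"
    and gs: "(\<integral>\<^sup>+x. ennreal (g x powr s) \<partial>torus) \<le> 1"
  shows "(\<integral>\<^sup>+x. (\<integral>\<^sup>+y. ennreal (f x * g y * max \<bar>sin (x - y)\<bar> e powr (-2/p)) \<partial>torus) \<partial>torus)
    \<le> ennreal (4 * (20 * pi / (1 - 2/p)) + 2)"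
proof (rule hls[OF _ p _ s _ _ _ _ _ f g f0 g0 fs gs])
  have l: "0 < 2 / p" "2 / p < 1" using p by auto
  show "sigma_finite_measure torus" ..
  show "0 \<le> 20 * pi / (1 - 2/p)" using l by simp
  have "(\<lambda>u. max \<bar>sin u\<bar> e) \<in> borel_measurable borel" by measurable
  then show "(\<lambda>(x, y). max \<bar>sin (x - y)\<bar> e) \<in> borel_measurable (torus \<Otimes>\<^sub>M torus)"
    by (rule torus_diff_measurable)
  show "0 < max \<bar>sin (x - y)\<bar> e" for x y using e by simp
  show "max \<bar>sin (x - y)\<bar> e = max \<bar>sin (y - x)\<bar> e" for x y
    using sin_minus[of "y - x"] by simp
  fix x \<rho> :: real assume x: "x \<in> space torus" and r: "0 < \<rho>"
  show "(\<integral>\<^sup>+y. ennreal (max \<bar>sin (x - y)\<bar> e powr (-2/p)) * indicator {y. max \<bar>sin (x - y)\<bar> e \<le> \<rho>} y \<partial>torus)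
    \<le> ennreal (20 * pi / (1 - 2/p) * \<rho> powr (1 - 2/p))"
  proof (cases "e \<le> \<rho>")
    case True
    have "(\<integral>\<^sup>+y. ennreal (max \<bar>sin (x - y)\<bar> e powr (-2/p)) * indicator {y. max \<bar>sin (x - y)\<bar> e \<le> \<rho>} y \<partial>torus)
      \<le> (\<integral>\<^sup>+y. ennreal (max \<bar>sin (x - y)\<bar> e powr (-(2/p))) * indicator {y. \<bar>sin (x - y)\<bar> \<le> \<rho>} y \<partial>torus)"
      by (intro nn_integral_mono) (auto simp: indicator_def)
    also have "\<dots> \<le> ennreal (5 * pi * 2 powr (2/p) * (((\<rho> + e) powr (1 - 2/p) - e powr (1 - 2/p)) / (1 - 2/p)))"
      using e l r x by (intro torus_max_sin_integral) auto
    also have "\<dots> \<le> ennreal (20 * pi / (1 - 2/p) * \<rho> powr (1 - 2/p))"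
    proof (rule ennreal_leI)
      have "(\<rho> + e) powr (1 - 2/p) \<le> (2 * \<rho>) powr (1 - 2/p)"
        using True e l by (intro powr_mono2) auto
      also have "\<dots> = 2 powr (1 - 2/p) * \<rho> powr (1 - 2/p)" by (rule powr_mult)
      finally have "(\<rho> + e) powr (1 - 2/p) - e powr (1 - 2/p) \<le> 2 powr (1 - 2/p) * \<rho> powr (1 - 2/p)"
        using powr_ge_zero[of e "1 - 2/p"] by linarith
      then have "5 * pi * 2 powr (2/p) * (((\<rho> + e) powr (1 - 2/p) - e powr (1 - 2/p)) / (1 - 2/p))
         \<le> 5 * pi * 2 powr (2/p) * (2 powr (1 - 2/p) * \<rho> powr (1 - 2/p) / (1 - 2/p))"
        using l by (intro mult_left_mono divide_right_mono) auto
      also have "\<dots> = 5 * pi * (2 powr (2/p) * 2 powr (1 - 2/p)) / (1 - 2/p) * \<rho> powr (1 - 2/p)" by simp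
      also have "2 powr (2/p) * 2 powr (1 - 2/p) = (2::real)" by (simp flip: powr_add)
      also have "5 * pi * 2 / (1 - 2/p) * \<rho> powr (1 - 2/p) \<le> 20 * pi / (1 - 2/p) * \<rho> powr (1 - 2/p)"
        using l by (intro mult_right_mono divide_right_mono) auto
      finally show "5 * pi * 2 powr (2/p) * (((\<rho> + e) powr (1 - 2/p) - e powr (1 - 2/p)) / (1 - 2/p))
        \<le> 20 * pi / (1 - 2/p) * \<rho> powr (1 - 2/p)" .
    qed
    finally show ?thesis .
  next
    case False
    then have em: "{y. max \<bar>sin (x - y)\<bar> e \<le> \<rho>} = {}" by auto
    show ?thesis unfolding em by simp
  qed
  \<comment> \<open>Where \<open>\<rho> < max \<bar>sin (x - y)\<bar> e\<close>, raising the
    truncation level from \<open>e\<close> to \<open>e'\<close> leaves the maximum unchanged. The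
    far integral is thus a full integral truncated at \<open>e'\<close>, of order
    \<open>1 / e'\<close> and so at most of order \<open>1 / \<rho>\<close>.\<close>
  define e' where "e' = max e \<rho>"
  have e': "e' > 0" "\<rho> \<le> e'" using e by (auto simp: e'_def)
  have "(\<integral>\<^sup>+y. ennreal (max \<bar>sin (x - y)\<bar> e powr (-2)) * indicator {y. \<rho> < max \<bar>sin (x - y)\<bar> e} y \<partial>torus)
    \<le> (\<integral>\<^sup>+y. ennreal (max \<bar>sin (x - y)\<bar> e' powr (-2)) * indicator {y. \<bar>sin (x - y)\<bar> \<le> 1} y \<partial>torus)"
    by (intro nn_integral_mono) (auto simp: indicator_def e'_def max_def)
  also have "\<dots> \<le> ennreal (5 * pi * 2 powr 2 * (((1 + e') powr (1 - 2) - e' powr (1 - 2)) / (1 - 2)))"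
    using e' x by (intro torus_max_sin_integral) auto
  also have "\<dots> \<le> ennreal (20 * pi / (1 - 2/p) / \<rho>)"
  proof (rule ennreal_leI)
    have "5 * pi * 2 powr 2 * (((1 + e') powr (1 - 2) - e' powr (1 - 2)) / (1 - 2)) = 20 * pi * (1 / e' - 1 / (1 + e'))"
      using e' by (simp add: powr_minus_divide)
    also have "\<dots> \<le> 20 * pi * (1 / \<rho>)"
    proof (rule mult_left_mono)
      have "1 / e' \<le> 1 / \<rho>" using e' r by (simp add: frac_le)
      moreover have "0 \<le> 1 / (1 + e')" using e' by simp
      ultimately show "1 / e' - 1 / (1 + e') \<le> 1 / \<rho>" by linarith
    qed simp
    also have "\<dots> \<le> 20 * pi / (1 - 2/p) * (1 / \<rho>)"
    proof (rule mult_right_mono)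
      have "20 * pi / 1 \<le> 20 * pi / (1 - 2/p)" using l by (intro divide_left_mono) auto
      then show "20 * pi \<le> 20 * pi / (1 - 2/p)" by simp
    qed (use r in auto)
    finally show "5 * pi * 2 powr 2 * (((1 + e') powr (1 - 2) - e' powr (1 - 2)) / (1 - 2)) \<le> 20 * pi / (1 - 2/p) / \<rho>"
      by simp
  qed
  finally show "(\<integral>\<^sup>+y. ennreal (max \<bar>sin (x - y)\<bar> e powr (-2)) * indicator {y. \<rho> < max \<bar>sin (x - y)\<bar> e} y \<partial>torus)
    \<le> ennreal (20 * pi / (1 - 2/p) / \<rho>)" .
qed

section \<open>Extended exponents in terms of real ones\<close>

lemma A_bound_real:
  assumes "\<delta> > -1/2" "r > 0"
  shows "A_bound \<delta> (ennreal r / 2) n =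
    (if 2 / r < \<delta> + 1 / 2 then (real n + 1) powr (\<delta> - 2 / r) else (real n + 1) powr (-1/2))"
proof -
  have h: "ennreal r / 2 = ennreal (r / 2)"
    using assms by (simp add: divide_ennreal[symmetric])
  have i: "enn2real (inverse (ennreal (r / 2))) = 2 / r"
    using assms by (simp add: inverse_ennreal)
  have "ennreal (1 / (\<delta> + 1 / 2)) < ennreal (r / 2) \<longleftrightarrow> 1 / (\<delta> + 1 / 2) < r / 2"
    using assms by (intro ennreal_less_iff) auto
  also have "\<dots> \<longleftrightarrow> 2 / r < \<delta> + 1 / 2"
    using assms by (simp add: field_simps)
  finally show ?thesis unfolding A_bound_def h i by simp
qed

lemma A_bound_infinity: "A_bound \<delta> (\<infinity> / 2) n = (real n + 1) powr \<delta>"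
  by (simp add: A_bound_def divide_ennreal_def ennreal_top_mult)

lemma ennreal_inverse_eqD:
  assumes "inverse q = ennreal t" "0 < t"
  shows "q = ennreal (inverse t)"
proof (cases q)
  case (real u)
  then have "u \<noteq> 0" using assms by auto
  then have "ennreal (inverse u) = ennreal t" using assms real by (simp add: inverse_ennreal)
  then show ?thesis using real assms(2) by (metis ennreal_inj inverse_inverse_eq less_imp_le inverse_nonnegative_iff_nonnegative)
qed (use assms in auto)

theorem theorem1p8:
  fixes \<alpha> \<beta> :: real and p p' :: ennreal
  assumes "0 \<le> \<beta>" and "\<beta> \<le> \<alpha>"
    and "\<alpha> > 1 / 2 \<or> (0 \<le> \<alpha> \<and> \<alpha> < 1 / 2) \<or> (\<alpha> = 1 / 2 \<and> \<beta> = 1 / 2)"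
    and "2 \<le> p"
    and "inverse p + inverse p' = 1"
  shows "\<exists>C::real. \<forall>n::nat.
    torus_opnorm p' p (jacobi_conv \<alpha> \<beta> n) \<le> ennreal (C * A_bound \<alpha> (p / 2) n)"
proof -
  define a where "a = \<alpha> + 1/2"
  have \<alpha>0: "0 \<le> \<alpha>" using assms by linarith
  then have a0: "a > 0" by (simp add: a_def)
  define N where "N = (\<lambda>n::nat. real n + 1)"
  have N1: "N n \<ge> 1" for n by (simp add: N_def)
  have iN: "(1 / N n) powr t = N n powr (- t)" for n t
    using N1[of n] by (simp add: powr_divide powr_minus_divide)
  define K where "K = (\<lambda>n \<theta>. complex_of_real (poly (jacobi \<alpha> \<beta> n) (cos \<theta>)))"
  define d where "d = (\<lambda>n \<theta>. max \<bar>sin \<theta>\<bar> (1 / N n))"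
  obtain C0 where C0: "C0 > 0" "\<And>n x. x \<in> {-1..1} \<Longrightarrow> \<bar>poly (jacobi \<alpha> \<beta> n) x\<bar>
     \<le> C0 * (real n + 1) powr (-1/2) * max (sqrt (1 - x\<^sup>2)) (1 / (real n + 1)) powr (- (\<alpha> + 1/2))"
    using jacobi_pointwise_bound[OF assms(1,2)] by blast
  have conv: "jacobi_conv \<alpha> \<beta> n = (\<lambda>g. torus_conv g (K n))" for n
    by (simp add: jacobi_conv_def K_def fun_eq_iff)
  have Km: "K n \<in> borel_measurable borel" for n
    unfolding K_def by (intro borel_measurable_continuous_onI continuous_intros)
  have dN: "1 / N n \<le> d n \<theta>" and dp: "0 < d n \<theta>" and d1: "d n \<theta> \<le> 1" for n \<theta>
    using N1[of n] by (auto simp: d_def less_max_iff_disj)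
  have Kd: "norm (K n \<theta>) \<le> C0 * N n powr (-1/2) * d n \<theta> powr (-a)" for n \<theta>
  proof -
    have "sqrt (1 - (cos \<theta>)\<^sup>2) = \<bar>sin \<theta>\<bar>" by (simp flip: sin_squared_eq)
    then show ?thesis using C0(2)[of "cos \<theta>" n] by (simp add: K_def N_def d_def a_def)
  qed
  have sup: "norm (K n \<theta>) \<le> C0 * N n powr \<alpha>" for n \<theta>
  proof -
    have "d n \<theta> powr (-a) \<le> (1 / N n) powr (-a)"
      using a0 dN N1[of n] by (intro powr_mono2') auto
    also have "\<dots> = N n powr a" by (simp only: iN minus_minus)
    finally have "C0 * N n powr (-1/2) * d n \<theta> powr (-a) \<le> C0 * N n powr (-1/2) * N n powr a"
      using C0(1) by (intro mult_left_mono) auto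
    also have "\<dots> = C0 * N n powr \<alpha>"
      by (simp add: a_def mult.assoc flip: powr_add)
    finally show ?thesis using Kd[of n \<theta>] by linarith
  qed
  show ?thesis
  proof (cases p)
    case top
    then have "inverse p' = 1" using assms(5) by simp
    then have p': "p' = 1" using ennreal_inverse_eqD[of p' 1] by simp
    show ?thesis
    proof (intro exI allI)
      fix n
      have "torus_opnorm 1 \<infinity> (\<lambda>g. torus_conv g (K n)) \<le> ennreal (C0 * N n powr \<alpha>)"
        using Km sup by (rule torus_opnorm_1_infinity)
      then show "torus_opnorm p' p (jacobi_conv \<alpha> \<beta> n) \<le> ennreal (C0 * A_bound \<alpha> (p / 2) n)"
        using top p' A_bound_infinity[of \<alpha> n] by (simp add: conv N_def)
    qed
  next
    case (real r)
    have r2: "r \<ge> 2" using assms(4) real by (metis ennreal_le_iff ennreal_numeral)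
    define s where "s = r / (r - 1)"
    have p': "p' = ennreal s"
    proof -
      have "inverse p = ennreal (1 / r)" using real r2 by (simp add: inverse_ennreal divide_inverse)
      then have "ennreal (1 / r) + inverse p' = 1" using assms(5) by simp
      then have "inverse p' = 1 - ennreal (1 / r)"
        by (metis ennreal_add_diff_cancel_left ennreal_neq_top)
      also have "\<dots> = ennreal (1 - 1 / r)" using r2 by (simp add: ennreal_minus flip: ennreal_1)
      finally have "p' = ennreal (inverse (1 - 1 / r))" using r2 by (intro ennreal_inverse_eqD) auto
      also have "inverse (1 - 1 / r) = s" using r2 by (simp add: s_def field_simps)
      finally show ?thesis .
    qed
    define A where "A = (\<lambda>n. A_bound \<alpha> (p / 2) n)"
    have A: "A n = (if 2 / r < a then N n powr (\<alpha> - 2 / r) else N n powr (-1/2))" for n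
      unfolding A_def real(2) using \<alpha>0 r2 by (subst A_bound_real) (auto simp: a_def N_def)
    have A0: "A n \<ge> 0" for n by (simp add: A)
    show ?thesis
    proof (cases "r = 2")
      case False
      then have r: "2 < r" using r2 by simp
      define c where "c = 4 * (20 * pi / (1 - 2/r)) + 2"
      have c0: "c \<ge> 0" using r by (simp add: c_def)
      \<comment> \<open>If \<open>2 / r < a\<close>, the excess singularity
        \<open>d powr (-(a - 2/r))\<close> is replaced by its largest value, attained at
        \<open>d = 1 / N\<close>, which produces the growing power of \<open>N\<close> in
        \<open>A\<close>. Otherwise \<open>d \<le> 1\<close> allows the exponent to be enlarged at
        no cost in \<open>N\<close>. The critical case \<open>2 / r = a\<close> belongs to the
        second alternative.\<close>
      have KA: "norm (K n \<theta>) \<le> C0 * A n * d n \<theta> powr (-2/r)" for n \<theta>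
      proof -
        have "N n powr (-1/2) * d n \<theta> powr (-a) \<le> A n * d n \<theta> powr (-2/r)"
        proof (cases "2 / r < a")
          case True
          have "d n \<theta> powr (-a) = d n \<theta> powr (-(a - 2/r)) * d n \<theta> powr (-2/r)"
            by (simp flip: powr_add)
          also have "\<dots> \<le> (1 / N n) powr (-(a - 2/r)) * d n \<theta> powr (-2/r)"
            using True dN N1[of n] by (intro mult_right_mono powr_mono2') auto
          also have "(1 / N n) powr (-(a - 2/r)) = N n powr (a - 2/r)"
            by (simp only: iN minus_minus)
          finally have "N n powr (-1/2) * d n \<theta> powr (-a) \<le> N n powr (-1/2) * (N n powr (a - 2/r) * d n \<theta> powr (-2/r))"
            by (intro mult_left_mono) auto
          also have "\<dots> = N n powr (-1/2 + (a - 2/r)) * d n \<theta> powr (-2/r)"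
            by (simp only: powr_add mult.assoc)
          also have "-1/2 + (a - 2/r) = \<alpha> - 2/r" by (simp add: a_def)
          also have "N n powr (\<alpha> - 2/r) * d n \<theta> powr (-2/r) = A n * d n \<theta> powr (-2/r)"
            using True by (simp only: A if_True)
          finally show ?thesis .
        next
          case False
          then have "d n \<theta> powr (-a) \<le> d n \<theta> powr (-2/r)"
            using dp d1 by (intro powr_mono') (auto simp: less_imp_le)
          then show ?thesis using False by (simp add: A mult_left_mono)
        qed
        then have "C0 * (N n powr (-1/2) * d n \<theta> powr (-a)) \<le> C0 * (A n * d n \<theta> powr (-2/r))"
          using C0(1) by (intro mult_left_mono) auto
        then show ?thesis using Kd[of n \<theta>] by (simp add: mult.assoc)
      qed
      show ?thesis
      proof (intro exI allI)
        fix n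
        have "torus_opnorm (ennreal s) (ennreal r) (\<lambda>g. torus_conv g (K n)) \<le> ennreal (C0 * c * A n)"
        \<comment> \<open>The supremum bound \<open>sup\<close> serves as the a priori bound on the
          kernel. The dependence on \<open>n\<close> comes from the bilinear estimate.\<close>
        proof (rule torus_opnorm_le_bilinear[OF _ s_def Km sup])
          show "0 \<le> C0 * c * A n" using C0(1) c0 A0 by simp
          fix f g :: "real \<Rightarrow> real"
          assume f[measurable]: "f \<in> borel_measurable torus" and g[measurable]: "g \<in> borel_measurable torus"
            and f0: "\<And>x. 0 \<le> f x" and g0: "\<And>x. 0 \<le> g x"
            and f1: "(\<integral>\<^sup>+x. ennreal (f x powr s) \<partial>torus) \<le> 1" and g1: "(\<integral>\<^sup>+x. ennreal (g x powr s) \<partial>torus) \<le> 1"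
          have dm: "(\<lambda>(x, y). d n (x - y)) \<in> borel_measurable (torus \<Otimes>\<^sub>M torus)"
            unfolding d_def by (rule torus_diff_measurable) measurable
          then have [measurable]: "(\<lambda>(x, y). d n (x - y)) \<in> borel_measurable (torus \<Otimes>\<^sub>M torus)" .
          have "(\<integral>\<^sup>+x. (\<integral>\<^sup>+y. ennreal (f x * g y * norm (K n (x - y))) \<partial>torus) \<partial>torus)
            \<le> (\<integral>\<^sup>+x. (\<integral>\<^sup>+y. ennreal (C0 * A n) * ennreal (f x * g y * d n (x - y) powr (-2/r)) \<partial>torus) \<partial>torus)"
          proof (intro nn_integral_mono)
            fix x y
            have "f x * g y * norm (K n (x - y)) \<le> f x * g y * (C0 * A n * d n (x - y) powr (-2/r))"
              by (intro mult_left_mono KA mult_nonneg_nonneg f0 g0)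
            then have "ennreal (f x * g y * norm (K n (x - y))) \<le> ennreal (C0 * A n * (f x * g y * d n (x - y) powr (-2/r)))"
              by (intro ennreal_leI) (simp add: mult_ac)
            also have "\<dots> = ennreal (C0 * A n) * ennreal (f x * g y * d n (x - y) powr (-2/r))"
              using C0(1) A0 f0 g0 by (intro ennreal_mult) auto
            finally show "ennreal (f x * g y * norm (K n (x - y))) \<le> ennreal (C0 * A n) * ennreal (f x * g y * d n (x - y) powr (-2/r))" .
          qed
          also have "\<dots> = (\<integral>\<^sup>+x. ennreal (C0 * A n) * (\<integral>\<^sup>+y. ennreal (f x * g y * d n (x - y) powr (-2/r)) \<partial>torus) \<partial>torus)"
          proof (intro nn_integral_cong nn_integral_cmult)
            fix x assume "x \<in> space torus"
            then have [measurable]: "(\<lambda>y. d n (x - y)) \<in> borel_measurable torus"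
              using measurable_compose[OF measurable_Pair1' dm] by simp
            show "(\<lambda>y. ennreal (f x * g y * d n (x - y) powr (-2/r))) \<in> borel_measurable torus" by measurable
          qed
          also have "\<dots> = ennreal (C0 * A n) * (\<integral>\<^sup>+x. (\<integral>\<^sup>+y. ennreal (f x * g y * d n (x - y) powr (-2/r)) \<partial>torus) \<partial>torus)"
            by (rule nn_integral_cmult) measurable
          also have "\<dots> \<le> ennreal (C0 * A n) * ennreal c"
            unfolding d_def c_def
            by (intro mult_left_mono torus_hls[OF r s_def _ f g f0 g0 f1 g1]) (use N1[of n] in auto)
          also have "\<dots> = ennreal (C0 * c * A n)"
            using C0(1) A0 c0 by (simp add: mult_ac flip: ennreal_mult)
          finally show "(\<integral>\<^sup>+x. (\<integral>\<^sup>+y. ennreal (f x * g y * norm (K n (x - y))) \<partial>torus) \<partial>torus) \<le> ennreal (C0 * c * A n)" .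
        qed (use r in auto)
        then show "torus_opnorm p' p (jacobi_conv \<alpha> \<beta> n) \<le> ennreal (C0 * c * A_bound \<alpha> (p / 2) n)"
          by (simp add: conv p' real A_def)
      qed
    next
      case two: True
      have pp: "p = 2" "p' = 2" using two real p' by (simp_all add: s_def)
      show ?thesis
      proof (cases "\<alpha> = 1/2")
        case True
        then have \<beta>: "\<beta> = 1/2" using assms by auto
        show ?thesis
        proof (intro exI allI)
          fix n
          define P where "P = jacobi \<alpha> \<beta> n"
          have P: "P = jacobi_poly (1/2) (1/2) n" by (simp add: P_def jacobi_eq_jacobi_poly True \<beta>)
          \<comment> \<open>The amplitude in \<open>jacobi_half_trig\<close>. The endpoint value has
            order \<open>N powr (1/2)\<close>, so \<open>c\<close> has order
            \<open>N powr (-1/2)\<close>. This is \<open>A n\<close>, because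
            \<open>2 / r = 1\<close> is not below \<open>a = 1\<close>.\<close>
          define c where "c = poly P 1 / N n"
          have P1: "poly P 1 = (real n + 1/2) gchoose n" by (simp add: P jacobi_poly_at_1)
          have c0: "c \<ge> 0" using gbinomial_harm_bound(2)[of "1/2" n] N1[of n] by (simp add: c_def P1)
          have "poly P 1 \<le> exp (1/2) * N n powr (1/2)"
            using gbinomial_powr_bound[of "1/2" n] by (simp add: P1 N_def)
          then have "c \<le> exp (1/2) * N n powr (1/2) / N n powr 1"
            using N1[of n] by (simp add: c_def divide_right_mono)
          also have "\<dots> = exp (1/2) * N n powr (1/2 - 1)" by (simp only: powr_diff times_divide_eq_right)
          also have "(1/2 - 1 :: real) = -1/2" by simp
          finally have cN: "c \<le> exp (1/2) * N n powr (-1/2)" .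
          have "K n = (\<lambda>\<theta>. of_real c * (\<Sum>j\<le>n. cis (of_int (int n - 2 * int j) * \<theta>)))"
          proof
            fix \<theta>
            show "K n \<theta> = of_real c * (\<Sum>j\<le>n. cis (of_int (int n - 2 * int j) * \<theta>))"
              using jacobi_half_trig[OF jacobi_poly_ode, of n \<theta>] by (simp add: K_def c_def P_def[symmetric] P N_def)
          qed
          then have "torus_opnorm 2 2 (\<lambda>g. torus_conv g (K n)) \<le> ennreal (2 * pi * c)"
            using torus_opnorm_2_trig[OF c0, of n] by simp
          also have "\<dots> \<le> ennreal (2 * pi * exp (1/2) * A n)"
          proof (rule ennreal_leI)
            have "A n = N n powr (-1/2)" using True two by (simp add: A a_def)
            then show "2 * pi * c \<le> 2 * pi * exp (1/2) * A n" using cN by simp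
          qed
          finally show "torus_opnorm p' p (jacobi_conv \<alpha> \<beta> n) \<le> ennreal (2 * pi * exp (1/2) * A_bound \<alpha> (p / 2) n)"
            by (simp add: conv pp A_def)
        qed
      next
        case False
        then have a1: "a \<noteq> 1" by (simp add: a_def)
        define c where "c = C0 * (5 * pi * 2 powr a * (2 / \<bar>a - 1\<bar>))"
        have c0: "c \<ge> 0" using C0(1) by (simp add: c_def)
        \<comment> \<open>The quotient is the integral of \<open>max s (1/N) powr (-a)\<close> up to
          a constant. For \<open>a < 1\<close> it is bounded, and
          \<open>A n = N powr (-1/2)\<close>. For \<open>a > 1\<close> it has order
          \<open>N powr (a - 1)\<close>, and \<open>-1/2 + (a - 1)\<close> is the exponent
          \<open>\<alpha> - 2 / r\<close> of \<open>A\<close> at \<open>r = 2\<close>. The generous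
          factor 2 in the second case gives both cases the same constant.\<close>
        have bound: "N n powr (-1/2) * (((1 + 1 / N n) powr (1 - a) - (1 / N n) powr (1 - a)) / (1 - a)) \<le> 2 / \<bar>a - 1\<bar> * A n" for n
        proof (cases "a < 1")
          case True
          have "(1 + 1 / N n) powr (1 - a) \<le> 2 powr (1 - a)" using True N1[of n] by (intro powr_mono2) auto
          also have "\<dots> \<le> 2 powr 1" using a0 by (intro powr_mono) auto
          also have "2 powr 1 = (2 :: real)" by simp
          finally have "(1 + 1 / N n) powr (1 - a) - (1 / N n) powr (1 - a) \<le> 2"
            using powr_ge_zero[of "1 / N n" "1 - a"] by linarith
          then have "((1 + 1 / N n) powr (1 - a) - (1 / N n) powr (1 - a)) / (1 - a) \<le> 2 / (1 - a)"
            using True by (intro divide_right_mono) auto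
          then have "N n powr (-1/2) * (((1 + 1 / N n) powr (1 - a) - (1 / N n) powr (1 - a)) / (1 - a)) \<le> N n powr (-1/2) * (2 / (1 - a))"
            by (intro mult_left_mono) auto
          then show ?thesis using True two by (simp add: A mult.commute)
        next
          case False
          then have a: "a > 1" using a1 by simp
          have "(1 / N n) powr (1 - a) = N n powr (a - 1)"
            by (simp only: iN minus_diff_eq)
          then have "((1 + 1 / N n) powr (1 - a) - (1 / N n) powr (1 - a)) / (1 - a)
             = (N n powr (a - 1) - (1 + 1 / N n) powr (1 - a)) / (a - 1)"
            using a by (simp add: field_simps)
          also have "\<dots> \<le> 2 * N n powr (a - 1) / (a - 1)"
          proof (rule divide_right_mono)
            show "N n powr (a - 1) - (1 + 1 / N n) powr (1 - a) \<le> 2 * N n powr (a - 1)"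
              using powr_ge_zero[of "1 + 1 / N n" "1 - a"] powr_ge_zero[of "N n" "a - 1"] by linarith
          qed (use a in simp)
          finally have "N n powr (-1/2) * (((1 + 1 / N n) powr (1 - a) - (1 / N n) powr (1 - a)) / (1 - a))
            \<le> N n powr (-1/2) * (2 * N n powr (a - 1) / (a - 1))" by (intro mult_left_mono) auto
          also have "\<dots> = 2 / (a - 1) * (N n powr (-1/2) * N n powr (a - 1))" by simp
          also have "N n powr (-1/2) * N n powr (a - 1) = N n powr (-1/2 + (a - 1))"
            by (simp only: powr_add)
          also have "-1/2 + (a - 1) = \<alpha> - 2/r" using two by (simp add: a_def)
          also have "N n powr (\<alpha> - 2/r) = A n"
            using a two by (simp add: A)
          finally show ?thesis using a by simp
        qed
        show ?thesis
        proof (intro exI allI)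
          fix n
          have "torus_opnorm 2 2 (\<lambda>g. torus_conv g (K n)) \<le> ennreal (c * A n)"
          proof (rule torus_opnorm_2_le_L1[OF Km sup])
            show "0 \<le> c * A n" using c0 A0 by simp
            show "norm (K n (- \<theta>)) = norm (K n \<theta>)" for \<theta> by (simp add: K_def)
            fix x assume x: "x \<in> space torus"
            have "(\<integral>\<^sup>+y. ennreal (norm (K n (x - y))) \<partial>torus)
              \<le> (\<integral>\<^sup>+y. ennreal (C0 * N n powr (-1/2)) * (ennreal (max \<bar>sin (x - y)\<bar> (1 / N n) powr (-a)) * indicator {y. \<bar>sin (x - y)\<bar> \<le> 1} y) \<partial>torus)"
            proof (rule nn_integral_mono)
              fix y
              have "ennreal (norm (K n (x - y))) \<le> ennreal (C0 * N n powr (-1/2) * d n (x - y) powr (-a))"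
                by (intro ennreal_leI Kd)
              also have "\<dots> = ennreal (C0 * N n powr (-1/2)) * ennreal (d n (x - y) powr (-a))"
                using C0(1) by (intro ennreal_mult) auto
              finally show "ennreal (norm (K n (x - y))) \<le> ennreal (C0 * N n powr (-1/2)) * (ennreal (max \<bar>sin (x - y)\<bar> (1 / N n) powr (-a)) * indicator {y. \<bar>sin (x - y)\<bar> \<le> 1} y)"
                by (simp add: d_def)
            qed
            also have "\<dots> = ennreal (C0 * N n powr (-1/2)) * (\<integral>\<^sup>+y. ennreal (max \<bar>sin (x - y)\<bar> (1 / N n) powr (-a)) * indicator {y. \<bar>sin (x - y)\<bar> \<le> 1} y \<partial>torus)"
              by (intro nn_integral_cmult sets_torus_borel) measurable
            also have "\<dots> \<le> ennreal (C0 * N n powr (-1/2)) * ennreal (5 * pi * 2 powr a * (((1 + 1 / N n) powr (1 - a) - (1 / N n) powr (1 - a)) / (1 - a)))"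
              using a0 a1 x N1[of n] by (intro mult_left_mono torus_max_sin_integral) auto
            also have "\<dots> = ennreal (C0 * N n powr (-1/2) * (5 * pi * 2 powr a * (((1 + 1 / N n) powr (1 - a) - (1 / N n) powr (1 - a)) / (1 - a))))"
              using C0(1) by (intro ennreal_mult'[symmetric]) auto
            also have "\<dots> = ennreal (C0 * (5 * pi * 2 powr a) * (N n powr (-1/2) * (((1 + 1 / N n) powr (1 - a) - (1 / N n) powr (1 - a)) / (1 - a))))"
              by (simp only: mult_ac)
            also have "\<dots> \<le> ennreal (C0 * (5 * pi * 2 powr a) * (2 / \<bar>a - 1\<bar> * A n))"
              using C0(1) by (intro ennreal_leI mult_left_mono bound) auto
            also have "\<dots> = ennreal (c * A n)" by (simp add: c_def mult_ac)
            finally show "(\<integral>\<^sup>+y. ennreal (norm (K n (x - y))) \<partial>torus) \<le> ennreal (c * A n)" .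
          qed
          then show "torus_opnorm p' p (jacobi_conv \<alpha> \<beta> n) \<le> ennreal (c * A_bound \<alpha> (p / 2) n)"
            by (simp add: conv pp A_def)
        qed
      qed
    qed
  qed
qed

end
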